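(* Fix $\alpha\in(0,1]$. Let $P$ be a Borel probability measure on $\mathbb{R}^d$ supported on a compact convex set $\mathcal{X}\subset\mathbb{R}^d$ with nonempty interior (so $\mathcal{X}=\mathrm{supp}\,P$), having a Lebesgue density $\rho$ that is Lipschitz continuous and strictly positive on $\mathcal{X}$. Let $\mathcal{Y}=\{y_1,\dots,y_N\}\subset\mathbb{R}^d$ be a finite set of distinct points and let $c_0\in(0,1)$. Then there exists a constant $C>0$ depending only on $\alpha,\mathcal{X},\rho,\mathcal{Y}$ and $c_0$ such that for every probability measure $Q$ with support $\mathcal{Y}$ and masses $q_i=Q(\{y_i\})$ satisfying $\min_{1\le i\le N}q_i\ge c_0$, and every $\alpha$-Hölder vector field $\varphi:\mathcal{X}\to\mathbb{R}^d$, $$ \big|\langle\varphi,T^\varepsilon-T^0\rangle_{L^2(P)}\big|\le C\big(\|\varphi\|_\infty\,\varepsilon^2\log^3(1/\varepsilon)+\|\varphi\|_{\mathcal{C}^\alpha}\,\varepsilon^{1+\alpha}\big)\qquad\text{for all }\varepsilon\in(0,1), $$ where $T^0$ is the Brenier map and $T^\varepsilon$ the entropic map from $P$ to $Q$.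
   Context: $\|\cdot\|$ and $\langle\cdot,\cdot\rangle$ are the Euclidean norm and inner product; $\mathbb{1}_N\in\mathbb{R}^N$ is the vector of ones; $q=(q_1,\dots,q_N)^\intercal$. Brenier map. Let $z^0\in\mathbb{R}^N$ be the unique (under the stated conditions on $P$) minimizer of $z\mapsto\int\max_{1\le i\le N}(\langle x,y_i\rangle-z_i)\,dP(x)+\langle z,q\rangle$ subject to $\langle z,\mathbb{1}_N\rangle=0$. The Laguerre cells are $C_i(z)=\bigcap_{j\ne i}\{x\in\mathcal{X}:\langle y_i-y_j,x\rangle\ge z_i-z_j\}$; they partition $\mathcal{X}$ up to Lebesgue-null sets. The Brenier map is the $P$-a.e. defined map $T^0(x)=y_i$ for $x\in C_i(z^0)$, $i=1,\dots,N$. (It induces the optimal coupling in $\sup_{\pi\in\Pi(P,Q)}\int\langle x,y\rangle\,d\pi(x,y)$, where $\Pi(P,Q)$ is the set of couplings of $P$ and $Q$.) Entropic map. For $\varepsilon>0$ let $z^\varepsilon\in\mathbb{R}^N$ be the unique minimizer of $z\mapsto\int\varepsilon\log\big(\sum_{i=1}^N e^{(\langle x,y_i\rangle-z_i)/\varepsilon}\big)\,dP(x)+\langle z,q\rangle$ subject to $\langle z,\mathbb{1}_N\rangle=0$. The entropic map is $$T^\varepsilon(x)=\sum_{i=1}^N y_i\,\frac{e^{(\langle x,y_i\rangle-z_i^\varepsilon)/\varepsilon}}{\sum_{j=1}^N e^{(\langle x,y_j\rangle-z_j^\varepsilon)/\varepsilon}},\quad x\in\mathcal{X}.$$ (Equivalently,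 $T^\varepsilon(x)=\mathbb{E}_{(X,Y)\sim\pi^\varepsilon}[Y\mid X=x]$, where $\pi^\varepsilon$ is the unique maximizer of $\int\langle x,y\rangle\,d\pi-\varepsilon D_{\mathsf{KL}}(\pi\|P\otimes Q)$ over $\Pi(P,Q)$.) Norms. $\langle\varphi,T\rangle_{L^2(P)}=\int\langle\varphi(x),T(x)\rangle\,dP(x)$; $\|\varphi\|_\infty=\sup_{x\in\mathcal{X}}\|\varphi(x)\|$; $\|\varphi\|_{\mathcal{C}^\alpha}=\|\varphi\|_\infty+\sup_{x\ne y\in\mathcal{X}}\|\varphi(x)-\varphi(y)\|/\|x-y\|^\alpha$. A vector field is $\alpha$-Hölder if $\|\varphi\|_{\mathcal{C}^\alpha}<\infty$. *)

theory Defs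
  imports "HOL-Probability.Probability"
begin

definition measure_support :: "'a::topological_space measure \<Rightarrow> 'a set" where
  "measure_support M = {x. \<forall>U. open U \<and> x \<in> U \<longrightarrow> 0 < emeasure M U}"

text \<open>The target points are a family \<open>y\<close> indexed by a finite type \<open>'n\<close>, so that \<open>N = CARD('n)\<close>
  and the potentials \<open>z\<close> live in \<open>real^'n\<close>.\<close>

definition masses :: "'a measure \<Rightarrow> ('n::finite \<Rightarrow> 'a) \<Rightarrow> real^'n" where
  "masses Q y = (\<chi> i. measure Q {y i})"

definition semidual :: "'a::euclidean_space measure \<Rightarrow> 'a measure \<Rightarrow> ('n::finite \<Rightarrow> 'a) \<Rightarrow> real^'n \<Rightarrow> real" where
  "semidual P Q y z = (LINT x|P. (MAX i\<in>UNIV. x \<bullet> y i - z $ i)) + z \<bullet> masses Q y"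

definition entropic_semidual ::
    "'a::euclidean_space measure \<Rightarrow> 'a measure \<Rightarrow> ('n::finite \<Rightarrow> 'a) \<Rightarrow> real \<Rightarrow> real^'n \<Rightarrow> real" where
  "entropic_semidual P Q y \<epsilon> z =
     (LINT x|P. \<epsilon> * ln (\<Sum>i\<in>UNIV. exp ((x \<bullet> y i - z $ i) / \<epsilon>))) + z \<bullet> masses Q y"

text \<open>Here \<open>vec 1\<close> is the vector of ones.\<close>

definition brenier_potential :: "'a::euclidean_space measure \<Rightarrow> 'a measure \<Rightarrow> ('n::finite \<Rightarrow> 'a) \<Rightarrow> real^'n" where
  "brenier_potential P Q y = (THE z. is_arg_min (semidual P Q y) (\<lambda>z. z \<bullet> vec 1 = 0) z)"

definition entropic_potential ::
    "'a::euclidean_space measure \<Rightarrow> 'a measure \<Rightarrow> ('n::finite \<Rightarrow> 'a) \<Rightarrow> real \<Rightarrow> real^'n" where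
  "entropic_potential P Q y \<epsilon> =
     (THE z. is_arg_min (entropic_semidual P Q y \<epsilon>) (\<lambda>z. z \<bullet> vec 1 = 0) z)"

definition laguerre_cell :: "'a::euclidean_space set \<Rightarrow> ('n::finite \<Rightarrow> 'a) \<Rightarrow> real^'n \<Rightarrow> 'n \<Rightarrow> 'a set" where
  "laguerre_cell X y z i = {x \<in> X. \<forall>j. j \<noteq> i \<longrightarrow> (y i - y j) \<bullet> x \<ge> z $ i - z $ j}"

text \<open>The cells cover \<open>X\<close> and, for distinct points, overlap only in a Lebesgue-null set. So if \<open>P\<close>
  is absolutely continuous and carried by \<open>X\<close>, the choice made by \<open>SOME\<close> and the values off \<open>X\<close> affect
  the map only on a \<open>P\<close>-null set.\<close>

definition brenier_map ::
    "'a::euclidean_space set \<Rightarrow> 'a measure \<Rightarrow> 'a measure \<Rightarrow> ('n::finite \<Rightarrow> 'a) \<Rightarrow> 'a \<Rightarrow> 'a" where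
  "brenier_map X P Q y x = y (SOME i. x \<in> laguerre_cell X y (brenier_potential P Q y) i)"

definition entropic_map ::
    "'a::euclidean_space measure \<Rightarrow> 'a measure \<Rightarrow> ('n::finite \<Rightarrow> 'a) \<Rightarrow> real \<Rightarrow> 'a \<Rightarrow> 'a" where
  "entropic_map P Q y \<epsilon> x =
     (let z = entropic_potential P Q y \<epsilon> in
      \<Sum>i\<in>UNIV. (exp ((x \<bullet> y i - z $ i) / \<epsilon>) / (\<Sum>j\<in>UNIV. exp ((x \<bullet> y j - z $ j) / \<epsilon>))) *\<^sub>R y i)"

text \<open>A field on \<open>X\<close> is a total function whose values off \<open>X\<close> are arbitrary (possibly not even
  measurable), hence the integral is restricted to \<open>X\<close>, which carries all the mass of \<open>P\<close>.\<close>

definition L2_inner_on :: "'a::euclidean_space set \<Rightarrow> 'a measure \<Rightarrow> ('a \<Rightarrow> 'a) \<Rightarrow> ('a \<Rightarrow> 'a) \<Rightarrow> real" where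
  "L2_inner_on X P \<phi> T = (LINT x:X|P. \<phi> x \<bullet> T x)"

definition sup_norm_on :: "'a set \<Rightarrow> ('a \<Rightarrow> 'b::real_normed_vector) \<Rightarrow> real" where
  "sup_norm_on X \<phi> = (SUP x\<in>X. norm (\<phi> x))"

definition holder_quotients ::
    "real \<Rightarrow> 'a::real_normed_vector set \<Rightarrow> ('a \<Rightarrow> 'b::real_normed_vector) \<Rightarrow> real set" where
  "holder_quotients \<alpha> X \<phi> =
     {norm (\<phi> u - \<phi> v) / norm (u - v) powr \<alpha> | u v. u \<in> X \<and> v \<in> X \<and> u \<noteq> v}"

definition holder_norm_on ::
    "real \<Rightarrow> 'a::real_normed_vector set \<Rightarrow> ('a \<Rightarrow> 'b::real_normed_vector) \<Rightarrow> real" where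
  "holder_norm_on \<alpha> X \<phi> = sup_norm_on X \<phi> + Sup (holder_quotients \<alpha> X \<phi>)"

text \<open>Finiteness of the Hoelder norm: both suprema are real-valued here and are meaningful only for
  sets that are bounded above.\<close>

definition holder_on ::
    "real \<Rightarrow> 'a::real_normed_vector set \<Rightarrow> ('a \<Rightarrow> 'b::real_normed_vector) \<Rightarrow> bool" where
  "holder_on \<alpha> X \<phi> \<longleftrightarrow>
     bdd_above ((\<lambda>x. norm (\<phi> x)) ` X) \<and> bdd_above (holder_quotients \<alpha> X \<phi>)"

end

theory Submission imports Defs "HOL-Real_Asymp.Real_Asymp"
begin

text \<open>Write \<open>D\<^sub>i x = x \<bullet> y i - z $ i\<close>. Up to terms that are small unless three of the \<open>D\<^sub>i\<close> nearly coincide,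
  the difference between the soft-max weight of \<open>i\<close> and the indicator of its Laguerre cell is a sum
  over \<open>j\<close> of odd functions of \<open>(D\<^sub>i - D\<^sub>j) / \<epsilon>\<close>. Reflection in the hyperplane \<open>D\<^sub>i = D\<^sub>j\<close> cancels these
  up to the oscillation of the test field and the density, of total size \<open>\<epsilon> powr (1 + \<alpha>)\<close> and \<open>\<epsilon>\<^sup>2\<close>;
  the points whose mirror image leaves \<open>X\<close> contribute \<open>\<epsilon>\<^sup>2 ln\<^sup>2 \<epsilon>\<close>, because cells of positive mass on
  both sides force the hyperplane to cut \<open>X\<close> transversally. Constant test functions give the same bound
  for the difference between the masses of the cells of the two potentials. The masses are strongly
  monotone in the potential, since in a convex body a slab separating two sets of positive mass has
  mass at least proportional to its width. Hence the two potentials differ by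
  \<open>O(\<epsilon>\<^sup>2 (1 + ln\<^sup>2 \<epsilon>))\<close>.\<close>

section \<open>Slabs and isometries under Lebesgue measure\<close>

text \<open>The obstacle is uniformity in \<open>Q\<close>. The target measure enters the estimates
  only through the condition \<open>good \<kappa> z\<close>: every cell of \<open>z\<close> has mass
  at least \<open>\<kappa>\<close>. It excludes three degeneracies: a thin middle cell among three
  collinear targets, an interface that grazes the boundary of \<open>X\<close>, and a potential of
  large oscillation. The Brenier potential satisfies it because its cells have the masses of
  \<open>Q\<close>. For the entropic potential only the integrals of the soft weights are
  prescribed, so it holds only for small \<open>\<epsilon>\<close>; for the other
  \<open>\<epsilon>\<close> a trivial bound suffices, since the Hoelder norm contains the sup norm
  and \<open>\<epsilon> powr (1 + \<alpha>)\<close> is bounded below there. The logarithm comes from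
  a cut-off: the set of points whose mirror image leaves \<open>X\<close> has mass quadratic in the
  slab width, and the soft-max tail falls below \<open>\<epsilon>\<^sup>2\<close> only at gap
  \<open>2 * \<epsilon> * ln (1 / \<epsilon>)\<close>. This yields a squared logarithm, which the
  cube dominates once \<open>ln (1 / \<epsilon>) \<ge> 1\<close>. The first-order conditions avoid
  differentiation under the integral: one-sided inequalities at perturbed potentials are passed to
  the limit.\<close>

lemma ball_measurable [measurable]: "ball c r \<in> sets borel" "cball c r \<in> sets borel"
  by auto

lemma nn_integral_lborel_affine:
  fixes f :: "'a::euclidean_space \<Rightarrow> ennreal"
  assumes [measurable]: "f \<in> borel_measurable borel" and "c \<noteq> 0"
  shows "(\<integral>\<^sup>+x. f x \<partial>lborel) = ennreal (\<bar>c\<bar> ^ DIM('a)) * (\<integral>\<^sup>+x. f (t + c *\<^sub>R x) \<partial>lborel)"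
proof -
  have "(\<integral>\<^sup>+x. f x \<partial>lborel) = (\<integral>\<^sup>+x. f x \<partial>density (distr lborel borel (\<lambda>x. t + c *\<^sub>R x)) (\<lambda>_. ennreal (\<bar>c\<bar> ^ DIM('a))))"
    using lborel_affine[OF assms(2), of t] by metis
  also have "\<dots> = (\<integral>\<^sup>+x. ennreal (\<bar>c\<bar> ^ DIM('a)) * f (t + c *\<^sub>R x) \<partial>lborel)"
    by (subst nn_integral_density; (subst nn_integral_distr)?; simp)
  also have "\<dots> = ennreal (\<bar>c\<bar> ^ DIM('a)) * (\<integral>\<^sup>+x. f (t + c *\<^sub>R x) \<partial>lborel)"
    by (rule nn_integral_cmult) simp
  finally show ?thesis .
qed

lemma nn_integral_lborel_translate:
  fixes f :: "'a::euclidean_space \<Rightarrow> ennreal"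
  assumes "f \<in> borel_measurable borel"
  shows "(\<integral>\<^sup>+x. f (x + t) \<partial>lborel) = (\<integral>\<^sup>+x. f x \<partial>lborel)"
  using nn_integral_lborel_affine[OF assms, of 1 t] by (simp add: add.commute)

text \<open>Uniqueness of Haar measure, tested against the indicator of the unit ball.\<close>

lemma nn_integral_lborel_isometric_involution:
  fixes f :: "'a::euclidean_space \<Rightarrow> ennreal" and L :: "'a \<Rightarrow> 'a"
  assumes f[measurable]: "f \<in> borel_measurable borel"
    and L: "linear L" "\<And>x. L (L x) = x" "\<And>x. norm (L x) = norm x"
  shows "(\<integral>\<^sup>+x. f (L x) \<partial>lborel) = (\<integral>\<^sup>+x. f x \<partial>lborel)"
proof -
  have [measurable]: "L \<in> borel_measurable borel"
    by (intro borel_measurable_continuous_onI linear_continuous_on linear_conv_bounded_linear[THEN iffD1] L)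
  define g :: "'a \<Rightarrow> ennreal" where "g = indicator (ball 0 1)"
  have [measurable]: "g \<in> borel_measurable borel" unfolding g_def by measurable
  have g: "g (- L x) = g x" for x by (simp add: g_def indicator_def L)
  define m where "m = (\<integral>\<^sup>+x. g x \<partial>lborel)"
  have m: "m = emeasure lborel (ball (0::'a) 1)" by (simp add: m_def g_def)
  have m0: "m \<noteq> 0" unfolding m using content_ball_pos[of 1 "0::'a"] by (auto simp: measure_def)
  have mf: "m \<noteq> \<infinity>" unfolding m using emeasure_bounded_finite[of "ball (0::'a) 1"] by auto
  have "m * (\<integral>\<^sup>+x. f (L x) \<partial>lborel) = (\<integral>\<^sup>+x. g x * (\<integral>\<^sup>+y. f (L y) \<partial>lborel) \<partial>lborel)"
    unfolding m_def by (rule nn_integral_multc[symmetric]) simp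
  also have "\<dots> = (\<integral>\<^sup>+x. (\<integral>\<^sup>+y. g x * f (L y) \<partial>lborel) \<partial>lborel)"
    by (intro nn_integral_cong nn_integral_cmult[symmetric]) simp
  \<comment> \<open>Translating \<open>y\<close> by \<open>L x\<close> brings \<open>x\<close> into
    the argument of \<open>f\<close>, because \<open>L (L x) = x\<close>. After Fubini the same
    translation in the other factor removes \<open>x\<close> from \<open>g\<close>, which is even
    and invariant under \<open>L\<close>.\<close>
  also have "\<dots> = (\<integral>\<^sup>+x. (\<integral>\<^sup>+y. g x * f (x + L y) \<partial>lborel) \<partial>lborel)"
  proof (rule nn_integral_cong)
    fix x :: 'a
    have "(\<integral>\<^sup>+y. g x * f (L (y + L x)) \<partial>lborel) = (\<integral>\<^sup>+y. g x * f (L y) \<partial>lborel)"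
      by (rule nn_integral_lborel_translate) simp
    moreover have "L (y + L x) = x + L y" for y by (simp add: linear_add[OF L(1)] L(2) add.commute)
    ultimately show "(\<integral>\<^sup>+y. g x * f (L y) \<partial>lborel) = (\<integral>\<^sup>+y. g x * f (x + L y) \<partial>lborel)" by simp
  qed
  also have "\<dots> = (\<integral>\<^sup>+y. (\<integral>\<^sup>+x. g x * f (x + L y) \<partial>lborel) \<partial>lborel)"
    by (rule lborel_pair.Fubini'[symmetric]) simp
  also have "\<dots> = (\<integral>\<^sup>+y. (\<integral>\<^sup>+x. g (x - L y) * f x \<partial>lborel) \<partial>lborel)"
  proof (rule nn_integral_cong)
    fix y :: 'a
    show "(\<integral>\<^sup>+x. g x * f (x + L y) \<partial>lborel) = (\<integral>\<^sup>+x. g (x - L y) * f x \<partial>lborel)"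
      using nn_integral_lborel_translate[of "\<lambda>x. g (x - L y) * f x" "L y"] by simp
  qed
  also have "\<dots> = (\<integral>\<^sup>+x. (\<integral>\<^sup>+y. g (x - L y) * f x \<partial>lborel) \<partial>lborel)"
    by (rule lborel_pair.Fubini') simp
  also have "\<dots> = (\<integral>\<^sup>+x. (\<integral>\<^sup>+y. g y * f x \<partial>lborel) \<partial>lborel)"
  proof (rule nn_integral_cong)
    fix x :: 'a
    have "(\<integral>\<^sup>+y. g (x - L (y + L x)) * f x \<partial>lborel) = (\<integral>\<^sup>+y. g (x - L y) * f x \<partial>lborel)"
      by (rule nn_integral_lborel_translate) simp
    moreover have "g (x - L (y + L x)) = g y" for y
      using g[of y] by (simp add: linear_add[OF L(1)] L(2))
    ultimately show "(\<integral>\<^sup>+y. g (x - L y) * f x \<partial>lborel) = (\<integral>\<^sup>+y. g y * f x \<partial>lborel)" by simp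
  qed
  also have "\<dots> = (\<integral>\<^sup>+x. m * f x \<partial>lborel)"
    unfolding m_def by (intro nn_integral_cong nn_integral_multc) simp
  also have "\<dots> = m * (\<integral>\<^sup>+x. f x \<partial>lborel)"
    by (rule nn_integral_cmult) simp
  finally show ?thesis using m0 mf by (simp add: ennreal_mult_cancel_left)
qed

text \<open>Average over the translations by \<open>t *\<^sub>R v\<close> with \<open>t\<close> in
  the unit interval: each shifts \<open>a \<bullet> x\<close> by \<open>t\<close>, leaves
  \<open>g\<close> alone and moves the ball by at most \<open>norm v\<close>. Integrating over
  \<open>t\<close> first then replaces the factor in \<open>f\<close> by its full integral.\<close>

lemma nn_integral_slice_le:
  fixes a v :: "'a::euclidean_space" and f :: "real \<Rightarrow> ennreal" and g :: "'a \<Rightarrow> ennreal"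
  assumes [measurable]: "f \<in> borel_measurable borel" "g \<in> borel_measurable borel"
    and "a \<bullet> v = 1" and g: "\<And>x t. g (x + t *\<^sub>R v) = g x"
  shows "(\<integral>\<^sup>+x. f (a \<bullet> x - b) * (g x * indicator (cball 0 R) x) \<partial>lborel)
    \<le> (\<integral>\<^sup>+t. f t \<partial>lborel) * (\<integral>\<^sup>+x. g x * indicator (cball 0 (R + norm v)) x \<partial>lborel)"
proof -
  let ?J = "\<integral>\<^sup>+x. f (a \<bullet> x - b) * (g x * indicator (cball 0 R) x) \<partial>lborel"
  have "?J = (\<integral>\<^sup>+t. indicator {0..1::real} t * ?J \<partial>lborel)"
    by (subst nn_integral_multc) simp_all
  also have "\<dots> \<le> (\<integral>\<^sup>+t. (\<integral>\<^sup>+x. f (a \<bullet> x - b - t) * (g x * indicator (cball 0 (R + norm v)) x) \<partial>lborel) \<partial>lborel)"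
  proof (intro nn_integral_mono)
    fix t :: real
    have "(\<integral>\<^sup>+x. f (a \<bullet> (x + (- t) *\<^sub>R v) - b) * (g (x + (- t) *\<^sub>R v) * indicator (cball 0 R) (x + (- t) *\<^sub>R v)) \<partial>lborel) = ?J"
      by (rule nn_integral_lborel_translate) simp
    then have J: "?J = (\<integral>\<^sup>+x. f (a \<bullet> x - b - t) * (g x * indicator (cball 0 R) (x - t *\<^sub>R v)) \<partial>lborel)"
      using g[where t="- t"] assms(3) by (simp add: inner_diff_right algebra_simps)
    show "indicator {0..1} t * ?J \<le> (\<integral>\<^sup>+x. f (a \<bullet> x - b - t) * (g x * indicator (cball 0 (R + norm v)) x) \<partial>lborel)"
    proof (cases "t \<in> {0..1}")
      case True
      have "indicator (cball 0 R) (x - t *\<^sub>R v) \<le> (indicator (cball 0 (R + norm v)) x :: ennreal)" for x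
      proof (cases "x - t *\<^sub>R v \<in> cball 0 R")
        case True2: True
        have "norm x \<le> norm (x - t *\<^sub>R v) + norm (t *\<^sub>R v)" by (metis diff_add_cancel norm_triangle_ineq)
        moreover have "norm (t *\<^sub>R v) \<le> 1 * norm v" using True by (auto simp: mult_left_le_one_le)
        ultimately show ?thesis using True2 by (simp add: indicator_def)
      qed simp
      then show ?thesis unfolding J using True by (auto intro!: nn_integral_mono mult_left_mono)
    qed simp
  qed
  also have "\<dots> = (\<integral>\<^sup>+x. (\<integral>\<^sup>+t. f (a \<bullet> x - b - t) * (g x * indicator (cball 0 (R + norm v)) x) \<partial>lborel) \<partial>lborel)"
    by (rule lborel_pair.Fubini'[symmetric]) simp
  also have "\<dots> = (\<integral>\<^sup>+x. (\<integral>\<^sup>+t. f t \<partial>lborel) * (g x * indicator (cball 0 (R + norm v)) x) \<partial>lborel)"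
  proof (rule nn_integral_cong)
    fix x :: 'a
    have "(\<integral>\<^sup>+t. f t \<partial>lborel) = (\<integral>\<^sup>+t. f (a \<bullet> x - b - t) \<partial>lborel)"
      using nn_integral_lborel_affine[of f "-1" "a \<bullet> x - b"] by simp
    then show "(\<integral>\<^sup>+t. f (a \<bullet> x - b - t) * (g x * indicator (cball 0 (R + norm v)) x) \<partial>lborel)
        = (\<integral>\<^sup>+t. f t \<partial>lborel) * (g x * indicator (cball 0 (R + norm v)) x)"
      by (subst nn_integral_multc) simp_all
  qed
  also have "\<dots> = (\<integral>\<^sup>+t. f t \<partial>lborel) * (\<integral>\<^sup>+x. g x * indicator (cball 0 (R + norm v)) x \<partial>lborel)"
    by (rule nn_integral_cmult) simp
  finally show ?thesis .
qed

lemma emeasure_cball_finite: "emeasure lborel (cball (c::'a::euclidean_space) r) < \<infinity>"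
  using emeasure_bounded_finite[OF bounded_cball] .

text \<open>A one-sided Fubini in the coordinate \<open>a \<bullet> x\<close>. The constant does not
  depend on the offset \<open>b\<close>, which is the source of uniformity in the potential later
  on.\<close>

lemma slab_nn_integral_bound:
  fixes a :: "'a::euclidean_space"
  assumes "a \<noteq> 0"
  shows "\<exists>C\<ge>0. \<forall>f\<in>borel_measurable borel. \<forall>b.
    (\<integral>\<^sup>+x. f (a \<bullet> x - b) * indicator (cball 0 R) x \<partial>lborel) \<le> ennreal C * (\<integral>\<^sup>+t. f t \<partial>(lborel::real measure))"
proof -
  define v where "v = (1 / (a \<bullet> a)) *\<^sub>R a"
  have v: "a \<bullet> v = 1" using assms by (simp add: v_def)
  let ?M = "emeasure lborel (cball (0::'a) (R + norm v))"
  have "?M < top" using emeasure_cball_finite[of 0 "R + norm v"] by simp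
  then have "?M = ennreal (enn2real ?M)" by (rule ennreal_enn2real[symmetric])
  then show ?thesis
    using nn_integral_slice_le[of _ "\<lambda>_. 1" a v _ R] v
    by (intro exI[of _ "enn2real ?M"]) (auto simp: mult.commute)
qed

text \<open>Slicing along the component \<open>u\<close> of \<open>a\<close> orthogonal to
  \<open>c\<close> integrates out \<open>f\<close> without touching \<open>c \<bullet> x\<close>;
  the single-slab bound then treats \<open>g\<close>. Independence of \<open>a\<close> and
  \<open>c\<close> makes \<open>u\<close> nonzero.\<close>

lemma double_slab_nn_integral_bound:
  fixes a c :: "'a::euclidean_space"
  assumes "c \<noteq> 0" "\<And>k. a \<noteq> k *\<^sub>R c"
  shows "\<exists>C\<ge>0. \<forall>f\<in>borel_measurable borel. \<forall>g\<in>borel_measurable borel. \<forall>b d.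
    (\<integral>\<^sup>+x. f (a \<bullet> x - b) * (g (c \<bullet> x - d) * indicator (cball 0 R) x) \<partial>lborel)
     \<le> ennreal C * ((\<integral>\<^sup>+t. f t \<partial>(lborel::real measure)) * (\<integral>\<^sup>+t. g t \<partial>(lborel::real measure)))"
proof -
  define u where "u = a - ((a \<bullet> c) / (c \<bullet> c)) *\<^sub>R c"
  have u0: "u \<noteq> 0" using assms(2) unfolding u_def by auto
  have uc: "c \<bullet> u = 0" using assms(1) by (simp add: u_def inner_diff_right inner_commute)
  have "a = u + ((a \<bullet> c) / (c \<bullet> c)) *\<^sub>R c" by (simp add: u_def)
  then have au: "a \<bullet> u = u \<bullet> u" using uc by (metis inner_add_left inner_scaleR_left mult_zero_right add_0_right)
  define v where "v = (1 / (u \<bullet> u)) *\<^sub>R u"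
  have v: "a \<bullet> v = 1" "c \<bullet> v = 0" using u0 uc au by (auto simp: v_def)
  obtain C where C: "C \<ge> 0" "\<And>f b. f\<in>borel_measurable borel \<Longrightarrow>
    (\<integral>\<^sup>+x. f (c \<bullet> x - b) * indicator (cball 0 (R + norm v)) x \<partial>lborel) \<le> ennreal C * (\<integral>\<^sup>+t. f t \<partial>(lborel::real measure))"
    using slab_nn_integral_bound[OF assms(1), of "R + norm v"] by blast
  show ?thesis
  proof (intro exI[of _ C] conjI ballI allI C(1))
    fix f g :: "real \<Rightarrow> ennreal" and b d :: real
    assume fg[measurable]: "f \<in> borel_measurable borel" "g \<in> borel_measurable borel"
    have "(\<integral>\<^sup>+x. f (a \<bullet> x - b) * (g (c \<bullet> x - d) * indicator (cball 0 R) x) \<partial>lborel)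
      \<le> (\<integral>\<^sup>+t. f t \<partial>lborel) * (\<integral>\<^sup>+x. g (c \<bullet> x - d) * indicator (cball 0 (R + norm v)) x \<partial>lborel)"
      by (rule nn_integral_slice_le) (auto simp: v inner_add_right)
    also have "\<dots> \<le> (\<integral>\<^sup>+t. f t \<partial>lborel) * (ennreal C * (\<integral>\<^sup>+t. g t \<partial>lborel))"
      by (intro mult_left_mono C(2) fg(2)) simp
    finally show "(\<integral>\<^sup>+x. f (a \<bullet> x - b) * (g (c \<bullet> x - d) * indicator (cball 0 R) x) \<partial>lborel)
     \<le> ennreal C * ((\<integral>\<^sup>+t. f t \<partial>lborel) * (\<integral>\<^sup>+t. g t \<partial>lborel))"
      by (simp add: mult_ac)
  qed
qed

lemma nn_integral_exp_abs_le:
  assumes "0 < \<eta>"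
  shows "(\<integral>\<^sup>+t. ennreal (exp (- \<bar>t\<bar> / \<eta>)) \<partial>lborel) \<le> ennreal (2 * \<eta>)"
proof -
  have half: "(\<integral>\<^sup>+t. ennreal (exp (- t / \<eta>)) * indicator {0..} t \<partial>lborel) = ennreal \<eta>"
  proof -
    have "(\<integral>\<^sup>+t. ennreal (exp (- t / \<eta>)) * indicator {0..} t \<partial>lborel) = 0 - (- \<eta> * exp (- 0 / \<eta>))"
    proof (rule nn_integral_FTC_atLeast)
      show "((\<lambda>t. - \<eta> * exp (- t / \<eta>)) \<longlongrightarrow> 0) at_top"
        using assms by real_asymp
      show "((\<lambda>t. - \<eta> * exp (- t / \<eta>)) has_real_derivative exp (- x / \<eta>)) (at x)" for x
        using assms by (auto intro!: derivative_eq_intros)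
    qed auto
    then show ?thesis by simp
  qed
  have "(\<integral>\<^sup>+t. ennreal (exp (- \<bar>t\<bar> / \<eta>)) \<partial>lborel)
     \<le> (\<integral>\<^sup>+t. ennreal (exp (- t / \<eta>)) * indicator {0..} t + ennreal (exp (- (- t) / \<eta>)) * indicator {0..} (- t) \<partial>lborel)"
    by (intro nn_integral_mono) (auto simp: indicator_def)
  also have "\<dots> = (\<integral>\<^sup>+t. ennreal (exp (- t / \<eta>)) * indicator {0..} t \<partial>lborel) + (\<integral>\<^sup>+t. ennreal (exp (- (- t) / \<eta>)) * indicator {0..} (- t) \<partial>lborel)"
    by (rule nn_integral_add) auto
  also have "(\<integral>\<^sup>+t. ennreal (exp (- (- t) / \<eta>)) * indicator {0..} (- t) \<partial>lborel) = (\<integral>\<^sup>+t. ennreal (exp (- t / \<eta>)) * indicator {0..} t \<partial>lborel)"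
    using nn_integral_lborel_affine[of "\<lambda>t. ennreal (exp (- t / \<eta>)) * indicator {0..} t" "-1" 0] by simp
  finally show ?thesis using assms unfolding half by (simp flip: ennreal_plus)
qed

section \<open>Slabs in convex bodies\<close>

text \<open>Between the last time \<open>t1\<close> with \<open>h \<ge> 0\<close> and the first
  later time \<open>t2\<close> with \<open>h \<le> - \<delta>\<close> the segment stays in the slab.
  Over this interval \<open>h\<close> falls by at least \<open>\<delta>\<close>, at speed at most
  \<open>2 * L * R\<close> because \<open>X\<close> has diameter at most
  \<open>2 * R\<close>.\<close>

lemma segment_time_in_slab:
  fixes X :: "'a::euclidean_space set" and h :: "'a \<Rightarrow> real"
  assumes X: "convex X" "X \<subseteq> cball 0 R" and "0 < R"
    and lip: "\<And>x x'. x \<in> X \<Longrightarrow> x' \<in> X \<Longrightarrow> \<bar>h x - h x'\<bar> \<le> L * norm (x - x')" and L: "0 < L"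
    and x: "x \<in> X" "0 \<le> h x" and y: "y \<in> X" "h y < - \<delta>" and \<delta>: "0 < \<delta>"
  shows "ennreal (\<delta> / (2 * L * R))
    \<le> (\<integral>\<^sup>+t. indicator {0..1} t * indicator {x\<in>X. - \<delta> \<le> h x \<and> h x < 0} ((1 - t) *\<^sub>R x + t *\<^sub>R y) \<partial>lborel)"
proof -
  let ?S = "{x\<in>X. - \<delta> \<le> h x \<and> h x < 0}"
  define p where "p t = (1 - t) *\<^sub>R x + t *\<^sub>R y" for t :: real
  define f where "f t = h (p t)" for t
  have pX: "p t \<in> X" if "t \<in> {0..1}" for t
    unfolding p_def using that X(1) x y by (auto intro: convexD_alt)
  have flip: "\<bar>f s - f t\<bar> \<le> 2 * L * R * \<bar>s - t\<bar>" if "s \<in> {0..1}" "t \<in> {0..1}" for s t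
  proof -
    have "p s - p t = (s - t) *\<^sub>R (y - x)" by (simp add: p_def algebra_simps)
    then have "norm (p s - p t) = \<bar>s - t\<bar> * norm (y - x)" by simp
    also have "norm (y - x) \<le> 2 * R"
      using x(1) y(1) X(2) norm_triangle_ineq4[of y x] subsetD[OF X(2), of x] subsetD[OF X(2), of y] by simp
    finally have n: "norm (p s - p t) \<le> \<bar>s - t\<bar> * (2 * R)" by (simp add: mult_left_mono)
    have "\<bar>f s - f t\<bar> \<le> L * norm (p s - p t)" unfolding f_def by (intro lip pX that)
    also have "\<dots> \<le> L * (\<bar>s - t\<bar> * (2 * R))" using n L by (intro mult_left_mono) auto
    finally show ?thesis by (simp add: mult_ac)
  qed
  have "(2 * L * R)-lipschitz_on {0..1} f"
    using flip L \<open>0 < R\<close> by (intro lipschitz_onI) (auto simp: dist_real_def)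
  then have cont: "continuous_on {0..1} f" by (rule lipschitz_on_continuous_on)
  define K1 where "K1 = {0..1} \<inter> f -` {0..}"
  have K1: "compact K1" unfolding K1_def compact_eq_bounded_closed
    using cont by (auto intro!: continuous_closed_preimage bounded_Int)
  have "0 \<in> K1" using x by (auto simp: K1_def f_def p_def)
  then obtain t1 where t1: "t1 \<in> K1" "\<And>t. t \<in> K1 \<Longrightarrow> t \<le> t1"
    using compact_attains_sup[OF K1] by auto
  have t1': "0 \<le> t1" "t1 \<le> 1" "0 \<le> f t1" using t1(1) by (auto simp: K1_def)
  define K2 where "K2 = {t1..1} \<inter> f -` {..-\<delta>}"
  have "continuous_on {t1..1} f" using cont by (rule continuous_on_subset) (use t1' in auto)
  then have K2: "compact K2" unfolding K2_def compact_eq_bounded_closed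
    by (auto intro!: continuous_closed_preimage bounded_Int)
  have "1 \<in> K2" using y t1' by (auto simp: K2_def f_def p_def)
  then obtain t2 where t2: "t2 \<in> K2" "\<And>t. t \<in> K2 \<Longrightarrow> t2 \<le> t"
    using compact_attains_inf[OF K2] by auto
  have t2': "t1 \<le> t2" "t2 \<le> 1" "f t2 \<le> - \<delta>" using t2(1) by (auto simp: K2_def)
  have "\<delta> \<le> \<bar>f t1 - f t2\<bar>" using t1' t2' by simp
  also have "\<dots> \<le> 2 * L * R * (t2 - t1)" using flip[of t1 t2] t1' t2' by simp
  finally have len: "\<delta> / (2 * L * R) \<le> t2 - t1" using L \<open>0 < R\<close> by (simp add: field_simps)
  have "p t \<in> ?S" if t: "t1 < t" "t < t2" for t
  proof -
    have 1: "t \<in> {0..1}" using t t1' t2' by auto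
    have "t \<notin> K1" "t \<notin> K2" using t1(2)[of t] t2(2)[of t] t by force+
    then have "f t < 0" "- \<delta> < f t" using 1 t by (auto simp: K1_def K2_def)
    then show ?thesis using pX[OF 1] by (simp add: f_def)
  qed
  then have "(\<integral>\<^sup>+t. indicator {t1<..<t2} t \<partial>lborel) \<le> (\<integral>\<^sup>+t. indicator {0..1} t * indicator ?S (p t) \<partial>lborel)"
    using t1' t2' by (intro nn_integral_mono) (auto simp: indicator_def)
  moreover have "(\<integral>\<^sup>+t. indicator {t1<..<t2} t \<partial>lborel) = ennreal (t2 - t1)" using t2' by simp
  ultimately have "ennreal (t2 - t1) \<le> (\<integral>\<^sup>+t. indicator {0..1} t * indicator ?S (p t) \<partial>lborel)" by simp
  with ennreal_leI[OF len] show ?thesis unfolding p_def by (rule order_trans)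
qed

lemma nn_integral_contract_le:
  fixes f :: "'a::euclidean_space \<Rightarrow> ennreal"
  assumes "f \<in> borel_measurable borel" and c: "1 / 2 \<le> c"
  shows "(\<integral>\<^sup>+x. f (t + c *\<^sub>R x) \<partial>lborel) \<le> ennreal (2 ^ DIM('a)) * (\<integral>\<^sup>+x. f x \<partial>lborel)"
proof -
  have "1 \<le> (2 * c) ^ DIM('a)" using c by (intro one_le_power) auto
  then have "1 * (\<integral>\<^sup>+x. f (t + c *\<^sub>R x) \<partial>lborel) \<le> ennreal ((2 * c) ^ DIM('a)) * (\<integral>\<^sup>+x. f (t + c *\<^sub>R x) \<partial>lborel)"
    by (intro mult_right_mono) (auto simp: ennreal_le_iff2)
  also have "\<dots> = ennreal (2 ^ DIM('a)) * (ennreal (\<bar>c\<bar> ^ DIM('a)) * (\<integral>\<^sup>+x. f (t + c *\<^sub>R x) \<partial>lborel))"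
    using c by (simp add: power_mult_distrib ennreal_mult mult_ac)
  also have "\<dots> = ennreal (2 ^ DIM('a)) * (\<integral>\<^sup>+x. f x \<partial>lborel)"
    using nn_integral_lborel_affine[OF assms(1), of c t] c by simp
  finally show ?thesis by simp
qed

text \<open>Each segment from \<open>{h \<ge> 0}\<close> to \<open>{h < - \<delta>}\<close> spends time of order \<open>\<delta>\<close> in the slab, while for fixed
  farther endpoint the map from the nearer endpoint to the point at time \<open>t\<close> contracts volumes by a
  factor of at least \<open>1 / 2 ^ d\<close>.\<close>

lemma convex_slab_mass:
  fixes X :: "'a::euclidean_space set" and h :: "'a \<Rightarrow> real"
  assumes X: "convex X" "X \<subseteq> cball 0 R" and R: "0 < R" and [measurable]: "X \<in> sets borel"
    and [measurable]: "h \<in> borel_measurable borel"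
    and lip: "\<And>x x'. x \<in> X \<Longrightarrow> x' \<in> X \<Longrightarrow> \<bar>h x - h x'\<bar> \<le> L * norm (x - x')" and L: "0 < L"
    and \<delta>: "0 < \<delta>"
  shows "emeasure lborel {x\<in>X. 0 \<le> h x} * emeasure lborel {x\<in>X. h x < - \<delta>} * ennreal (\<delta> / (2 * L * R))
    \<le> ennreal (2 ^ DIM('a)) * emeasure lborel X * emeasure lborel {x\<in>X. - \<delta> \<le> h x \<and> h x < 0}"
proof -
  define E where "E = {x\<in>X. 0 \<le> h x}"
  define F where "F = {x\<in>X. h x < - \<delta>}"
  define S where "S = {x\<in>X. - \<delta> \<le> h x \<and> h x < 0}"
  have [measurable]: "E \<in> sets borel" "F \<in> sets borel" "S \<in> sets borel"
    unfolding E_def F_def S_def by measurable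
  let ?k = "ennreal (\<delta> / (2 * L * R))"
  \<comment> \<open>The time in the slab, integrated over all pairs of endpoints in \<open>E\<close>
    and \<open>F\<close>. Integrating over time first bounds the triple integral from below;
    integrating over an endpoint first bounds it from above.\<close>
  define q :: "real \<Rightarrow> 'a \<Rightarrow> 'a \<Rightarrow> ennreal" where "q t x y = indicator E x * (indicator F y * (indicator {0..1} t * indicator S ((1 - t) *\<^sub>R x + t *\<^sub>R y)))"
    for t :: real and x y :: 'a
  have "emeasure lborel E * emeasure lborel F * ?k = (\<integral>\<^sup>+x. indicator E x * (\<integral>\<^sup>+y. indicator F y * ?k \<partial>lborel) \<partial>lborel)"
    by (simp add: nn_integral_multc mult.assoc)
  also have "\<dots> \<le> (\<integral>\<^sup>+x. (\<integral>\<^sup>+y. (\<integral>\<^sup>+t. q t x y \<partial>lborel) \<partial>lborel) \<partial>lborel)"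
  proof (intro nn_integral_mono)
    fix x :: 'a
    have "indicator E x * (indicator F y * ?k) \<le> (\<integral>\<^sup>+t. q t x y \<partial>lborel)" for y
    proof (cases "x \<in> E \<and> y \<in> F")
      case True
      then have "x \<in> X" "0 \<le> h x" "y \<in> X" "h y < - \<delta>" by (auto simp: E_def F_def)
      then have "?k \<le> (\<integral>\<^sup>+t. indicator {0..1} t * indicator S ((1 - t) *\<^sub>R x + t *\<^sub>R y) \<partial>lborel)"
        unfolding S_def by (intro segment_time_in_slab[OF X R _ L] lip \<delta>)
      then show ?thesis using True by (simp add: q_def)
    next
      case False
      then have "indicator E x * (indicator F y * ?k) = 0" by (cases "x \<in> E") simp_all
      then show ?thesis by (metis zero_le)
    qed
    then have "(\<integral>\<^sup>+y. indicator E x * (indicator F y * ?k) \<partial>lborel) \<le> (\<integral>\<^sup>+y. (\<integral>\<^sup>+t. q t x y \<partial>lborel) \<partial>lborel)"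
      by (intro nn_integral_mono)
    then show "indicator E x * (\<integral>\<^sup>+y. indicator F y * ?k \<partial>lborel) \<le> (\<integral>\<^sup>+y. (\<integral>\<^sup>+t. q t x y \<partial>lborel) \<partial>lborel)"
      by (subst (asm) nn_integral_cmult) simp_all
  qed
  also have "\<dots> = (\<integral>\<^sup>+x. (\<integral>\<^sup>+t. (\<integral>\<^sup>+y. q t x y \<partial>lborel) \<partial>lborel) \<partial>lborel)"
    by (rule nn_integral_cong, rule lborel_pair.Fubini'[symmetric]) (unfold q_def, measurable)
  also have "\<dots> = (\<integral>\<^sup>+t. (\<integral>\<^sup>+x. (\<integral>\<^sup>+y. q t x y \<partial>lborel) \<partial>lborel) \<partial>lborel)"
    by (rule lborel_pair.Fubini'[symmetric]) (unfold q_def, measurable)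
  also have "\<dots> \<le> (\<integral>\<^sup>+t. indicator {0..1::real} t * (ennreal (2 ^ DIM('a)) * emeasure lborel X * emeasure lborel S) \<partial>lborel)"
  proof (intro nn_integral_mono)
    fix t :: real
    let ?b = "ennreal (2 ^ DIM('a)) * emeasure lborel X * emeasure lborel S"
    have iX: "indicator E x \<le> (indicator X x :: ennreal)" "indicator F x \<le> (indicator X x :: ennreal)" for x
      by (auto simp: E_def F_def indicator_def)
    have le: "(\<integral>\<^sup>+x. indicator S (v + c *\<^sub>R x) \<partial>lborel) \<le> ennreal (2 ^ DIM('a)) * emeasure lborel S" if "1/2 \<le> c" for v c
      using nn_integral_contract_le[of "indicator S" c v] that by simp
    \<comment> \<open>The nearer endpoint is \<open>y\<close> when \<open>t\<close> is at least one
      half and \<open>x\<close> otherwise; the integral over that endpoint is taken first.\<close>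
    consider "t \<notin> {0..1}" | "t \<in> {0..1}" "1/2 \<le> t" | "t \<in> {0..1}" "1/2 \<le> 1 - t" by force
    then show "(\<integral>\<^sup>+x. (\<integral>\<^sup>+y. q t x y \<partial>lborel) \<partial>lborel) \<le> indicator {0..1} t * ?b"
    proof cases
      case 1 then show ?thesis by (simp add: q_def)
    next
      case 2
      have "(\<integral>\<^sup>+x. (\<integral>\<^sup>+y. q t x y \<partial>lborel) \<partial>lborel) \<le> (\<integral>\<^sup>+x. (\<integral>\<^sup>+y. indicator X x * indicator S ((1 - t) *\<^sub>R x + t *\<^sub>R y) \<partial>lborel) \<partial>lborel)"
        using iX by (intro nn_integral_mono) (auto simp: q_def indicator_def)
      also have "\<dots> = (\<integral>\<^sup>+x. indicator X x * (\<integral>\<^sup>+y. indicator S ((1 - t) *\<^sub>R x + t *\<^sub>R y) \<partial>lborel) \<partial>lborel)"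
        by (rule nn_integral_cong, rule nn_integral_cmult) measurable
      also have "\<dots> \<le> (\<integral>\<^sup>+x. indicator X x * (ennreal (2 ^ DIM('a)) * emeasure lborel S) \<partial>lborel)"
        by (intro nn_integral_mono mult_left_mono le 2) simp
      also have "\<dots> = ?b" by (subst nn_integral_multc) (auto simp: mult_ac)
      finally show ?thesis using 2 by simp
    next
      case 3
      have "(\<integral>\<^sup>+x. (\<integral>\<^sup>+y. q t x y \<partial>lborel) \<partial>lborel) = (\<integral>\<^sup>+y. (\<integral>\<^sup>+x. q t x y \<partial>lborel) \<partial>lborel)"
        by (rule lborel_pair.Fubini'[symmetric]) (unfold q_def, measurable)
      also have "\<dots> \<le> (\<integral>\<^sup>+y. (\<integral>\<^sup>+x. indicator X y * indicator S (t *\<^sub>R y + (1 - t) *\<^sub>R x) \<partial>lborel) \<partial>lborel)"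
        using iX by (intro nn_integral_mono) (auto simp: q_def indicator_def add.commute)
      also have "\<dots> = (\<integral>\<^sup>+y. indicator X y * (\<integral>\<^sup>+x. indicator S (t *\<^sub>R y + (1 - t) *\<^sub>R x) \<partial>lborel) \<partial>lborel)"
        by (rule nn_integral_cong, rule nn_integral_cmult) measurable
      also have "\<dots> \<le> (\<integral>\<^sup>+x. indicator X x * (ennreal (2 ^ DIM('a)) * emeasure lborel S) \<partial>lborel)"
        by (intro nn_integral_mono mult_left_mono le 3) simp
      also have "\<dots> = ?b" by (subst nn_integral_multc) (auto simp: mult_ac)
      finally show ?thesis using 3 by simp
    qed
  qed
  also have "\<dots> = ennreal (2 ^ DIM('a)) * emeasure lborel X * emeasure lborel S"
    by (subst nn_integral_multc) auto
  finally show ?thesis unfolding E_def F_def S_def .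
qed

lemma measure_lborel_dilation:
  fixes Y :: "'a::euclidean_space set"
  assumes "compact Y" and t: "0 < t" "t < 1"
  shows "measure lborel ((\<lambda>x. t *\<^sub>R p + (1 - t) *\<^sub>R x) ` Y) = (1 - t) ^ DIM('a) * measure lborel Y"
proof -
  define d where "d x = t *\<^sub>R p + (1 - t) *\<^sub>R x" for x
  have "inj d" using t by (auto simp: inj_on_def d_def)
  have "continuous_on Y d" unfolding d_def by (intro continuous_intros)
  then have [measurable]: "d ` Y \<in> sets borel"
    using assms(1) by (intro borel_compact compact_continuous_image)
  have [measurable]: "Y \<in> sets borel" using assms(1) by (rule borel_compact)
  have "emeasure lborel (d ` Y) = (\<integral>\<^sup>+x. indicator (d ` Y) x \<partial>lborel)" by simp
  also have "\<dots> = ennreal ((1 - t) ^ DIM('a)) * (\<integral>\<^sup>+x. indicator (d ` Y) (d x) \<partial>lborel)"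
    using nn_integral_lborel_affine[of "indicator (d ` Y)" "1 - t" "t *\<^sub>R p", folded d_def] t by simp
  also have "(\<lambda>x. indicator (d ` Y) (d x) :: ennreal) = indicator Y"
    using \<open>inj d\<close> by (auto simp: fun_eq_iff indicator_def inj_image_mem_iff)
  finally have "emeasure lborel (d ` Y) = ennreal ((1 - t) ^ DIM('a)) * emeasure lborel Y" by simp
  then show ?thesis using t by (simp add: measure_def enn2real_mult d_def[abs_def])
qed

definition reflect :: "'a::euclidean_space \<Rightarrow> real \<Rightarrow> 'a \<Rightarrow> 'a" where
  "reflect a b x = x - (2 * (a \<bullet> x - b) / (a \<bullet> a)) *\<^sub>R a"

text \<open>A point of the slab whose mirror image leaves \<open>X\<close> lies outside the dilation of the slab
  about \<open>p\<close> with ratio \<open>1 - O(s)\<close>; the slab is star-shaped about \<open>p\<close>, so the missing part has volume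
  \<open>O(s)\<close> times that of the slab.\<close>

lemma reflect_leaving_measure:
  fixes X :: "'a::euclidean_space set" and C :: real
  assumes X: "compact X" "convex X" and p: "cball p r \<subseteq> X" "0 < r" "a \<bullet> p = b" and a: "a \<noteq> 0" and s: "0 \<le> s"
    and slab: "measure lborel {x\<in>X. \<bar>a \<bullet> x - b\<bar> \<le> s} \<le> C * s"
  shows "measure lborel {x\<in>X. \<bar>a \<bullet> x - b\<bar> \<le> s \<and> reflect a b x \<notin> X} \<le> 2 * DIM('a) * C / (norm a * r) * s\<^sup>2"
proof -
  define Y where "Y = {x\<in>X. \<bar>a \<bullet> x - b\<bar> \<le> s}"
  define B where "B = {x\<in>X. \<bar>a \<bullet> x - b\<bar> \<le> s \<and> reflect a b x \<notin> X}"
  have Ycl: "Y = X \<inter> {x. \<bar>a \<bullet> x - b\<bar> \<le> s}" by (auto simp: Y_def)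
  have Yc: "compact Y" unfolding Ycl
    by (intro compact_Int_closed X closed_Collect_le continuous_intros)
  have Yconv: "convex Y"
  proof -
    have "{x. \<bar>a \<bullet> x - b\<bar> \<le> s} = {x. a \<bullet> x \<le> s + b} \<inter> {x. a \<bullet> x \<ge> - s + b}"
      by auto
    then show ?thesis unfolding Ycl by (simp add: convex_Int X convex_halfspace_le convex_halfspace_ge)
  qed
  have pY: "p \<in> Y" using p s by (auto simp: Y_def)
  have [measurable]: "X \<in> sets borel" "Y \<in> sets borel" using X Yc by (auto intro: borel_compact)
  have Yfin: "emeasure lborel Y < \<infinity>" using Yc by (intro emeasure_bounded_finite compact_imp_bounded)
  have [measurable]: "B \<in> sets borel" unfolding B_def reflect_def by measurable
  \<comment> \<open>Reflection moves a point of the slab by at most \<open>2 * s / norm a\<close>,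
    that is \<open>\<tau> * r\<close>, so the displacement divided by \<open>\<tau>\<close> fits
    into the ball about \<open>p\<close>.\<close>
  define \<tau> where "\<tau> = 2 * s / (norm a * r)"
  have na: "0 < norm a * r" using a p by simp
  have \<tau>0: "0 \<le> \<tau>" using s na by (simp add: \<tau>_def)
  have Y0: "0 \<le> measure lborel Y" by simp
  have BY: "measure lborel B \<le> DIM('a) * \<tau> * measure lborel Y"
  \<comment> \<open>For \<open>\<tau> \<ge> 1\<close> the factor \<open>DIM('a) * \<tau>\<close> is
    at least 1 and the bound is trivial. For \<open>s = 0\<close> reflection fixes the points of the
    slab, so \<open>B\<close> is empty.\<close>
  proof (cases "\<tau> < 1 \<and> s \<noteq> 0")
    case False
    have *: "B = {}" if "s = 0"
      using that by (auto simp: B_def reflect_def)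
    have "measure lborel B \<le> measure lborel Y"
      using Yfin \<open>B \<in> sets borel\<close> by (intro measure_mono_fmeasurable) (auto simp: fmeasurable_def, auto simp: B_def Y_def)
    moreover have "1 \<le> DIM('a) * \<tau>" if "\<not> \<tau> < 1"
      using that mult_mono[of 1 "real DIM('a)" 1 \<tau>] DIM_positive[where 'a='a] by (simp add: Suc_le_eq)
    ultimately show ?thesis using False * Y0 mult_right_mono[of 1 "DIM('a) * \<tau>" "measure lborel Y"]
      by (cases "s = 0") (auto simp: \<tau>_def)
  next
    case True
    then have \<tau>: "\<tau> < 1" "0 < \<tau>" using s na by (auto simp: \<tau>_def)
    define d where "d x = \<tau> *\<^sub>R p + (1 - \<tau>) *\<^sub>R x" for x
    have dY: "d ` Y \<subseteq> Y" using Yconv pY \<tau> by (auto simp: d_def intro: convexD)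
    have "continuous_on Y d" unfolding d_def by (intro continuous_intros)
    then have dc: "compact (d ` Y)" using Yc by (rule compact_continuous_image)
    have [measurable]: "d ` Y \<in> sets borel" using dc by (auto intro: borel_compact)
    have dfin: "emeasure lborel (d ` Y) < \<infinity>" using dc by (intro emeasure_bounded_finite compact_imp_bounded)
    have dm: "measure lborel (d ` Y) = (1 - \<tau>) ^ DIM('a) * measure lborel Y"
      unfolding d_def by (rule measure_lborel_dilation[OF Yc]) (use \<tau> in auto)
    have "B \<subseteq> Y - d ` Y"
    proof
      fix x assume x: "x \<in> B"
      have "x \<notin> d ` Y"
      proof
        assume "x \<in> d ` Y"
        \<comment> \<open>The mirror image \<open>d w + e\<close> is a convex combination of
          \<open>p + (1 / \<tau>) *\<^sub>R e\<close>, a point of the ball, and of \<open>w\<close>,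
          so it would lie in \<open>X\<close>.\<close>
        then obtain w where w: "w \<in> Y" "x = d w" by auto
        define e where "e = reflect a b x - x"
        have "norm e = 2 * \<bar>a \<bullet> x - b\<bar> / norm a"
          using a abs_mult[of 2 "a \<bullet> x - b"] by (simp add: e_def reflect_def abs_mult power2_norm_eq_inner[symmetric] power2_eq_square)
        also have "\<dots> \<le> 2 * s / norm a" using x a by (auto simp: B_def intro!: divide_right_mono)
        also have "\<dots> = \<tau> * r" using p a by (simp add: \<tau>_def)
        finally have "norm ((1 / \<tau>) *\<^sub>R e) \<le> r" using \<tau> by (simp add: field_simps)
        then have "p + (1 / \<tau>) *\<^sub>R e \<in> X" using p by (auto simp: dist_norm)
        moreover have "w \<in> X" using w by (simp add: Y_def)
        ultimately have "\<tau> *\<^sub>R (p + (1 / \<tau>) *\<^sub>R e) + (1 - \<tau>) *\<^sub>R w \<in> X"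
          using X(2) \<tau> by (intro convexD) auto
        moreover have "\<tau> *\<^sub>R (p + (1 / \<tau>) *\<^sub>R e) + (1 - \<tau>) *\<^sub>R w = reflect a b x"
          using \<tau> w(2) by (simp add: e_def d_def scaleR_add_right)
        ultimately show False using x by (simp add: B_def)
      qed
      then show "x \<in> Y - d ` Y" using x by (auto simp: B_def Y_def)
    qed
    then have "measure lborel B \<le> measure lborel (Y - d ` Y)"
      using Yfin by (intro measure_mono_fmeasurable fmeasurable_Diff) (auto simp: fmeasurable_def)
    also have "\<dots> = measure lborel Y - measure lborel (d ` Y)"
      using Yfin dY by (intro measure_Diff) auto
    also have "\<dots> = (1 - (1 - \<tau>) ^ DIM('a)) * measure lborel Y" by (simp add: dm algebra_simps)
    \<comment> \<open>Bernoulli's inequality linearises the volume lost by the dilation.\<close>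
    also have "\<dots> \<le> (DIM('a) * \<tau>) * measure lborel Y"
      using Bernoulli_inequality[of "- \<tau>" "DIM('a)"] \<tau> by (intro mult_right_mono) auto
    finally show ?thesis .
  qed
  also have "\<dots> \<le> DIM('a) * \<tau> * (C * s)" using slab \<tau>0 by (intro mult_left_mono) (auto simp: Y_def)
  also have "\<dots> = 2 * DIM('a) * C / (norm a * r) * s\<^sup>2" by (simp add: \<tau>_def power2_eq_square)
  finally show ?thesis by (simp add: B_def)
qed

section \<open>The semidiscrete setting\<close>

text \<open>Turns constants found separately for each pair or triple of target indices into a single
  one; the sum serves as a common upper bound.\<close>

lemma finite_uniform_constant:
  fixes Q :: "'k::finite \<Rightarrow> real \<Rightarrow> bool"
  assumes ex: "\<And>k. \<exists>C\<ge>0. Q k C" and mono: "\<And>k C C'. Q k C \<Longrightarrow> C \<le> C' \<Longrightarrow> Q k C'"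
  shows "\<exists>C\<ge>0. \<forall>k. Q k C"
proof -
  obtain c where c: "\<And>k. 0 \<le> c k \<and> Q k (c k)" using ex by metis
  have "c k \<le> sum c UNIV" for k using c by (intro member_le_sum) auto
  then have "\<forall>k. Q k (sum c UNIV)" using c mono by blast
  moreover have "0 \<le> sum c UNIV" using c by (intro sum_nonneg) auto
  ultimately show ?thesis by blast
qed

lemma ex_argmax:
  fixes f :: "'k::finite \<Rightarrow> real"
  shows "\<exists>a. \<forall>j. f j \<le> f a"
proof -
  have "Max (range f) \<in> range f" by (rule Max_in) auto
  then obtain a where a: "Max (range f) = f a" by (rule rangeE)
  have "f j \<le> f a" for j using Max_ge[of "range f" "f j"] a by simp
  then show ?thesis by blast
qed

lemma ex_argmin:
  fixes f :: "'k::finite \<Rightarrow> real"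
  shows "\<exists>a. \<forall>j. f a \<le> f j"
  using ex_argmax[of "\<lambda>j. - f j"] by simp

text \<open>\<open>Q\<close> is deliberately not a parameter: constants obtained in the locale
  cannot depend on it. The bounds \<open>R\<close>, \<open>M\<close>, \<open>m\<close>,
  \<open>L\<close> and \<open>Y\<close> are all determined by \<open>X\<close>,
  \<open>\<rho>\<close> and the target points.\<close>

locale semidiscrete =
  fixes X :: "'a::euclidean_space set" and P :: "'a measure" and \<rho> :: "'a \<Rightarrow> real"
    and y :: "'n::finite \<Rightarrow> 'a" and R M m L Y :: real
  assumes X_compact: "compact X" and X_convex: "convex X" and X_interior: "interior X \<noteq> {}"
    and X_R: "X \<subseteq> cball 0 R" and R_pos: "0 < R"
    and P_prob: "prob_space P"
    and P_density: "P = density lborel (\<lambda>x. ennreal (\<rho> x) * indicator X x)"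
    and \<rho>_lip: "\<And>x x'. x \<in> X \<Longrightarrow> x' \<in> X \<Longrightarrow> \<bar>\<rho> x - \<rho> x'\<bar> \<le> L * norm (x - x')" and L_nonneg: "0 \<le> L"
    and \<rho>_bounds: "\<And>x. x \<in> X \<Longrightarrow> m \<le> \<rho> x \<and> \<rho> x \<le> M" and m_pos: "0 < m"
    and inj_y: "inj y" and y_Y: "\<And>i. norm (y i) \<le> Y" and Y_pos: "0 < Y"
begin

sublocale P: prob_space P by (rule P_prob)

definition D :: "real^'n \<Rightarrow> 'n \<Rightarrow> 'a \<Rightarrow> real" where "D z i x = x \<bullet> y i - z $ i"

abbreviation gap :: "real^'n \<Rightarrow> 'n \<Rightarrow> 'n \<Rightarrow> 'a \<Rightarrow> real" where
  "gap z i j x \<equiv> D z i x - D z j x"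

abbreviation cell :: "real^'n \<Rightarrow> 'n \<Rightarrow> 'a set" where "cell \<equiv> laguerre_cell X y"

text \<open>Nondegeneracy of a potential, and the substitute for the lower bound on the masses of
  \<open>Q\<close> in all geometric estimates.\<close>

definition good :: "real \<Rightarrow> real^'n \<Rightarrow> bool" where
  "good \<kappa> z \<longleftrightarrow> (\<forall>i. \<kappa> \<le> measure P (cell z i))"

text \<open>The density cut off at \<open>X\<close>, since \<open>\<rho>\<close> is known to be
  continuous only there and may be arbitrary elsewhere.\<close>

definition wt :: "'a \<Rightarrow> real" where "wt x = \<rho> x * indicator X x"

lemma X_borel [measurable]: "X \<in> sets borel"
  using X_compact by (rule borel_compact)

lemma \<rho>_continuous: "continuous_on X \<rho>"
proof (rule lipschitz_on_continuous_on)
  show "L-lipschitz_on X \<rho>"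
    using \<rho>_lip L_nonneg by (intro lipschitz_onI) (auto simp: dist_norm)
qed

lemma wt_measurable [measurable]: "wt \<in> borel_measurable borel"
proof -
  have "(\<lambda>x. indicator X x *\<^sub>R \<rho> x) \<in> borel_measurable borel"
    by (rule borel_measurable_continuous_on_indicator) (use \<rho>_continuous in auto)
  then show ?thesis by (simp add: wt_def[abs_def] mult.commute)
qed

lemma X_nonempty: "X \<noteq> {}" using X_interior by auto

lemma M_pos: "0 < M" using X_nonempty \<rho>_bounds m_pos by force

lemma wt_bounds: "0 \<le> wt x" "wt x \<le> M * indicator X x" "m * indicator X x \<le> wt x"
  using \<rho>_bounds[of x] m_pos by (auto simp: wt_def indicator_def)

section \<open>Comparison of \<open>P\<close> with Lebesgue measure\<close>

lemma P_wt: "P = density lborel (\<lambda>x. ennreal (wt x))"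
  unfolding P_density by (intro arg_cong2[of _ _ _ _ density] refl ext) (auto simp: wt_def indicator_def)

lemma sets_P [measurable_cong, simp]: "sets P = sets borel" by (simp add: P_wt)

lemma space_P [simp]: "space P = UNIV" by (simp add: P_wt)

lemma nn_integral_P: "f \<in> borel_measurable borel \<Longrightarrow> (\<integral>\<^sup>+x. f x \<partial>P) = (\<integral>\<^sup>+x. ennreal (wt x) * f x \<partial>lborel)"
  unfolding P_wt by (rule nn_integral_density) auto

lemma nn_integral_P_le:
  assumes [measurable]: "f \<in> borel_measurable borel"
  shows "(\<integral>\<^sup>+x. f x \<partial>P) \<le> ennreal M * (\<integral>\<^sup>+x. f x * indicator X x \<partial>lborel)"
proof -
  have "ennreal (wt x) * f x \<le> ennreal M * (f x * indicator X x)" for x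
  proof (cases "x \<in> X")
    case True
    then have "ennreal (wt x) \<le> ennreal M" using wt_bounds(2)[of x] by (intro ennreal_leI) simp
    then show ?thesis using True by (simp add: mult_right_mono)
  qed (simp add: wt_def)
  then have "(\<integral>\<^sup>+x. f x \<partial>P) \<le> (\<integral>\<^sup>+x. ennreal M * (f x * indicator X x) \<partial>lborel)"
    by (subst nn_integral_P) (auto intro!: nn_integral_mono)
  also have "\<dots> = ennreal M * (\<integral>\<^sup>+x. f x * indicator X x \<partial>lborel)"
    by (rule nn_integral_cmult) measurable
  finally show ?thesis .
qed

lemma emeasure_P_le:
  assumes [measurable]: "S \<in> sets borel"
  shows "emeasure P S \<le> ennreal M * emeasure lborel (S \<inter> X)"
proof -
  have "emeasure P S = (\<integral>\<^sup>+x. indicator S x \<partial>P)" by simp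
  also have "\<dots> \<le> ennreal M * (\<integral>\<^sup>+x. indicator S x * indicator X x \<partial>lborel)"
    by (rule nn_integral_P_le) measurable
  also have "(\<integral>\<^sup>+x. indicator S x * indicator X x \<partial>lborel) = (\<integral>\<^sup>+x. indicator (S \<inter> X) x \<partial>lborel)"
    by (intro nn_integral_cong) (auto simp: indicator_def)
  finally show ?thesis by simp
qed

lemma emeasure_lborel_X: "emeasure lborel X < \<infinity>"
  using X_compact by (intro emeasure_bounded_finite compact_imp_bounded)

lemma X_fmeasurable: "S \<in> sets borel \<Longrightarrow> S \<subseteq> X \<Longrightarrow> S \<in> fmeasurable lborel"
  using emeasure_lborel_X emeasure_mono[of S X lborel] by (auto simp: fmeasurable_def intro: le_less_trans)

lemma measure_P_le:
  assumes "S \<in> sets borel" "S \<subseteq> X"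
  shows "measure P S \<le> M * measure lborel S"
proof -
  have "S \<inter> X = S" using assms by auto
  with emeasure_P_le[OF assms(1)] have "ennreal (measure P S) \<le> ennreal M * emeasure lborel S"
    by (simp only: P.emeasure_eq_measure)
  then have "ennreal (measure P S) \<le> ennreal M * ennreal (measure lborel S)"
    by (simp only: emeasure_eq_measure2[OF X_fmeasurable[OF assms]])
  then show ?thesis using M_pos by (simp flip: ennreal_mult)
qed

lemma measure_P_ge:
  assumes [measurable]: "S \<in> sets borel" and "S \<subseteq> X"
  shows "m * measure lborel S \<le> measure P S"
proof -
  have "ennreal m * emeasure lborel S = (\<integral>\<^sup>+x. ennreal m * indicator S x \<partial>lborel)"
    by (rule nn_integral_cmult_indicator[symmetric]) simp
  also have "\<dots> \<le> (\<integral>\<^sup>+x. ennreal (wt x) * indicator S x \<partial>lborel)"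
  proof (intro nn_integral_mono)
    fix x
    have "m \<le> wt x" if "x \<in> S" using wt_bounds(3)[of x] assms(2) that by auto
    then show "ennreal m * indicator S x \<le> ennreal (wt x) * indicator S x"
      by (cases "x \<in> S") (auto intro: ennreal_leI)
  qed
  also have "\<dots> = emeasure P S" using nn_integral_P[of "indicator S"] by simp
  finally have "ennreal m * ennreal (measure lborel S) \<le> ennreal (measure P S)"
    by (simp only: P.emeasure_eq_measure emeasure_eq_measure2[OF X_fmeasurable[OF assms]])
  then show ?thesis using m_pos by (simp flip: ennreal_mult)
qed

lemma measure_P_X: "measure P X = 1"
proof -
  have "emeasure P (- X) \<le> ennreal M * emeasure lborel (- X \<inter> X)" by (rule emeasure_P_le) auto
  then have "measure P (- X) = 0" by (simp add: measure_def)
  then show ?thesis using P.prob_compl[of X] by (simp add: Compl_eq_Diff_UNIV)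
qed

lemma AE_X: "AE x in P. x \<in> X"
  using P.prob_eq_1[of X] measure_P_X by simp

lemma integrable_bounded:
  fixes f :: "'a \<Rightarrow> real"
  assumes "f \<in> borel_measurable borel" "\<And>x. \<bar>f x\<bar> \<le> B"
  shows "integrable P f"
  by (rule P.integrable_const_bound[of _ B]) (use assms in auto)

lemma integrable_indicator_P: "S \<in> sets borel \<Longrightarrow> integrable P (\<lambda>x. indicator S x :: real)"
  by (rule integrable_bounded[of _ 1]) (auto simp: indicator_def)

section \<open>The affine functions \<open>D z i\<close>, their slabs and ties\<close>

lemma y_neq: "i \<noteq> j \<Longrightarrow> y i - y j \<noteq> 0" using inj_y by (auto dest: injD)

lemma D_diff: "gap z i j x = (y i - y j) \<bullet> x - (z $ i - z $ j)"
  by (simp add: D_def inner_diff_left inner_commute[of x])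

lemma D_measurable [measurable]: "D z i \<in> borel_measurable borel"
  unfolding D_def[abs_def] by measurable

lemma D_lip: "\<bar>D z i x - D z i x'\<bar> \<le> Y * norm (x - x')"
proof -
  have "\<bar>D z i x - D z i x'\<bar> = \<bar>(x - x') \<bullet> y i\<bar>" by (simp add: D_def inner_diff_left)
  also have "\<dots> \<le> norm (x - x') * norm (y i)" by (rule Cauchy_Schwarz_ineq2)
  also have "\<dots> \<le> norm (x - x') * Y" by (intro mult_left_mono y_Y) simp
  finally show ?thesis by (simp add: mult.commute)
qed

lemma cell_eq: "cell z i = {x \<in> X. \<forall>j. D z j x \<le> D z i x}"
proof -
  have "(y i - y j) \<bullet> x \<ge> z $ i - z $ j \<longleftrightarrow> D z j x \<le> D z i x" for x j
    using D_diff[of z i x j] by linarith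
  then show ?thesis unfolding laguerre_cell_def by (auto, metis order_refl)
qed

lemma cell_measurable [measurable]: "cell z i \<in> sets borel"
  unfolding cell_eq by measurable

lemma slab_lborel_nn:
  "\<exists>C\<ge>0. \<forall>i j. i \<noteq> j \<longrightarrow> (\<forall>f\<in>borel_measurable borel. \<forall>b.
     (\<integral>\<^sup>+x. f ((y i - y j) \<bullet> x - b) * indicator (cball 0 R) x \<partial>lborel) \<le> ennreal C * (\<integral>\<^sup>+t. f t \<partial>lborel))"
proof -
  let ?Q = "\<lambda>(i, j) C. i \<noteq> j \<longrightarrow> (\<forall>f\<in>borel_measurable borel. \<forall>b.
     (\<integral>\<^sup>+x. f ((y i - y j) \<bullet> x - b) * indicator (cball 0 R) x \<partial>lborel) \<le> ennreal C * (\<integral>\<^sup>+t. f t \<partial>(lborel::real measure)))"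
  have "\<exists>C\<ge>0. \<forall>k. ?Q k C"
  proof (rule finite_uniform_constant)
    fix k :: "'n \<times> 'n"
    show "\<exists>C\<ge>0. ?Q k C"
    proof (cases "fst k = snd k")
      case False
      then show ?thesis using slab_nn_integral_bound[OF y_neq[OF False], of R] by (auto simp: case_prod_unfold)
    qed (auto simp: case_prod_unfold)
  next
    fix k C C' assume Q: "?Q k C" and "C \<le> (C'::real)"
    then have "ennreal C * I \<le> ennreal C' * I" for I by (intro mult_right_mono ennreal_leI) auto
    with Q show "?Q k C'"
      unfolding case_prod_unfold by (meson order_trans)
  qed
  then show ?thesis by auto
qed

lemma indicator_X_le: "indicator X x \<le> (indicator (cball 0 R) x :: ennreal)"
  using X_R by (auto simp: indicator_def)

text \<open>Uniform in \<open>z\<close> because the potential enters a gap only as the offset of the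
  slab, while the normal \<open>y i - y j\<close> ranges over a finite set.\<close>

lemma slab_P_nn:
  "\<exists>C\<ge>0. \<forall>z i j. i \<noteq> j \<longrightarrow> (\<forall>f\<in>borel_measurable borel.
     (\<integral>\<^sup>+x. f (gap z i j x) \<partial>P) \<le> ennreal C * (\<integral>\<^sup>+t. f t \<partial>lborel))"
proof -
  obtain C where C: "C \<ge> 0" "\<And>i j f b. i \<noteq> j \<Longrightarrow> f \<in> borel_measurable borel \<Longrightarrow>
     (\<integral>\<^sup>+x. f ((y i - y j) \<bullet> x - b) * indicator (cball 0 R) x \<partial>lborel) \<le> ennreal C * (\<integral>\<^sup>+t. f t \<partial>lborel)"
    using slab_lborel_nn by blast
  show ?thesis
  proof (intro exI[of _ "M * C"] conjI allI impI ballI)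
    fix z :: "real^'n" and i j :: 'n and f :: "real \<Rightarrow> ennreal"
    assume ij: "i \<noteq> j" and f[measurable]: "f \<in> borel_measurable borel"
    have "(\<integral>\<^sup>+x. f (gap z i j x) \<partial>P) \<le> ennreal M * (\<integral>\<^sup>+x. f (gap z i j x) * indicator X x \<partial>lborel)"
      by (rule nn_integral_P_le) measurable
    also have "\<dots> \<le> ennreal M * (\<integral>\<^sup>+x. f (gap z i j x) * indicator (cball 0 R) x \<partial>lborel)"
      using indicator_X_le by (intro mult_left_mono nn_integral_mono) auto
    also have "\<dots> \<le> ennreal M * (ennreal C * (\<integral>\<^sup>+t. f t \<partial>lborel))"
      unfolding D_diff by (intro mult_left_mono C(2) ij f) simp
    finally show "(\<integral>\<^sup>+x. f (gap z i j x) \<partial>P) \<le> ennreal (M * C) * (\<integral>\<^sup>+t. f t \<partial>lborel)"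
      using M_pos C(1) by (simp add: ennreal_mult mult.assoc)
  qed (use M_pos C(1) in simp)
qed

lemma slab_P:
  "\<exists>C\<ge>0. \<forall>z i j s. i \<noteq> j \<longrightarrow> 0 \<le> s \<longrightarrow> measure P {x. \<bar>gap z i j x\<bar> \<le> s} \<le> C * s"
proof -
  obtain C where C: "C \<ge> 0" "\<And>z i j f. i \<noteq> j \<Longrightarrow> f \<in> borel_measurable borel \<Longrightarrow>
     (\<integral>\<^sup>+x. f (gap z i j x) \<partial>P) \<le> ennreal C * (\<integral>\<^sup>+t. f t \<partial>lborel)"
    using slab_P_nn by blast
  show ?thesis
  proof (intro exI[of _ "2 * C"] conjI allI impI)
    fix z :: "real^'n" and i j :: 'n and s :: real
    assume ij: "i \<noteq> j" and s: "0 \<le> s"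
    have "emeasure P {x. \<bar>gap z i j x\<bar> \<le> s} = (\<integral>\<^sup>+x. indicator {x. \<bar>gap z i j x\<bar> \<le> s} x \<partial>P)"
      by (rule nn_integral_indicator[symmetric]) measurable
    also have "\<dots> = (\<integral>\<^sup>+x. indicator {-s..s} (gap z i j x) \<partial>P)"
      by (intro nn_integral_cong) (auto simp: indicator_def)
    also have "\<dots> \<le> ennreal C * (\<integral>\<^sup>+t. indicator {-s..s} t \<partial>lborel)"
      by (rule C(2)[OF ij]) measurable
    also have "\<dots> = ennreal (2 * C * s)" using s C(1) by (simp flip: ennreal_mult add: mult_ac)
    finally show "measure P {x. \<bar>gap z i j x\<bar> \<le> s} \<le> 2 * C * s"
      using s C(1) by (simp add: P.emeasure_eq_measure)
  qed (use C in simp)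
qed

text \<open>A tie is a slab of width 0.\<close>

lemma AE_no_ties: "AE x in P. \<forall>i j. i \<noteq> j \<longrightarrow> D z i x \<noteq> D z j x"
proof -
  obtain C where C: "\<And>z i j s. i \<noteq> j \<Longrightarrow> 0 \<le> s \<Longrightarrow> measure P {x. \<bar>gap z i j x\<bar> \<le> s} \<le> C * s"
    using slab_P by blast
  have "AE x in P. i \<noteq> j \<longrightarrow> D z i x \<noteq> D z j x" for i j
  proof (cases "i = j")
    case False
    have "measure P {x. \<bar>gap z i j x\<bar> \<le> 0} = 0"
      using C[OF False, of 0 z] by (simp add: measure_le_0_iff)
    then have "AE x in P. \<not> (x \<in> {x. \<bar>gap z i j x\<bar> \<le> 0})"
      by (intro AE_not_in) (auto simp: null_sets_def P.emeasure_eq_measure)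
    then show ?thesis by (rule AE_mp) auto
  qed simp
  then have "AE x in P. \<forall>i\<in>UNIV. \<forall>j\<in>UNIV. i \<noteq> j \<longrightarrow> D z i x \<noteq> D z j x"
    by (intro AE_finite_allI) simp_all
  then show ?thesis by simp
qed

end

section \<open>Near coincidences and transversality\<close>

context semidiscrete begin

section \<open>Near coincidences of three affine functions\<close>

abbreviation triple_exp :: "real \<Rightarrow> real^'n \<Rightarrow> 'n \<Rightarrow> 'n \<Rightarrow> 'n \<Rightarrow> 'a \<Rightarrow> real" where
  "triple_exp \<eta> z i j k x \<equiv> exp (- (\<bar>gap z i j x\<bar> + \<bar>gap z i k x\<bar>) / \<eta>)"

text \<open>With independent normals the exponential factors into two functions of transversal
  coordinates, and each contributes a factor \<open>2 * \<eta>\<close>.\<close>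

lemma triple_noncollinear:
  "\<exists>C\<ge>0. \<forall>i j k. (\<forall>c. y i - y j \<noteq> c *\<^sub>R (y i - y k)) \<and> i \<noteq> k \<longrightarrow> (\<forall>z \<eta>. 0 < \<eta> \<longrightarrow>
     (LINT x|P. triple_exp \<eta> z i j k x) \<le> C * \<eta>\<^sup>2)"
proof -
  let ?Q = "\<lambda>(i, j, k) C. (\<forall>c. y i - y j \<noteq> c *\<^sub>R (y i - y k)) \<and> i \<noteq> k \<longrightarrow> (\<forall>z \<eta>. 0 < \<eta> \<longrightarrow>
     (LINT x|P. triple_exp \<eta> z i j k x) \<le> C * \<eta>\<^sup>2)"
  have "\<exists>C\<ge>0. \<forall>t. ?Q t C"
  proof (rule finite_uniform_constant)
    fix t :: "'n \<times> 'n \<times> 'n"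
    obtain i j k where t: "t = (i, j, k)" by (cases t)
    show "\<exists>C\<ge>0. ?Q t C"
    proof (cases "(\<forall>c. y i - y j \<noteq> c *\<^sub>R (y i - y k)) \<and> i \<noteq> k")
      case True
      obtain C where C: "C \<ge> 0" "\<And>f g b d. f \<in> borel_measurable borel \<Longrightarrow> g \<in> borel_measurable borel \<Longrightarrow>
          (\<integral>\<^sup>+x. f ((y i - y j) \<bullet> x - b) * (g ((y i - y k) \<bullet> x - d) * indicator (cball 0 R) x) \<partial>lborel)
          \<le> ennreal C * ((\<integral>\<^sup>+t. f t \<partial>(lborel::real measure)) * (\<integral>\<^sup>+t. g t \<partial>(lborel::real measure)))"
        using double_slab_nn_integral_bound[of "y i - y k" "y i - y j" R] y_neq True by blast
      have "(LINT x|P. triple_exp \<eta> z i j k x) \<le> M * (C * 4) * \<eta>\<^sup>2"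
        if \<eta>: "0 < \<eta>" for z \<eta>
      proof (rule integral_real_bounded)
        let ?e = "\<lambda>t. ennreal (exp (- \<bar>t\<bar> / \<eta>))"
        have "(\<integral>\<^sup>+x. ennreal (triple_exp \<eta> z i j k x) \<partial>P)
          \<le> ennreal M * (\<integral>\<^sup>+x. ennreal (triple_exp \<eta> z i j k x) * indicator X x \<partial>lborel)"
          by (rule nn_integral_P_le) measurable
        also have "\<dots> \<le> ennreal M * (\<integral>\<^sup>+x. ?e ((y i - y j) \<bullet> x - (z $ i - z $ j)) * (?e ((y i - y k) \<bullet> x - (z $ i - z $ k)) * indicator (cball 0 R) x) \<partial>lborel)"
        proof (intro mult_left_mono nn_integral_mono)
          fix x
          have "triple_exp \<eta> z i j k x = exp (- \<bar>gap z i j x\<bar> / \<eta>) * exp (- \<bar>gap z i k x\<bar> / \<eta>)"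
            by (simp add: exp_add[symmetric] diff_divide_distrib)
          then show "ennreal (triple_exp \<eta> z i j k x) * indicator X x
            \<le> ?e ((y i - y j) \<bullet> x - (z $ i - z $ j)) * (?e ((y i - y k) \<bullet> x - (z $ i - z $ k)) * indicator (cball 0 R) x)"
            using indicator_X_le[of x] by (simp add: D_diff[symmetric] ennreal_mult mult.assoc mult_left_mono)
        qed simp
        also have "\<dots> \<le> ennreal M * (ennreal C * ((\<integral>\<^sup>+t. ?e t \<partial>lborel) * (\<integral>\<^sup>+t. ?e t \<partial>lborel)))"
          by (intro mult_left_mono C(2)) auto
        also have "\<dots> \<le> ennreal M * (ennreal C * (ennreal (2 * \<eta>) * ennreal (2 * \<eta>)))"
          by (intro mult_left_mono mult_mono nn_integral_exp_abs_le \<eta>) auto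
        also have "\<dots> = ennreal (M * (C * 4) * \<eta>\<^sup>2)"
          using M_pos C(1) \<eta> by (simp flip: ennreal_mult add: power2_eq_square mult_ac)
        finally show "(\<integral>\<^sup>+x. ennreal (triple_exp \<eta> z i j k x) \<partial>P) \<le> ennreal (M * (C * 4) * \<eta>\<^sup>2)" .
      qed (use M_pos C in simp)
      then show ?thesis unfolding t using M_pos C(1) by (intro exI[of _ "M * (C * 4)"]) auto
    qed (auto simp: t)
  next
    fix t C C' assume "?Q t C" "C \<le> (C'::real)"
    moreover have "C * \<eta>\<^sup>2 \<le> C' * \<eta>\<^sup>2" for \<eta> using \<open>C \<le> C'\<close> by (simp add: mult_right_mono)
    ultimately show "?Q t C'" unfolding case_prod_unfold by (meson order_trans)
  qed
  then show ?thesis by auto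
qed

text \<open>For collinear points the three affine functions depend on a single variable \<open>t\<close>, and the
  cell of the middle point is a slab in \<open>t\<close>; since it has mass at least \<open>\<kappa>\<close> it is not thin.\<close>

lemma collinear_offset_bound:
  assumes \<kappa>: "0 < \<kappa>"
  shows "\<exists>c>0. \<forall>i j k u. i \<noteq> j \<and> i \<noteq> k \<and> j \<noteq> k \<and> y i - y j = u *\<^sub>R (y i - y k) \<longrightarrow>
    (\<forall>z x. good \<kappa> z \<longrightarrow> c \<le> \<bar>gap z i j x\<bar> + \<bar>gap z i k x\<bar>)"
proof -
  obtain C where C: "C \<ge> 0" "\<And>z i j s. i \<noteq> j \<Longrightarrow> 0 \<le> s \<Longrightarrow> measure P {x. \<bar>gap z i j x\<bar> \<le> s} \<le> C * s"
    using slab_P by blast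
  \<comment> \<open>The bound is put in the inverse form \<open>1 \<le> B * ...\<close> to make it
    monotone in \<open>B\<close>, as \<open>finite_uniform_constant\<close> requires. At the end
    \<open>c\<close> is recovered as \<open>1 / (B + 1)\<close>, where the 1 guards against
    \<open>B = 0\<close>.\<close>
  define Q where "Q t B \<longleftrightarrow> (case t of (i, j, k) \<Rightarrow> i \<noteq> j \<and> i \<noteq> k \<and> j \<noteq> k \<longrightarrow>
     (\<forall>u z x. y i - y j = u *\<^sub>R (y i - y k) \<and> good \<kappa> z \<longrightarrow> 1 \<le> B * (\<bar>gap z i j x\<bar> + \<bar>gap z i k x\<bar>)))"
    for t and B :: real
  have "\<exists>B\<ge>0. \<forall>t. Q t B"
  proof (rule finite_uniform_constant)
    fix t :: "'n \<times> 'n \<times> 'n"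
    obtain i j k where t: "t = (i, j, k)" by (cases t)
    show "\<exists>B\<ge>0. Q t B"
    proof (cases "i \<noteq> j \<and> i \<noteq> k \<and> j \<noteq> k \<and> (\<exists>u. y i - y j = u *\<^sub>R (y i - y k))")
      case False then show ?thesis by (intro exI[of _ 0]) (auto simp: t Q_def)
    next
      case True
      then obtain u where u: "y i - y j = u *\<^sub>R (y i - y k)" and ne: "i \<noteq> j" "i \<noteq> k" "j \<noteq> k" by blast
      \<comment> \<open>The constants below involve \<open>u\<close>; they depend on the triple
        alone because the triple determines \<open>u\<close>.\<close>
      have uniq: "u' = u" if "y i - y j = u' *\<^sub>R (y i - y k)" for u'
        using that u y_neq[OF ne(2)] by (metis scaleR_cancel_right)
      have u0: "u \<noteq> 0" using u y_neq[OF ne(1)] by auto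
      have u1: "u \<noteq> 1" using u y_neq[OF ne(3)] by auto
      define K where "K = 1 / \<bar>u\<bar> + 1 / \<bar>1 - u\<bar>"
      have K: "1 / \<bar>u\<bar> \<le> K" "1 / \<bar>1 - u\<bar> \<le> K" "0 < K" using u0 u1 by (auto simp: K_def add_pos_pos)
      have "1 \<le> (C * K / \<kappa> * (1 + \<bar>u\<bar>)) * (\<bar>gap z i j x\<bar> + \<bar>gap z i k x\<bar>)" if g: "good \<kappa> z" for z x
      proof -
        \<comment> \<open>With the gap between \<open>i\<close> and \<open>k\<close> as the common
          variable \<open>T\<close>, the gap between \<open>i\<close> and \<open>j\<close> is
          \<open>u * T + w\<close>. The three functions can meet in a point only if
          \<open>w = 0\<close>, so \<open>w\<close> measures their offset.\<close>
        define w where "w = u * (z $ i - z $ k) - (z $ i - z $ j)"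
        define T where "T x = gap z i k x" for x
        have ij: "gap z i j x = u * T x + w" for x
          unfolding T_def D_diff u w_def by (simp add: algebra_simps)
        have key: "\<exists>l. \<forall>x \<in> cell z l. \<bar>T x\<bar> \<le> K * \<bar>w\<bar>"
        proof -
          \<comment> \<open>The cases say which target lies between the other two:
            \<open>y i\<close>, \<open>y j\<close> or \<open>y k\<close>. Its cell is confined to a
            slab in \<open>T\<close> of width proportional to the offset.\<close>
          consider "u < 0" | "0 < u" "u < 1" | "1 < u" using u0 u1 by linarith
          then show ?thesis
          proof cases
            case 1
            have "\<bar>T x\<bar> \<le> K * \<bar>w\<bar>" if "x \<in> cell z i" for x
            proof -
              have "0 \<le> T x" "0 \<le> gap z i j x" using that by (auto simp: cell_eq T_def)
              then have "\<bar>u\<bar> * \<bar>T x\<bar> \<le> \<bar>w\<bar>" using 1 ij[of x] by auto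
              then have "\<bar>T x\<bar> \<le> 1 / \<bar>u\<bar> * \<bar>w\<bar>" using u0 by (simp add: field_simps)
              also have "\<dots> \<le> K * \<bar>w\<bar>" by (intro mult_right_mono K) simp
              finally show ?thesis .
            qed
            then show ?thesis by blast
          next
            case 2
            have "\<bar>T x\<bar> \<le> K * \<bar>w\<bar>" if "x \<in> cell z j" for x
            proof -
              have cell: "D z i x \<le> D z j x" "D z k x \<le> D z j x" using that by (auto simp: cell_eq)
              then have le: "u * T x + w \<le> 0" "D z k x \<le> D z j x" using ij[of x] by linarith+
              then have le2: "(u - 1) * T x + w \<le> 0" using ij[of x] by (simp add: T_def algebra_simps)
              have "\<bar>u\<bar> * \<bar>T x\<bar> \<le> \<bar>w\<bar> \<or> \<bar>1 - u\<bar> * \<bar>T x\<bar> \<le> \<bar>w\<bar>"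
              proof (cases "0 \<le> T x")
                case True then show ?thesis using le(1) 2 by (auto simp: abs_if algebra_simps)
              next
                case False
                then have "(1 - u) * - T x \<le> - w" using le2 by (simp add: algebra_simps)
                then show ?thesis using False 2 by (auto simp: abs_if)
              qed
              then have "\<bar>T x\<bar> \<le> 1 / \<bar>u\<bar> * \<bar>w\<bar> \<or> \<bar>T x\<bar> \<le> 1 / \<bar>1 - u\<bar> * \<bar>w\<bar>" using u0 u1 by (auto simp: field_simps)
              moreover have "1 / \<bar>u\<bar> * \<bar>w\<bar> \<le> K * \<bar>w\<bar>" "1 / \<bar>1 - u\<bar> * \<bar>w\<bar> \<le> K * \<bar>w\<bar>" by (intro mult_right_mono K; simp)+
              ultimately show ?thesis by linarith
            qed
            then show ?thesis by blast
          next
            case 3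
            have "\<bar>T x\<bar> \<le> K * \<bar>w\<bar>" if "x \<in> cell z k" for x
            proof -
              have le: "T x \<le> 0" "D z j x \<le> D z k x" using that by (auto simp: cell_eq T_def)
              then have le2: "0 \<le> (u - 1) * T x + w" using ij[of x] by (simp add: T_def algebra_simps)
              then have "\<bar>1 - u\<bar> * \<bar>T x\<bar> \<le> \<bar>w\<bar>" using le(1) 3 by (auto simp: abs_if algebra_simps)
              then have "\<bar>T x\<bar> \<le> 1 / \<bar>1 - u\<bar> * \<bar>w\<bar>" using u1 by (simp add: field_simps)
              also have "\<dots> \<le> K * \<bar>w\<bar>" by (intro mult_right_mono K) simp
              finally show ?thesis .
            qed
            then show ?thesis by blast
          qed
        qed
        \<comment> \<open>The middle cell has mass at least \<open>\<kappa>\<close> and lies in a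
          slab of mass at most \<open>C * K * \<bar>w\<bar>\<close>, so the offset is bounded below.
          The two gaps together dominate the offset up to the factor
          \<open>1 + \<bar>u\<bar>\<close>.\<close>
        then obtain l where l: "cell z l \<subseteq> {x. \<bar>gap z i k x\<bar> \<le> K * \<bar>w\<bar>}" by (auto simp: T_def)
        have "\<kappa> \<le> measure P (cell z l)" using g by (simp add: good_def)
        also have "\<dots> \<le> measure P {x. \<bar>gap z i k x\<bar> \<le> K * \<bar>w\<bar>}"
          by (rule P.finite_measure_mono[OF l]) measurable
        also have "\<dots> \<le> C * (K * \<bar>w\<bar>)" using K by (intro C(2) ne) auto
        finally have kw: "\<kappa> \<le> C * K * \<bar>w\<bar>" by (simp add: mult.assoc)
        have "\<bar>w\<bar> = \<bar>(gap z i j x) - u * (gap z i k x)\<bar>" using ij[of x] by (simp add: T_def)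
        also have "\<dots> \<le> \<bar>gap z i j x\<bar> + \<bar>u\<bar> * \<bar>gap z i k x\<bar>"
          by (metis abs_mult abs_triangle_ineq4)
        also have "\<dots> \<le> (1 + \<bar>u\<bar>) * (\<bar>gap z i j x\<bar> + \<bar>gap z i k x\<bar>)"
          by (simp add: algebra_simps)
        finally have "\<kappa> \<le> C * K * ((1 + \<bar>u\<bar>) * (\<bar>gap z i j x\<bar> + \<bar>gap z i k x\<bar>))"
          using kw C(1) K mult_left_mono[of "\<bar>w\<bar>" _ "C * K"] by (meson mult_nonneg_nonneg less_imp_le order_trans)
        then show ?thesis using \<kappa> by (simp add: field_simps)
      qed
      moreover have "0 \<le> C * K / \<kappa> * (1 + \<bar>u\<bar>)" using C(1) K \<kappa> by simp
      ultimately show ?thesis unfolding t Q_def by (intro exI[of _ "C * K / \<kappa> * (1 + \<bar>u\<bar>)"]) auto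
    qed
  next
    fix t :: "'n \<times> 'n \<times> 'n" and B B' assume Q: "Q t B" and "B \<le> (B'::real)"
    then have "B * (\<bar>a\<bar> + \<bar>b\<bar>) \<le> B' * (\<bar>a\<bar> + \<bar>b\<bar>)" for a b :: real by (intro mult_right_mono) auto
    with Q show "Q t B'" unfolding Q_def case_prod_unfold by (meson order_trans)
  qed
  then obtain B where B: "B \<ge> 0" "\<And>t. Q t B" by blast
  show ?thesis
  proof (intro exI[of _ "1 / (B + 1)"] conjI allI impI)
    fix i j k :: 'n and u z x
    assume a: "i \<noteq> j \<and> i \<noteq> k \<and> j \<noteq> k \<and> y i - y j = u *\<^sub>R (y i - y k)" and g: "good \<kappa> z"
    have "1 \<le> B * (\<bar>gap z i j x\<bar> + \<bar>gap z i k x\<bar>)" using B(2)[of "(i, j, k)"] a g unfolding Q_def by blast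
    also have "\<dots> \<le> (B + 1) * (\<bar>gap z i j x\<bar> + \<bar>gap z i k x\<bar>)" by (intro mult_right_mono) auto
    finally show "1 / (B + 1) \<le> \<bar>gap z i j x\<bar> + \<bar>gap z i k x\<bar>"
      using B(1) by (simp add: field_simps)
  qed (use B in simp)
qed

lemma exp_minus_le_inverse_square:
  fixes t :: real
  assumes "0 < t"
  shows "exp (- t) \<le> 2 / t\<^sup>2"
proof -
  have "t\<^sup>2 / 2 \<le> exp t" using exp_lower_Taylor_quadratic[of t] assms by simp
  then show ?thesis using assms by (simp add: exp_minus field_simps)
qed

text \<open>Independent normals are covered by the double-slab bound. For collinear targets the sum
  of the gaps is at least \<open>c\<close> everywhere, so the integrand is at most
  \<open>exp (- (c / \<eta>))\<close>, which is already of order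
  \<open>\<eta>\<^sup>2\<close>.\<close>

lemma triple_bound:
  assumes \<kappa>: "0 < \<kappa>"
  shows "\<exists>C\<ge>0. \<forall>z i j k \<eta>. good \<kappa> z \<and> i \<noteq> j \<and> i \<noteq> k \<and> j \<noteq> k \<and> 0 < \<eta> \<longrightarrow>
     (LINT x|P. triple_exp \<eta> z i j k x) \<le> C * \<eta>\<^sup>2"
proof -
  obtain C where C: "C \<ge> 0" "\<And>z i j k \<eta>. (\<forall>c. y i - y j \<noteq> c *\<^sub>R (y i - y k)) \<Longrightarrow> i \<noteq> k \<Longrightarrow> 0 < \<eta> \<Longrightarrow>
     (LINT x|P. triple_exp \<eta> z i j k x) \<le> C * \<eta>\<^sup>2"
    using triple_noncollinear by blast
  obtain c where c: "c > 0" "\<And>i j k u z x. i \<noteq> j \<Longrightarrow> i \<noteq> k \<Longrightarrow> j \<noteq> k \<Longrightarrow> y i - y j = u *\<^sub>R (y i - y k) \<Longrightarrow>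
    good \<kappa> z \<Longrightarrow> c \<le> \<bar>gap z i j x\<bar> + \<bar>gap z i k x\<bar>"
    using collinear_offset_bound[OF \<kappa>] by blast
  show ?thesis
  proof (intro exI[of _ "C + 2 / c\<^sup>2"] conjI allI impI)
    fix z and i j k :: 'n and \<eta> :: real
    assume a: "good \<kappa> z \<and> i \<noteq> j \<and> i \<noteq> k \<and> j \<noteq> k \<and> 0 < \<eta>"
    show "(LINT x|P. triple_exp \<eta> z i j k x) \<le> (C + 2 / c\<^sup>2) * \<eta>\<^sup>2"
    proof (cases "\<forall>u. y i - y j \<noteq> u *\<^sub>R (y i - y k)")
      case True
      have "0 \<le> 2 / c\<^sup>2 * \<eta>\<^sup>2" by simp
      with C(2)[OF True, of \<eta> z] a show ?thesis unfolding distrib_right by linarith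
    next
      case False
      then obtain u where u: "y i - y j = u *\<^sub>R (y i - y k)" by auto
      have "triple_exp \<eta> z i j k x \<le> 2 / c\<^sup>2 * \<eta>\<^sup>2" for x
      proof -
        have "c \<le> \<bar>gap z i j x\<bar> + \<bar>gap z i k x\<bar>"
          by (rule c(2)[OF _ _ _ u]) (use a in auto)
        from divide_right_mono[OF this, of \<eta>]
        have "triple_exp \<eta> z i j k x \<le> exp (- (c / \<eta>))"
          using a
          by (simp only: minus_divide_left[symmetric] exp_le_cancel_iff neg_le_iff_le less_imp_le)
        also have "\<dots> \<le> 2 / (c / \<eta>)\<^sup>2" using c(1) a by (intro exp_minus_le_inverse_square) simp
        finally show ?thesis by (simp add: power_divide)
      qed
      then have "(LINT x|P. triple_exp \<eta> z i j k x) \<le> 2 / c\<^sup>2 * \<eta>\<^sup>2"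
        by (intro P.integral_le_const P.integrable_const_bound[where B="2 / c\<^sup>2 * \<eta>\<^sup>2"]) auto
      moreover have "0 \<le> C * \<eta>\<^sup>2" using C by simp
      ultimately show ?thesis unfolding distrib_right by linarith
    qed
  qed (use C in simp)
qed

section \<open>Transversality of the interfaces\<close>

text \<open>Shrink \<open>X\<close> slightly towards an interior point. Every point of the smaller
  copy is the centre of a ball of fixed radius inside \<open>X\<close>, and the copy misses so
  little mass that every cell of mass \<open>\<kappa>\<close> must meet it.\<close>

lemma deep_core:
  assumes \<kappa>: "0 < \<kappa>"
  shows "\<exists>r>0. \<exists>K\<subseteq>X. convex K \<and> K \<in> sets borel \<and> (\<forall>p\<in>K. cball p r \<subseteq> X) \<and> measure P (X - K) < \<kappa>"
proof -
  obtain x0 r0 where r0: "0 < r0" "cball x0 r0 \<subseteq> X"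
    using X_interior by (auto simp: mem_interior_cball)
  have x0: "x0 \<in> X" using r0 by auto
  let ?d = "real DIM('a)"
  \<comment> \<open>By Bernoulli's inequality a dilation of ratio \<open>1 - t\<close> loses mass at
    most \<open>(b - 1) * t\<close>. The added 1 keeps \<open>b\<close> positive, so that
    \<open>t\<close> can be chosen by dividing by it.\<close>
  define b where "b = M * ?d * measure lborel X + 1"
  have b: "1 \<le> b" using M_pos by (simp add: b_def)
  define t where "t = min (1/2) (\<kappa> / (2 * b))"
  have t: "0 < t" "t < 1" "t \<le> \<kappa> / (2 * b)" using \<kappa> b by (auto simp: t_def)
  define d where "d x = t *\<^sub>R x0 + (1 - t) *\<^sub>R x" for x
  have "continuous_on X d" unfolding d_def by (intro continuous_intros)
  then have K: "compact (d ` X)" using X_compact by (rule compact_continuous_image)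
  then have [measurable]: "d ` X \<in> sets borel" by (rule borel_compact)
  have sub: "d ` X \<subseteq> X" using X_convex x0 t by (auto simp: d_def intro: convexD)
  have "d ` X = (+) (t *\<^sub>R x0) ` ((*\<^sub>R) (1 - t) ` X)" by (auto simp: d_def)
  then have conv: "convex (d ` X)" by (simp only: convex_translation convex_scaling X_convex)
  have ball: "cball p (t * r0) \<subseteq> X" if pd: "p \<in> d ` X" for p
  proof
    fix q assume q: "q \<in> cball p (t * r0)"
    obtain x where x: "x \<in> X" "p = d x" using pd by blast
    have "norm ((1 / t) *\<^sub>R (q - p)) \<le> r0" using q t unfolding norm_scaleR by (simp add: dist_norm norm_minus_commute field_simps)
    then have "x0 + (1 / t) *\<^sub>R (q - p) \<in> X" using r0 by (auto simp: dist_norm)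
    then have "t *\<^sub>R (x0 + (1 / t) *\<^sub>R (q - p)) + (1 - t) *\<^sub>R x \<in> X" using x X_convex t by (intro convexD) auto
    also have "t *\<^sub>R (x0 + (1 / t) *\<^sub>R (q - p)) + (1 - t) *\<^sub>R x = q" using t x by (simp add: d_def scaleR_add_right)
    finally show "q \<in> X" .
  qed
  have dm: "measure lborel (d ` X) = (1 - t) ^ DIM('a) * measure lborel X"
    unfolding d_def by (rule measure_lborel_dilation[OF X_compact]) (use t in auto)
  have "measure P (X - d ` X) \<le> M * measure lborel (X - d ` X)"
    by (rule measure_P_le) auto
  also have "measure lborel (X - d ` X) = measure lborel X - measure lborel (d ` X)"
    using emeasure_lborel_X sub by (intro measure_Diff) auto
  also have "M * \<dots> = M * ((1 - (1 - t) ^ DIM('a)) * measure lborel X)" by (simp add: dm algebra_simps)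
  also have "\<dots> \<le> M * (?d * t * measure lborel X)"
    using Bernoulli_inequality[of "- t" "DIM('a)"] t M_pos by (intro mult_left_mono mult_right_mono) auto
  also have "\<dots> = (b - 1) * t" by (simp add: b_def mult_ac)
  also have "\<dots> \<le> b * t" using t by (intro mult_right_mono) auto
  also have "\<dots> \<le> b * (\<kappa> / (2 * b))" using t b by (intro mult_left_mono) auto
  also have "\<dots> < \<kappa>" using \<kappa> b by simp
  finally have "measure P (X - d ` X) < \<kappa>" .
  then show ?thesis using conv sub ball r0(1) t(1) by (intro exI[of _ "t * r0"] conjI exI[of _ "d ` X"]) auto
qed

definition mirror :: "real^'n \<Rightarrow> 'n \<Rightarrow> 'n \<Rightarrow> 'a \<Rightarrow> 'a" where
  "mirror z i j = reflect (y i - y j) (z $ i - z $ j)"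

lemma mirror_measurable [measurable]: "mirror z i j \<in> borel_measurable borel"
  unfolding mirror_def reflect_def[abs_def] by measurable

text \<open>The convex core of \<open>deep_core\<close> meets both cell \<open>i\<close> and cell
  \<open>j\<close>, hence by connectedness also the hyperplane between them. The meeting point
  carries a ball of fixed radius in \<open>X\<close>, which is the centre that
  \<open>reflect_leaving_measure\<close> needs.\<close>

lemma mirror_leaving:
  assumes \<kappa>: "0 < \<kappa>"
  shows "\<exists>C\<ge>0. \<forall>z i j s. good \<kappa> z \<and> i \<noteq> j \<and> 0 \<le> s \<longrightarrow>
    measure P {x\<in>X. \<bar>gap z i j x\<bar> \<le> s \<and> mirror z i j x \<notin> X} \<le> C * s\<^sup>2"
proof -
  obtain r K where r: "0 < r" and K: "K \<subseteq> X" "convex K" "K \<in> sets borel" "\<And>p. p \<in> K \<Longrightarrow> cball p r \<subseteq> X"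
    "measure P (X - K) < \<kappa>"
    using deep_core[OF \<kappa>] by blast
  obtain C where C: "C \<ge> 0" "\<And>z i j s. i \<noteq> j \<Longrightarrow> 0 \<le> s \<Longrightarrow> measure P {x. \<bar>gap z i j x\<bar> \<le> s} \<le> C * s"
    using slab_P by blast
  \<comment> \<open>A common bound for all inverse distances of distinct targets; the diagonal terms
    vanish because \<open>1 / 0 = 0\<close>.\<close>
  define e where "e = (\<Sum>i\<in>UNIV. \<Sum>j\<in>UNIV. 1 / norm (y i - y j))"
  have e: "1 / norm (y i - y j) \<le> e" for i j
  proof -
    have "1 / norm (y i - y j) \<le> (\<Sum>j\<in>UNIV. 1 / norm (y i - y j))"
      by (rule member_le_sum[of j UNIV "\<lambda>j. 1 / norm (y i - y j)"]) auto
    also have "\<dots> \<le> e" unfolding e_def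
      by (rule member_le_sum[of i UNIV "\<lambda>i. \<Sum>j\<in>UNIV. 1 / norm (y i - y j)"]) (auto intro!: sum_nonneg)
    finally show ?thesis .
  qed
  have e0: "0 \<le> e" unfolding e_def by (intro sum_nonneg) auto
  define c where "c = M * (2 * DIM('a) * (C / m) * e / r)"
  show ?thesis
  proof (intro exI[of _ c] conjI allI impI)
    fix z and i j :: 'n and s assume a: "good \<kappa> z \<and> i \<noteq> j \<and> 0 \<le> (s::real)"
    let ?a = "y i - y j" and ?b = "z $ i - z $ j"
    have meet: "K \<inter> cell z l \<noteq> {}" for l
    proof
      assume "K \<inter> cell z l = {}"
      then have "cell z l \<subseteq> X - K" by (auto simp: cell_eq)
      then have "measure P (cell z l) \<le> measure P (X - K)"
        using K(3) by (intro P.finite_measure_mono) auto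
      then show False using a K(5) by (force simp: good_def dest: spec[of _ l])
    qed
    obtain u where u: "u \<in> K" "u \<in> cell z i" using meet[of i] by blast
    obtain v where v: "v \<in> K" "v \<in> cell z j" using meet[of j] by blast
    have uv: "?a \<bullet> v \<le> ?b" "?b \<le> ?a \<bullet> u"
      using u(2) v(2) D_diff[of z i u j] D_diff[of z i v j] by (auto simp: cell_eq) (metis diff_ge_0_iff_ge diff_le_0_iff_le)+
    have "connected K" using K(2) by (rule convex_connected)
    then obtain p where p: "p \<in> K" "?a \<bullet> p = ?b"
      using connected_ivt_hyperplane[of K v u ?a ?b] u(1) v(1) uv by auto
    have meas: "{x\<in>X. \<bar>?a \<bullet> x - ?b\<bar> \<le> s} \<in> sets borel" "{x \<in> X. \<bar>?a \<bullet> x - ?b\<bar> \<le> s \<and> mirror z i j x \<notin> X} \<in> sets borel"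
      by measurable
    have "m * measure lborel {x\<in>X. \<bar>?a \<bullet> x - ?b\<bar> \<le> s} \<le> measure P {x\<in>X. \<bar>?a \<bullet> x - ?b\<bar> \<le> s}"
      by (rule measure_P_ge[OF meas(1)]) auto
    also have "\<dots> \<le> measure P {x. \<bar>gap z i j x\<bar> \<le> s}"
      unfolding D_diff by (intro P.finite_measure_mono) auto
    also have "\<dots> \<le> C * s" using a by (intro C) auto
    finally have slab: "measure lborel {x\<in>X. \<bar>?a \<bullet> x - ?b\<bar> \<le> s} \<le> C / m * s"
      using m_pos by (simp add: field_simps)
    have "measure P {x\<in>X. \<bar>?a \<bullet> x - ?b\<bar> \<le> s \<and> mirror z i j x \<notin> X}
      \<le> M * measure lborel {x\<in>X. \<bar>?a \<bullet> x - ?b\<bar> \<le> s \<and> mirror z i j x \<notin> X}"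
      by (rule measure_P_le[OF meas(2)]) auto
    also have "\<dots> \<le> M * (2 * DIM('a) * (C / m) / (norm ?a * r) * s\<^sup>2)"
      unfolding mirror_def
      using reflect_leaving_measure[OF X_compact X_convex K(4)[OF p(1)] r p(2) y_neq _ slab] a M_pos
      by (intro mult_left_mono) auto
    also have "\<dots> = M * ((2 * DIM('a) * (C / m) * s\<^sup>2 / r) * (1 / norm ?a))" by simp
    also have "\<dots> \<le> M * ((2 * DIM('a) * (C / m) * s\<^sup>2 / r) * e)"
      using M_pos m_pos C(1) r by (intro mult_left_mono e) auto
    also have "\<dots> = c * s\<^sup>2" by (simp add: c_def mult_ac)
    finally show "measure P {x\<in>X. \<bar>gap z i j x\<bar> \<le> s \<and> mirror z i j x \<notin> X} \<le> c * s\<^sup>2"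
      unfolding D_diff .
  qed (use M_pos m_pos C r e0 in \<open>simp add: c_def\<close>)
qed

end

section \<open>Expansion of the soft-max weights\<close>

lemma inner_reflect: "a \<noteq> 0 \<Longrightarrow> a \<bullet> reflect a b x - b = - (a \<bullet> x - b)"
  by (simp add: reflect_def inner_diff_right)

lemma reflect_reflect:
  assumes "a \<noteq> 0"
  shows "reflect a b (reflect a b x) = x"
proof -
  have "2 * (a \<bullet> reflect a b x - b) / (a \<bullet> a) = - (2 * (a \<bullet> x - b) / (a \<bullet> a))"
    unfolding inner_reflect[OF assms] mult_minus_right minus_divide_left ..
  then have "reflect a b (reflect a b x) = reflect a b x - (- (2 * (a \<bullet> x - b) / (a \<bullet> a))) *\<^sub>R a"
    by (simp only: reflect_def[of a b "reflect a b x"])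
  then show ?thesis unfolding scaleR_minus_left diff_minus_eq_add by (simp add: reflect_def)
qed

text \<open>An affine reflection is the linear reflection \<open>reflect a 0\<close>, an isometric
  involution, followed by a translation; both preserve Lebesgue measure.\<close>

lemma distr_lborel_reflect:
  fixes a :: "'a::euclidean_space"
  assumes a: "a \<noteq> 0"
  shows "distr lborel borel (reflect a b) = lborel"
proof (rule measure_eqI)
  show "sets (distr lborel borel (reflect a b)) = sets lborel" by simp
next
  fix S :: "'a set" assume "S \<in> sets (distr lborel borel (reflect a b))"
  then have S[measurable]: "S \<in> sets borel" by simp
  have [measurable]: "reflect a b \<in> borel_measurable borel" unfolding reflect_def[abs_def] by measurable
  define L where "L = reflect a 0"
  define c where "c = (2 * b / (a \<bullet> a)) *\<^sub>R a"
  have Lc: "reflect a b x = L x + c" for x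
    by (simp add: reflect_def L_def c_def diff_divide_distrib scaleR_diff_left)
  have lin: "linear L"
    unfolding L_def reflect_def
    by (intro linearI) (simp_all add: inner_add_right inner_scaleR_right algebra_simps add_divide_distrib scaleR_add_left)
  have iso: "norm (L x) = norm x" for x
  proof -
    have "L x \<bullet> L x = x \<bullet> x"
      using a by (simp add: L_def reflect_def inner_diff_left inner_diff_right inner_commute power2_eq_square field_simps)
    then show ?thesis by (simp add: norm_eq_sqrt_inner)
  qed
  have "emeasure (distr lborel borel (reflect a b)) S = (\<integral>\<^sup>+x. indicator S x \<partial>distr lborel borel (reflect a b))"
    by simp
  also have "\<dots> = (\<integral>\<^sup>+x. indicator S (reflect a b x) \<partial>lborel)"
    by (rule nn_integral_distr) measurable
  also have "\<dots> = (\<integral>\<^sup>+x. indicator S (L x + c) \<partial>lborel)" by (simp add: Lc)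
  also have "\<dots> = (\<integral>\<^sup>+x. indicator S (x + c) \<partial>lborel)"
    by (rule nn_integral_lborel_isometric_involution[of "\<lambda>x. indicator S (x + c)"])
       (use lin iso reflect_reflect[OF a] in \<open>auto simp: L_def\<close>)
  also have "\<dots> = emeasure lborel S"
    using nn_integral_lborel_translate[of "indicator S" c] by simp
  finally show "emeasure (distr lborel borel (reflect a b)) S = emeasure lborel S" .
qed

text \<open>The logistic function minus the indicator of \<open>t > 0\<close>, except that the value at \<open>0\<close> is \<open>0\<close> so that
  the function is odd.\<close>

definition om :: "real \<Rightarrow> real" where "om t = - sgn t / (1 + exp \<bar>t\<bar>)"

lemma om_measurable [measurable]: "om \<in> borel_measurable borel"
  unfolding om_def[abs_def] by measurable

lemma om_minus: "om (- t) = - om t" by (simp add: om_def sgn_minus)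

lemma om_neg: "t < 0 \<Longrightarrow> om t = 1 / (1 + exp (- t))" by (simp add: om_def)

lemma abs_om_le: "\<bar>om t\<bar> \<le> exp (- \<bar>t\<bar>)"
proof -
  have "\<bar>om t\<bar> \<le> 1 / (1 + exp \<bar>t\<bar>)" by (auto simp: om_def abs_mult sgn_if divide_right_mono abs_divide)
  also have "\<dots> \<le> 1 / exp \<bar>t\<bar>" by (intro divide_left_mono mult_pos_pos add_pos_pos) auto
  finally show ?thesis by (simp add: exp_minus divide_inverse)
qed

lemma abs_om_le_1: "\<bar>om t\<bar> \<le> 1"
  using abs_om_le[of t] by (rule order_trans) simp

text \<open>Half of the exponential pays for the power: in the variable
  \<open>u = h / \<epsilon>\<close> the bound is
  \<open>u powr \<alpha> \<le> 1 + u \<le> 2 * exp (u / 2)\<close>.\<close>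

lemma powr_mult_exp_le:
  assumes "0 < \<alpha>" "\<alpha> \<le> (1::real)" "0 < \<epsilon>" "0 \<le> h"
  shows "h powr \<alpha> * exp (- h / \<epsilon>) \<le> 2 * \<epsilon> powr \<alpha> * exp (- h / (2 * \<epsilon>))"
proof -
  define u where "u = h / \<epsilon>"
  have u: "0 \<le> u" "h = \<epsilon> * u" using assms by (auto simp: u_def)
  have "u powr \<alpha> \<le> 1 + u"
  proof (cases "u \<le> 1")
    case True
    then have "u powr \<alpha> \<le> 1" using u assms by (intro powr_le1) auto
    then show ?thesis using u by simp
  next
    case False
    then have "u powr \<alpha> \<le> u powr 1" using assms by (intro powr_mono) auto
    then show ?thesis using False by simp
  qed
  also have "\<dots> \<le> 2 * (1 + u / 2)" using u by simp
  also have "\<dots> \<le> 2 * exp (u / 2)" by (intro mult_left_mono exp_ge_add_one_self) auto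
  finally have "u powr \<alpha> * exp (- u) \<le> 2 * exp (u / 2) * exp (- u)" by (intro mult_right_mono) auto
  also have "\<dots> = 2 * exp (- u / 2)" by (simp add: mult_exp_exp)
  finally have "\<epsilon> powr \<alpha> * (u powr \<alpha> * exp (- u)) \<le> \<epsilon> powr \<alpha> * (2 * exp (- u / 2))" by (intro mult_left_mono) auto
  then show ?thesis using assms u by (simp add: powr_mult mult_ac)
qed

context semidiscrete begin

definition soft :: "real \<Rightarrow> real^'n \<Rightarrow> 'n \<Rightarrow> 'a \<Rightarrow> real" where
  "soft \<epsilon> z i x = exp (D z i x / \<epsilon>) / (\<Sum>j\<in>UNIV. exp (D z j x / \<epsilon>))"

lemma soft_measurable [measurable]: "soft \<epsilon> z i \<in> borel_measurable borel"
  unfolding soft_def[abs_def] by measurable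

lemma sum_exp_pos: "0 < (\<Sum>j\<in>(UNIV::'n set). exp (f j :: real))"
  by (intro sum_pos) auto

lemma soft_pos: "0 < soft \<epsilon> z i x"
  unfolding soft_def by (intro divide_pos_pos sum_exp_pos) simp

lemma sum_soft: "(\<Sum>i\<in>UNIV. soft \<epsilon> z i x) = 1"
  using sum_exp_pos[of "\<lambda>j. D z j x / \<epsilon>"] unfolding soft_def sum_divide_distrib[symmetric] by simp

lemma soft_le_1: "soft \<epsilon> z i x \<le> 1"
  using member_le_sum[of i UNIV "\<lambda>i. soft \<epsilon> z i x"] soft_pos sum_soft by (auto simp: less_imp_le)

lemma integrable_soft: "integrable P (soft \<epsilon> z i)"
  using soft_pos[of \<epsilon> z i] soft_le_1[of \<epsilon> z i] by (intro integrable_bounded[of _ 1]) (auto simp: abs_of_pos)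

text \<open>At a point without ties: the top index is \<open>i\<close> or \<open>j\<close>. So if
  \<open>a\<close> is on top, exactly the pairs containing \<open>a\<close> are active, and a weight
  \<open>i\<close> other than \<open>a\<close> receives a single pair correction.\<close>

definition only2 :: "real^'n \<Rightarrow> 'n \<Rightarrow> 'n \<Rightarrow> 'a set" where
  "only2 z i j = {x. \<forall>k. k \<noteq> i \<and> k \<noteq> j \<longrightarrow> D z k x < max (D z i x) (D z j x)}"

lemma only2_measurable [measurable]: "only2 z i j \<in> sets borel"
  unfolding only2_def by measurable

text \<open>The summand in which \<open>a\<close> is the top index is the product of the relative
  weights of two competitors. Summing over all \<open>a\<close> avoids a choice of the top index
  depending on \<open>x\<close>.\<close>

definition triples :: "real \<Rightarrow> real^'n \<Rightarrow> 'a \<Rightarrow> real" where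
  "triples \<epsilon> z x = (\<Sum>a\<in>UNIV. \<Sum>j\<in>-{a}. \<Sum>k\<in>-{a,j}. triple_exp \<epsilon> z a j k x)"

lemma triples_measurable [measurable]: "triples \<epsilon> z \<in> borel_measurable borel"
  unfolding triples_def[abs_def] by measurable

text \<open>Measured relative to the top index \<open>a\<close>, the weight of \<open>i\<close> is
  \<open>e i / (1 + S)\<close>, whereas the pair formed by \<open>i\<close> and \<open>a\<close>
  alone would give \<open>e i / (1 + e i)\<close>. The discrepancy is at most
  \<open>e i * (S - e i)\<close>, a sum of products of two relative weights.\<close>

lemma soft_expansion:
  assumes x: "x \<in> X" and ties: "\<And>i j. i \<noteq> j \<Longrightarrow> D z i x \<noteq> D z j x" and \<epsilon>: "0 < \<epsilon>"
  shows "\<bar>soft \<epsilon> z i x - indicator (cell z i) x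
      - (\<Sum>j\<in>-{i}. om (gap z i j x / \<epsilon>) * indicator (only2 z i j) x)\<bar> \<le> triples \<epsilon> z x"
proof -
  obtain a where a: "\<And>j. D z j x \<le> D z a x" using ex_argmax[of "\<lambda>j. D z j x"] by blast
  have lt: "D z j x < D z a x" if "j \<noteq> a" for j using a[of j] ties[OF that] by simp
  define e where "e j = exp (gap z j a x / \<epsilon>)" for j
  have e0: "0 < e j" for j by (simp add: e_def)
  define S where "S = (\<Sum>j\<in>-{a}. e j)"
  have S0: "0 \<le> S" unfolding S_def using e0 by (intro sum_nonneg) (auto simp: less_imp_le)
  have eS: "e j = exp (D z j x / \<epsilon>) / exp (D z a x / \<epsilon>)" for j
    by (simp add: e_def exp_diff diff_divide_distrib)
  have "(\<Sum>j\<in>UNIV. e j) = e a + S" unfolding S_def by (simp add: sum.remove[of UNIV a] Compl_eq_Diff_UNIV)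
  moreover have "e a = 1" by (simp add: e_def)
  ultimately have sumE: "(\<Sum>j\<in>UNIV. e j) = 1 + S" by simp
  have soft_e: "soft \<epsilon> z i x = e i / (1 + S)" for i
  proof -
    have "soft \<epsilon> z i x = (exp (D z i x / \<epsilon>) / exp (D z a x / \<epsilon>)) / ((\<Sum>j\<in>UNIV. exp (D z j x / \<epsilon>)) / exp (D z a x / \<epsilon>))"
      by (simp add: soft_def)
    also have "(\<Sum>j\<in>UNIV. exp (D z j x / \<epsilon>)) / exp (D z a x / \<epsilon>) = (\<Sum>j\<in>UNIV. e j)"
      by (simp add: eS sum_divide_distrib)
    finally show ?thesis by (simp only: sumE eS[symmetric])
  qed
  have Sj: "S - e j = (\<Sum>k\<in>-{a,j}. e k)" if "j \<noteq> a" for j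
  proof -
    have "-{a} = insert j (-{a,j})" using that by auto
    then show ?thesis unfolding S_def by simp
  qed
  have ee: "triple_exp \<epsilon> z a j k x = e j * e k" for j k
    using a[of j] a[of k] by (simp add: e_def mult_exp_exp add_divide_distrib[symmetric] algebra_simps)
  have "(\<Sum>j\<in>-{a}. \<Sum>k\<in>-{a,j}. triple_exp \<epsilon> z a j k x) \<le> triples \<epsilon> z x"
    unfolding triples_def
    by (rule member_le_sum[of a UNIV "\<lambda>a. \<Sum>j\<in>-{a}. \<Sum>k\<in>-{a,j}. triple_exp \<epsilon> z a j k x"])
       (auto intro!: sum_nonneg)
  moreover have "(\<Sum>j\<in>-{a}. \<Sum>k\<in>-{a,j}. e j * e k) = (\<Sum>j\<in>-{a}. e j * (S - e j))"
    using Sj by (intro sum.cong) (auto simp: sum_distrib_left)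
  ultimately have tr: "(\<Sum>j\<in>-{a}. e j * (S - e j)) \<le> triples \<epsilon> z x"
    unfolding ee by simp
  have nn: "0 \<le> e j * (S - e j)" if "j \<noteq> a" for j
    unfolding Sj[OF that] using e0 by (intro mult_nonneg_nonneg sum_nonneg) (auto simp: less_imp_le)
  have tm: "0 \<le> e j / (1 + e j) - e j / (1 + S) \<and> e j / (1 + e j) - e j / (1 + S) \<le> e j * (S - e j)" if "j \<noteq> a" for j
  proof -
    have "e j / (1 + e j) - e j / (1 + S) = e j * (S - e j) / ((1 + e j) * (1 + S))"
      using e0[of j] S0 by (simp add: field_simps)
    moreover have "1 \<le> (1 + e j) * (1 + S)" using e0[of j] S0 mult_mono[of 1 "1 + e j" 1 "1 + S"] by simp
    ultimately show ?thesis using nn[OF that]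
      by (simp add: divide_le_eq mult_right_le_one_le) (metis mult_left_mono mult.right_neutral)
  qed
  show ?thesis
  \<comment> \<open>For the top index all its pairs are active and their corrections sum up what the
    other weights take away; for any other index only the pair with \<open>a\<close>
    survives.\<close>
  proof (cases "i = a")
    case True
    have "x \<in> cell z i" using x a True by (simp add: cell_eq)
    moreover have "om (gap z i j x / \<epsilon>) * indicator (only2 z i j) x = - (e j / (1 + e j))" if "j \<in> -{i}" for j
    proof -
      have "x \<in> only2 z i j" using lt True by (auto simp: only2_def less_max_iff_disj)
      moreover have "om (gap z i j x / \<epsilon>) = - 1 / (1 + exp (gap z i j x / \<epsilon>))"
        using lt[of j] that True \<epsilon> by (simp add: om_def)
      moreover have "exp (gap z i j x / \<epsilon>) = 1 / e j"
        unfolding e_def True by (simp add: exp_minus[symmetric] divide_inverse[of 1] minus_divide_left)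
      moreover have "- 1 / (1 + 1 / e j) = - (e j / (1 + e j))" using e0[of j] by (simp add: field_simps)
      ultimately show ?thesis by (simp only: indicator_simps mult_1_right)
    qed
    then have "(\<Sum>j\<in>-{i}. om (gap z i j x / \<epsilon>) * indicator (only2 z i j) x) = (\<Sum>j\<in>-{a}. - (e j / (1 + e j)))"
      using True by (intro sum.cong) auto
    moreover have "soft \<epsilon> z i x = 1 - (\<Sum>j\<in>-{a}. e j / (1 + S))"
      unfolding soft_e True \<open>e a = 1\<close> sum_divide_distrib[symmetric] S_def[symmetric] using S0 by (simp add: field_simps)
    ultimately have "soft \<epsilon> z i x - indicator (cell z i) x
      - (\<Sum>j\<in>-{i}. om (gap z i j x / \<epsilon>) * indicator (only2 z i j) x) = (\<Sum>j\<in>-{a}. e j / (1 + e j) - e j / (1 + S))"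
      by (simp add: sum_subtractf sum_negf)
    also have "\<bar>\<dots>\<bar> \<le> (\<Sum>j\<in>-{a}. e j * (S - e j))"
      using tm by (intro order_trans[OF sum_abs] sum_mono) auto
    finally show ?thesis using tr by linarith
  next
    case False
    have "x \<notin> cell z i" using lt[OF False] by (auto simp: cell_eq not_le)
    moreover have "(\<Sum>j\<in>-{i}. om (gap z i j x / \<epsilon>) * indicator (only2 z i j) x)
        = (\<Sum>j\<in>-{i}. if j = a then e i / (1 + e i) else 0)"
    proof (intro sum.cong refl)
      fix j assume j: "j \<in> -{i}"
      show "om (gap z i j x / \<epsilon>) * indicator (only2 z i j) x = (if j = a then e i / (1 + e i) else 0)"
      proof (cases "j = a")
        case True
        have "x \<in> only2 z i j" using lt True by (auto simp: only2_def less_max_iff_disj)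
        moreover have "om (gap z i j x / \<epsilon>) = 1 / (1 + exp (- (gap z i j x / \<epsilon>)))"
          using lt[OF False] True \<epsilon> by (intro om_neg divide_neg_pos) auto
        moreover have "exp (- (gap z i j x / \<epsilon>)) = 1 / e i"
          unfolding e_def True by (simp add: exp_minus divide_inverse[of 1])
        moreover have "1 / (1 + 1 / e i) = e i / (1 + e i)" using e0[of i] by (simp add: field_simps)
        ultimately show ?thesis using True by (simp only: if_True simp_thms indicator_simps mult_1_right)
      next
        case jf: False
        have "\<not> D z a x < max (D z i x) (D z j x)" using a by (simp add: not_less)
        then have "x \<notin> only2 z i j" using jf False by (auto simp: only2_def)
        then show ?thesis using jf by simp
      qed
    qed
    ultimately have "soft \<epsilon> z i x - indicator (cell z i) x
      - (\<Sum>j\<in>-{i}. om (gap z i j x / \<epsilon>) * indicator (only2 z i j) x) = - (e i / (1 + e i) - e i / (1 + S))"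
      using False by (simp add: soft_e)
    also have "\<bar>\<dots>\<bar> \<le> e i * (S - e i)" using tm[OF False] by simp
    also have "\<dots> \<le> (\<Sum>j\<in>-{a}. e j * (S - e j))"
      using False nn by (intro member_le_sum) auto
    finally show ?thesis using tr by linarith
  qed
qed

lemma slab_exp:
  "\<exists>C\<ge>0. \<forall>z i j \<eta>. i \<noteq> j \<longrightarrow> 0 < \<eta> \<longrightarrow> (LINT x|P. exp (- \<bar>gap z i j x\<bar> / \<eta>)) \<le> C * \<eta>"
proof -
  obtain C where C: "C \<ge> 0" "\<And>z i j f. i \<noteq> j \<Longrightarrow> f \<in> borel_measurable borel \<Longrightarrow>
     (\<integral>\<^sup>+x. f (gap z i j x) \<partial>P) \<le> ennreal C * (\<integral>\<^sup>+t. f t \<partial>lborel)"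
    using slab_P_nn by blast
  have "(LINT x|P. exp (- \<bar>gap z i j x\<bar> / \<eta>)) \<le> C * 2 * \<eta>" if "i \<noteq> j" "0 < \<eta>" for z i j \<eta>
  proof (rule integral_real_bounded)
    have "(\<integral>\<^sup>+x. ennreal (exp (- \<bar>gap z i j x\<bar> / \<eta>)) \<partial>P) \<le> ennreal C * (\<integral>\<^sup>+t. ennreal (exp (- \<bar>t\<bar> / \<eta>)) \<partial>lborel)"
      using C(2)[OF that(1), of "\<lambda>t. ennreal (exp (- \<bar>t\<bar> / \<eta>))" z] by simp
    also have "\<dots> \<le> ennreal C * ennreal (2 * \<eta>)" by (intro mult_left_mono nn_integral_exp_abs_le that) simp
    also have "\<dots> = ennreal (C * 2 * \<eta>)" using C(1) that by (simp flip: ennreal_mult add: mult.assoc)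
    finally show "(\<integral>\<^sup>+x. ennreal (exp (- \<bar>gap z i j x\<bar> / \<eta>)) \<partial>P) \<le> ennreal (C * 2 * \<eta>)" .
  qed (use C that in simp)
  then show ?thesis using C(1) by (intro exI[of _ "C * 2"]) auto
qed

lemma D_mirror: "i \<noteq> j \<Longrightarrow> D z i (mirror z i j x) - D z j (mirror z i j x) = - (gap z i j x)"
  unfolding D_diff mirror_def by (rule inner_reflect[OF y_neq])

lemma mirror_mirror: "i \<noteq> j \<Longrightarrow> mirror z i j (mirror z i j x) = x"
  unfolding mirror_def by (rule reflect_reflect[OF y_neq])

lemma mirror_dist:
  "\<exists>E\<ge>1. \<forall>z i j x. i \<noteq> j \<longrightarrow> norm (x - mirror z i j x) \<le> E * \<bar>gap z i j x\<bar>"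
proof -
  \<comment> \<open>The summand 1 ensures \<open>E \<ge> 1\<close>, which later gives
    \<open>E powr \<alpha> \<le> E\<close>.\<close>
  define E where "E = 1 + (\<Sum>i\<in>UNIV. \<Sum>j\<in>UNIV. 2 / norm (y i - y j))"
  have e: "2 / norm (y i - y j) \<le> E" for i j
  proof -
    have "2 / norm (y i - y j) \<le> (\<Sum>j\<in>UNIV. 2 / norm (y i - y j))"
      by (rule member_le_sum[of j UNIV "\<lambda>j. 2 / norm (y i - y j)"]) auto
    also have "\<dots> \<le> (\<Sum>i\<in>UNIV. \<Sum>j\<in>UNIV. 2 / norm (y i - y j))"
      by (rule member_le_sum[of i UNIV "\<lambda>i. \<Sum>j\<in>UNIV. 2 / norm (y i - y j)"]) (auto intro!: sum_nonneg)
    finally show ?thesis by (simp add: E_def)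
  qed
  have "norm (x - mirror z i j x) \<le> E * \<bar>gap z i j x\<bar>" if "i \<noteq> j" for z i j x
  proof -
    have "norm (x - mirror z i j x) = (2 / norm (y i - y j)) * \<bar>gap z i j x\<bar>"
      using y_neq[OF that]
      unfolding mirror_def reflect_def D_diff
      by (simp only: diff_diff_eq2 add_diff_cancel_left' norm_scaleR abs_divide abs_mult)
         (simp add: power2_norm_eq_inner[symmetric] power2_eq_square)
    also have "\<dots> \<le> E * \<bar>gap z i j x\<bar>" by (intro mult_right_mono e) simp
    finally show ?thesis .
  qed
  moreover have "1 \<le> E" unfolding E_def by (simp add: sum_nonneg)
  ultimately show ?thesis by blast
qed

end

section \<open>Cancellation by reflection\<close>

text \<open>The error of a scalar test function with sup bound \<open>B\<close> and Hoelder constant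
  \<open>H\<close>. The 1 beside the squared logarithm keeps the first term from degenerating as
  \<open>\<epsilon>\<close> tends to 1.\<close>

abbreviation rate :: "real \<Rightarrow> real \<Rightarrow> real \<Rightarrow> real \<Rightarrow> real" where
  "rate \<alpha> \<epsilon> B H \<equiv> B * (\<epsilon>\<^sup>2 * (1 + (ln \<epsilon>)\<^sup>2)) + H * \<epsilon> powr (1 + \<alpha>)"

abbreviation hoelder_le :: "real \<Rightarrow> real \<Rightarrow> 'a::real_normed_vector set \<Rightarrow> ('a \<Rightarrow> real) \<Rightarrow> bool" where
  "hoelder_le \<alpha> H X \<psi> \<equiv> \<forall>x\<in>X. \<forall>x'\<in>X. \<bar>\<psi> x - \<psi> x'\<bar> \<le> H * norm (x - x') powr \<alpha>"

context semidiscrete begin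

lemma integrable_exp_neg:
  fixes f :: "'a \<Rightarrow> real"
  assumes "f \<in> borel_measurable borel" "\<And>x. 0 \<le> f x" "0 < \<eta>"
  shows "integrable P (\<lambda>x. exp (- f x / \<eta>))"
  by (rule integrable_bounded[of _ 1]) (use assms in auto)

lemma density_integral:
  fixes f :: "'a \<Rightarrow> real"
  assumes [measurable]: "f \<in> borel_measurable borel"
  shows "(LINT x|P. f x) = (LINT x|lborel. wt x * f x)"
    and "integrable P f \<longleftrightarrow> integrable lborel (\<lambda>x. wt x * f x)"
  unfolding P_wt using wt_bounds(1)
  by (simp_all add: integral_real_density integrable_real_density)

text \<open>Averaging over the mirror symmetry, under which \<open>om\<close> is odd, leaves only the oscillation of
  the weight \<open>\<psi> * \<rho>\<close> between mirror points.\<close>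

lemma symmetric_pair_bound:
  assumes ij: "i \<noteq> j" and \<alpha>: "0 < \<alpha>" "\<alpha> \<le> 1" and \<epsilon>: "0 < \<epsilon>" and E: "1 \<le> E"
    and dist: "\<And>x. norm (x - mirror z i j x) \<le> E * \<bar>gap z i j x\<bar>"
    and \<psi>[measurable]: "\<psi> \<in> borel_measurable borel" and B: "\<And>x. \<bar>\<psi> x\<bar> \<le> B" and H: "0 \<le> H"
    and hol: "\<And>x x'. x \<in> X \<Longrightarrow> x' \<in> X \<Longrightarrow> \<bar>\<psi> x - \<psi> x'\<bar> \<le> H * norm (x - x') powr \<alpha>"
    and A[measurable]: "A \<in> sets borel" "A \<subseteq> X"
    and sl: "(LINT x|P. exp (- \<bar>gap z i j x\<bar> / (2 * \<epsilon>))) \<le> C * (2 * \<epsilon>)"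
  shows "\<bar>LINT x|P. \<psi> x * (om (gap z i j x / \<epsilon>) * indicator {x\<in>A. mirror z i j x \<in> A} x)\<bar>
    \<le> 2 * E * (M + L) / m * C * (H * \<epsilon> powr (1 + \<alpha>) + B * \<epsilon>\<^sup>2)"
proof -
  let ?R = "mirror z i j" and ?h = "\<lambda>x. gap z i j x"
  define F where "F x = wt x * (\<psi> x * (om (?h x / \<epsilon>) * indicator {x\<in>A. ?R x \<in> A} x))" for x
  have [measurable]: "F \<in> borel_measurable borel" unfolding F_def by measurable
  have B0: "0 \<le> B" using B[of undefined] by linarith
  have intP: "integrable P (\<lambda>x. \<psi> x * (om (?h x / \<epsilon>) * indicator {x\<in>A. ?R x \<in> A} x))"
  proof (rule integrable_bounded[of _ "B * (1 * 1)"])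
    show "\<bar>\<psi> x * (om (?h x / \<epsilon>) * indicator {x\<in>A. ?R x \<in> A} x)\<bar> \<le> B * (1 * 1)" for x
      unfolding abs_mult by (intro mult_mono B abs_om_le_1) (auto simp: B0 indicator_def)
  qed measurable
  have IF: "(LINT x|P. \<psi> x * (om (?h x / \<epsilon>) * indicator {x\<in>A. ?R x \<in> A} x)) = (LINT x|lborel. F x)"
    and intF: "integrable lborel F"
    using intP density_integral[of "\<lambda>x. \<psi> x * (om (?h x / \<epsilon>) * indicator {x\<in>A. ?R x \<in> A} x)"]
    unfolding F_def by auto
  have dR: "distr lborel borel ?R = lborel"
    unfolding mirror_def by (rule distr_lborel_reflect[OF y_neq[OF ij]])
  have intFR: "integrable lborel (\<lambda>x. F (?R x))"
    using integrable_distr_eq[of ?R lborel borel F] intF dR by simp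
  have "(LINT x|lborel. F (?R x)) = (LINT x|distr lborel borel ?R. F x)"
    by (rule integral_distr[symmetric]) measurable
  then have "2 * (LINT x|lborel. F x) = (LINT x|lborel. F x) + (LINT x|lborel. F (?R x))" by (simp add: dR)
  also have "\<dots> = (LINT x|lborel. F x + F (?R x))"
    by (rule Bochner_Integration.integral_add[symmetric]) (use intF intFR in auto)
  finally have two: "2 * (LINT x|lborel. F x) = (LINT x|lborel. F x + F (?R x))" .
  define K where "K = E * (M + L) * 2 * (H * \<epsilon> powr \<alpha> + B * \<epsilon>)"
  have K0: "0 \<le> K" using E M_pos L_nonneg H B0 \<epsilon> by (simp add: K_def)
  have pt: "\<bar>F x + F (?R x)\<bar> \<le> wt x * (K / m * exp (- \<bar>?h x\<bar> / (2 * \<epsilon>)))" for x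
  proof (cases "x \<in> A \<and> ?R x \<in> A")
    case False
    then have "F x = 0" "F (?R x) = 0" by (auto simp: F_def mirror_mirror[OF ij])
    then show ?thesis using K0 m_pos wt_bounds(1)[of x] by simp
  next
    case True
    then have X: "x \<in> X" "?R x \<in> X" using A by auto
    then have w: "wt x = \<rho> x" "wt (?R x) = \<rho> (?R x)" by (auto simp: wt_def)
    have omR: "om (?h (?R x) / \<epsilon>) = - om (?h x / \<epsilon>)"
      by (simp only: D_mirror[OF ij] minus_divide_left[symmetric] om_minus)
    have "F x + F (?R x) = (\<rho> x * \<psi> x - \<rho> (?R x) * \<psi> (?R x)) * om (?h x / \<epsilon>)"
      using True by (simp add: F_def w mirror_mirror[OF ij] omR left_diff_distrib)
    then have "\<bar>F x + F (?R x)\<bar> = \<bar>\<rho> x * \<psi> x - \<rho> (?R x) * \<psi> (?R x)\<bar> * \<bar>om (?h x / \<epsilon>)\<bar>" by (simp add: abs_mult)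
    also have "\<dots> \<le> (E * (M + L) * (H * \<bar>?h x\<bar> powr \<alpha> + B * \<bar>?h x\<bar>)) * exp (- \<bar>?h x\<bar> / \<epsilon>)"
    proof (intro mult_mono)
      have d: "norm (x - ?R x) \<le> E * \<bar>?h x\<bar>" by (rule dist)
      have "norm (x - ?R x) powr \<alpha> \<le> (E * \<bar>?h x\<bar>) powr \<alpha>" using d \<alpha> by (intro powr_mono2) auto
      also have "\<dots> = E powr \<alpha> * \<bar>?h x\<bar> powr \<alpha>" using E by (simp add: powr_mult)
      also have "\<dots> \<le> E * \<bar>?h x\<bar> powr \<alpha>" using powr_mono[of \<alpha> 1 E] \<alpha> E by (intro mult_right_mono) auto
      finally have p: "norm (x - ?R x) powr \<alpha> \<le> E * \<bar>?h x\<bar> powr \<alpha>" .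
      have h\<psi>: "\<bar>\<psi> x - \<psi> (?R x)\<bar> \<le> H * (E * \<bar>?h x\<bar> powr \<alpha>)"
        using hol[OF X] mult_left_mono[OF p H] by linarith
      have h\<rho>: "\<bar>\<rho> x - \<rho> (?R x)\<bar> \<le> L * (E * \<bar>?h x\<bar>)"
        using \<rho>_lip[OF X] mult_left_mono[OF d L_nonneg] by linarith
      have "\<bar>\<rho> x * \<psi> x - \<rho> (?R x) * \<psi> (?R x)\<bar> = \<bar>\<rho> x * (\<psi> x - \<psi> (?R x)) + \<psi> (?R x) * (\<rho> x - \<rho> (?R x))\<bar>"
        by (simp add: algebra_simps)
      also have "\<dots> \<le> \<bar>\<rho> x\<bar> * \<bar>\<psi> x - \<psi> (?R x)\<bar> + \<bar>\<psi> (?R x)\<bar> * \<bar>\<rho> x - \<rho> (?R x)\<bar>"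
        unfolding abs_mult[symmetric] by (rule abs_triangle_ineq)
      also have "\<dots> \<le> M * (H * (E * \<bar>?h x\<bar> powr \<alpha>)) + B * (L * (E * \<bar>?h x\<bar>))"
        using \<rho>_bounds[OF X(1)] m_pos B0 M_pos
        by (intro add_mono mult_mono h\<psi> h\<rho> B) auto
      also have "\<dots> \<le> (M + L) * (H * (E * \<bar>?h x\<bar> powr \<alpha>)) + B * ((M + L) * (E * \<bar>?h x\<bar>))"
        using M_pos L_nonneg H B0 E by (intro add_mono mult_right_mono mult_left_mono) auto
      finally show "\<bar>\<rho> x * \<psi> x - \<rho> (?R x) * \<psi> (?R x)\<bar> \<le> E * (M + L) * (H * \<bar>?h x\<bar> powr \<alpha> + B * \<bar>?h x\<bar>)"
        by (simp add: algebra_simps)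
      show "\<bar>om (?h x / \<epsilon>)\<bar> \<le> exp (- \<bar>?h x\<bar> / \<epsilon>)" using abs_om_le[of "?h x / \<epsilon>"] \<epsilon> by simp
      show "0 \<le> E * (M + L) * (H * \<bar>?h x\<bar> powr \<alpha> + B * \<bar>?h x\<bar>)"
        using E M_pos L_nonneg H B0 by simp
    qed simp
    also have "\<dots> = E * (M + L) * (H * (\<bar>?h x\<bar> powr \<alpha> * exp (- \<bar>?h x\<bar> / \<epsilon>)) + B * (\<bar>?h x\<bar> powr 1 * exp (- \<bar>?h x\<bar> / \<epsilon>)))"
      by (simp add: algebra_simps)
    also have "\<dots> \<le> E * (M + L) * (H * (2 * \<epsilon> powr \<alpha> * exp (- \<bar>?h x\<bar> / (2 * \<epsilon>))) + B * (2 * \<epsilon> powr 1 * exp (- \<bar>?h x\<bar> / (2 * \<epsilon>))))"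
      using E M_pos L_nonneg H B0 \<alpha> \<epsilon>
      by (intro mult_left_mono add_mono powr_mult_exp_le) auto
    also have "\<dots> = K * exp (- \<bar>?h x\<bar> / (2 * \<epsilon>))" using \<epsilon> by (simp add: K_def algebra_simps)
    \<comment> \<open>On \<open>X\<close> the factor \<open>wt x / m\<close> is at least 1;
      inserting it turns the Lebesgue integral of the bound back into one over \<open>P\<close>,
      where \<open>sl\<close> applies.\<close>
    also have "\<dots> \<le> wt x * (K / m * exp (- \<bar>?h x\<bar> / (2 * \<epsilon>)))"
    proof -
      have "1 \<le> wt x / m" using wt_bounds(3)[of x] X m_pos by simp
      then have "1 * (K * exp (- \<bar>?h x\<bar> / (2 * \<epsilon>))) \<le> wt x / m * (K * exp (- \<bar>?h x\<bar> / (2 * \<epsilon>)))"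
        using K0 by (intro mult_right_mono) auto
      then show ?thesis by simp
    qed
    finally show ?thesis .
  qed
  have "integrable P (\<lambda>x. K / m * exp (- \<bar>?h x\<bar> / (2 * \<epsilon>)))"
    using \<epsilon> by (intro integrable_mult_right integrable_exp_neg) auto
  then have intG: "integrable lborel (\<lambda>x. wt x * (K / m * exp (- \<bar>?h x\<bar> / (2 * \<epsilon>))))"
    by (subst density_integral(2)[symmetric]) auto
  have "2 * \<bar>LINT x|lborel. F x\<bar> = \<bar>LINT x|lborel. F x + F (?R x)\<bar>" using two by linarith
  also have "\<dots> \<le> (LINT x|lborel. \<bar>F x + F (?R x)\<bar>)" by (rule integral_abs_bound)
  also have "\<dots> \<le> (LINT x|lborel. wt x * (K / m * exp (- \<bar>?h x\<bar> / (2 * \<epsilon>))))"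
    using intF intFR intG pt by (intro integral_mono) auto
  also have "\<dots> = (LINT x|P. K / m * exp (- \<bar>?h x\<bar> / (2 * \<epsilon>)))"
    by (rule density_integral(1)[symmetric]) measurable
  also have "\<dots> = K / m * (LINT x|P. exp (- \<bar>?h x\<bar> / (2 * \<epsilon>)))" by simp
  also have "\<dots> \<le> K / m * (C * (2 * \<epsilon>))" using sl K0 m_pos by (intro mult_left_mono) auto
  also have "\<dots> = 2 * (2 * E * (M + L) / m * C * (H * (\<epsilon> powr \<alpha> * \<epsilon>) + B * \<epsilon>\<^sup>2))"
    by (simp add: K_def power2_eq_square field_simps)
  also have "\<epsilon> powr \<alpha> * \<epsilon> = \<epsilon> powr (1 + \<alpha>)" using \<epsilon> by (simp add: powr_add mult.commute)
  finally show ?thesis unfolding IF by linarith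
qed

text \<open>If some \<open>k\<close> overtakes \<open>i\<close> and \<open>j\<close> only after
  reflection, it was already close: reflection changes each \<open>D\<close> by at most
  \<open>Y * E\<close> times the gap. The point is then a near coincidence of three
  functions.\<close>

lemma mirror_leaving_only2:
  assumes ij: "i \<noteq> j" and E: "1 \<le> E" and dist: "norm (x - mirror z i j x) \<le> E * \<bar>gap z i j x\<bar>"
    and x: "x \<in> only2 z i j" "mirror z i j x \<notin> only2 z i j"
  shows "\<exists>k. k \<noteq> i \<and> k \<noteq> j \<and> \<bar>gap z i k x\<bar> \<le> (1 + 2 * Y * E) * \<bar>gap z i j x\<bar>"
proof -
  let ?R = "mirror z i j" and ?h = "\<lambda>x. gap z i j x"
  obtain k where k: "k \<noteq> i" "k \<noteq> j" "max (D z i (?R x)) (D z j (?R x)) \<le> D z k (?R x)"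
    using x(2) by (auto simp: only2_def not_less)
  have kx: "D z k x < max (D z i x) (D z j x)" using x(1) k by (auto simp: only2_def)
  have Yd: "\<bar>D z l x - D z l (?R x)\<bar> \<le> Y * E * \<bar>?h x\<bar>" for l
  proof -
    have "\<bar>D z l x - D z l (?R x)\<bar> \<le> Y * norm (x - ?R x)" by (rule D_lip)
    also have "\<dots> \<le> Y * (E * \<bar>?h x\<bar>)" using dist Y_pos by (intro mult_left_mono) auto
    finally show ?thesis by (simp add: mult.assoc)
  qed
  have eq: "(1 + 2 * Y * E) * \<bar>?h x\<bar> = \<bar>?h x\<bar> + (Y * E * \<bar>?h x\<bar> + Y * E * \<bar>?h x\<bar>)" by (simp add: algebra_simps)
  define q where "q = Y * E * \<bar>?h x\<bar>"
  have q: "0 \<le> q" "\<bar>D z i x - D z i (?R x)\<bar> \<le> q" "\<bar>D z k x - D z k (?R x)\<bar> \<le> q"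
    using Y_pos E Yd by (simp_all add: q_def)
  have "D z i (?R x) \<le> D z k (?R x)" using k(3) by simp
  moreover have "D z k x < D z i x + \<bar>?h x\<bar>" using kx by linarith
  ultimately have "\<bar>gap z i k x\<bar> \<le> (1 + 2 * Y * E) * \<bar>?h x\<bar>"
    unfolding eq q_def[symmetric] using q by linarith
  then show ?thesis using k by blast
qed

text \<open>The odd cancellation needs a mirror-invariant domain. What is left over consists of
  points whose image leaves \<open>X\<close>, controlled by transversality, and points whose image
  leaves \<open>only2\<close>, controlled by triple coincidences.\<close>

lemma pair_bound:
  assumes \<kappa>: "0 < \<kappa>" and \<alpha>: "0 < \<alpha>" "\<alpha> \<le> 1"
  shows "\<exists>C\<ge>0. \<forall>z i j \<epsilon> \<psi> B H. good \<kappa> z \<longrightarrow> i \<noteq> j \<longrightarrow> 0 < \<epsilon> \<longrightarrow> \<epsilon> < 1 \<longrightarrow>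
     \<psi> \<in> borel_measurable borel \<longrightarrow> (\<forall>x. \<bar>\<psi> x\<bar> \<le> B) \<longrightarrow> 0 \<le> H \<longrightarrow>
     hoelder_le \<alpha> H X \<psi> \<longrightarrow>
     \<bar>LINT x|P. \<psi> x * (om (gap z i j x / \<epsilon>) * indicator (only2 z i j) x)\<bar>
       \<le> C * rate \<alpha> \<epsilon> B H"
proof -
  obtain E where E: "1 \<le> E" "\<And>z i j x. i \<noteq> j \<Longrightarrow> norm (x - mirror z i j x) \<le> E * \<bar>gap z i j x\<bar>"
    using mirror_dist by blast
  obtain C1 where C1: "C1 \<ge> 0" "\<And>z i j \<eta>. i \<noteq> j \<Longrightarrow> 0 < \<eta> \<Longrightarrow> (LINT x|P. exp (- \<bar>gap z i j x\<bar> / \<eta>)) \<le> C1 * \<eta>"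
    using slab_exp by blast
  obtain C2 where C2: "C2 \<ge> 0" "\<And>z i j s. good \<kappa> z \<Longrightarrow> i \<noteq> j \<Longrightarrow> 0 \<le> s \<Longrightarrow>
      measure P {x\<in>X. \<bar>gap z i j x\<bar> \<le> s \<and> mirror z i j x \<notin> X} \<le> C2 * s\<^sup>2"
    using mirror_leaving[OF \<kappa>] by blast
  obtain C3 where C3: "C3 \<ge> 0" "\<And>z i j k \<eta>. good \<kappa> z \<Longrightarrow> i \<noteq> j \<Longrightarrow> i \<noteq> k \<Longrightarrow> j \<noteq> k \<Longrightarrow> 0 < \<eta> \<Longrightarrow>
     (LINT x|P. triple_exp \<eta> z i j k x) \<le> C3 * \<eta>\<^sup>2"
    using triple_bound[OF \<kappa>] by blast
  define K where "K = 1 + 2 * Y * E"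
  have K: "1 \<le> K" using Y_pos E by (simp add: K_def)
  define N where "N = real CARD('n)"
  define Ca where "Ca = 2 * E * (M + L) / m * C1"
  \<comment> \<open>The three terms come from the cut-off \<open>s\<close>, with
    \<open>s\<^sup>2 = 4 * \<epsilon>\<^sup>2 * (ln \<epsilon>)\<^sup>2\<close>, from the tail
    \<open>\<epsilon>\<^sup>2\<close> beyond it, and from at most \<open>N\<close> triple integrals
    at scale \<open>2 * K * \<epsilon>\<close>.\<close>
  define Cb where "Cb = 4 * C2 + 1 + N * (C3 * (2 * K)\<^sup>2)"
  have Ca: "0 \<le> Ca" using E M_pos L_nonneg m_pos C1 by (simp add: Ca_def)
  have Cb: "0 \<le> Cb" using C2 C3 K by (simp add: Cb_def N_def)
  have main: "\<bar>LINT x|P. \<psi> x * (om (gap z i j x / \<epsilon>) * indicator (only2 z i j) x)\<bar>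
       \<le> (Ca + Cb) * rate \<alpha> \<epsilon> B H"
    if g: "good \<kappa> z" and ij: "i \<noteq> j" and \<epsilon>: "0 < \<epsilon>" "\<epsilon> < 1" and \<psi>[measurable]: "\<psi> \<in> borel_measurable borel"
      and B': "\<forall>x. \<bar>\<psi> x\<bar> \<le> B" and H: "0 \<le> H"
      and hol': "hoelder_le \<alpha> H X \<psi>"
    for z i j \<epsilon> \<psi> B H
  proof -
    note B = B'[rule_format] and hol = hol'[rule_format]
    let ?R = "mirror z i j" and ?h = "\<lambda>x. gap z i j x"
    define A where "A = X \<inter> only2 z i j"
    have A[measurable]: "A \<in> sets borel" "A \<subseteq> X" by (auto simp: A_def)
    have B0: "0 \<le> B" using B[of undefined] by linarith
    \<comment> \<open>The mirror is an involution, so \<open>?W\<close> is invariant under it;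
      \<open>?V\<close> collects the points at which the invariance of \<open>A\<close>
      fails.\<close>
    let ?W = "{x\<in>A. ?R x \<in> A}" and ?V = "{x\<in>A. ?R x \<notin> A}"
    let ?f = "\<lambda>S x. \<psi> x * (om (?h x / \<epsilon>) * indicator S x)"
    have int: "integrable P (?f S)" if [measurable]: "S \<in> sets borel" for S
    proof (rule integrable_bounded[of _ "B * (1 * 1)"])
      show "\<bar>?f S x\<bar> \<le> B * (1 * 1)" for x
        unfolding abs_mult by (intro mult_mono B abs_om_le_1) (auto simp: B0 indicator_def)
    qed measurable
    have "(LINT x|P. ?f (only2 z i j) x) = (LINT x|P. ?f ?W x + ?f ?V x)"
      using AE_X by (intro integral_cong_AE) (auto simp: A_def indicator_def)
    also have "\<dots> = (LINT x|P. ?f ?W x) + (LINT x|P. ?f ?V x)"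
      by (intro Bochner_Integration.integral_add int) measurable
    finally have split: "(LINT x|P. ?f (only2 z i j) x) = (LINT x|P. ?f ?W x) + (LINT x|P. ?f ?V x)" .
    have W: "\<bar>LINT x|P. ?f ?W x\<bar> \<le> Ca * (H * \<epsilon> powr (1 + \<alpha>) + B * \<epsilon>\<^sup>2)"
      unfolding Ca_def
      by (rule symmetric_pair_bound[OF ij \<alpha> \<epsilon>(1) E(1) E(2)[OF ij] \<psi> B H hol A C1(2)[OF ij]]) (use \<epsilon> in simp_all)
    \<comment> \<open>Beyond this gap the tail \<open>exp (- \<bar>?h x\<bar> / \<epsilon>)\<close>
      is at most \<open>\<epsilon>\<^sup>2\<close>; within it the mass of the bad set is of order
      \<open>s\<^sup>2\<close>.\<close>
    define s where "s = - (2 * \<epsilon> * ln \<epsilon>)"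
    have s: "0 \<le> s" using \<epsilon> by (simp add: s_def mult_nonneg_nonpos)
    let ?Bad = "{x\<in>X. \<bar>?h x\<bar> \<le> s \<and> ?R x \<notin> X}"
    let ?t = "\<lambda>k x. exp (- (\<bar>?h x\<bar> + \<bar>gap z i k x\<bar>) / (2 * K * \<epsilon>))"
    have pt: "\<bar>?f ?V x\<bar> \<le> B * (indicator ?Bad x + (\<epsilon>\<^sup>2 + (\<Sum>k\<in>-{i,j}. ?t k x)))" for x
    proof (cases "x \<in> ?V")
      case False then show ?thesis using B0 by (auto intro!: mult_nonneg_nonneg add_nonneg_nonneg sum_nonneg)
    next
      case True
      have t0: "0 \<le> (\<Sum>k\<in>-{i,j}. ?t k x)" by (intro sum_nonneg) simp
      have "\<bar>?f ?V x\<bar> = \<bar>\<psi> x\<bar> * \<bar>om (?h x / \<epsilon>)\<bar>" using True by (simp add: abs_mult)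
      also have "\<dots> \<le> B * exp (- \<bar>?h x\<bar> / \<epsilon>)"
        using abs_om_le[of "?h x / \<epsilon>"] \<epsilon> B0 by (intro mult_mono B) auto
      also have "exp (- \<bar>?h x\<bar> / \<epsilon>) \<le> indicator ?Bad x + (\<epsilon>\<^sup>2 + (\<Sum>k\<in>-{i,j}. ?t k x))"
      proof (cases "?R x \<in> X")
        case False
        show ?thesis
        proof (cases "\<bar>?h x\<bar> \<le> s")
          case True2: True
          then have "indicator ?Bad x = (1::real)" using True False A by auto
          moreover have "exp (- \<bar>?h x\<bar> / \<epsilon>) \<le> 1" using \<epsilon> by simp
          ultimately show ?thesis using t0 by (smt (verit) zero_le_power2)
        next
          case False
          then have "- \<bar>?h x\<bar> / \<epsilon> \<le> 2 * ln \<epsilon>" using \<epsilon> by (simp add: s_def field_simps)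
          then have "exp (- \<bar>?h x\<bar> / \<epsilon>) \<le> exp (2 * ln \<epsilon>)" by simp
          also have "exp (2 * ln \<epsilon>) = \<epsilon>\<^sup>2" using \<epsilon> by (simp add: exp_double)
          finally have "exp (- \<bar>?h x\<bar> / \<epsilon>) \<le> \<epsilon>\<^sup>2" .
          moreover have "(0::real) \<le> indicator ?Bad x" by simp
          ultimately show ?thesis using t0 by linarith
        qed
      next
        case True2: True
        obtain k where k: "k \<noteq> i" "k \<noteq> j" "\<bar>gap z i k x\<bar> \<le> K * \<bar>?h x\<bar>"
          using mirror_leaving_only2[OF ij E(1) E(2)[OF ij]] True True2 unfolding A_def K_def by blast
        \<comment> \<open>Both gaps are at most \<open>K\<close> times
          \<open>\<bar>?h x\<bar>\<close>, so their sum over \<open>2 * K * \<epsilon>\<close> is at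
          most \<open>\<bar>?h x\<bar> / \<epsilon>\<close>: the decay in one gap is traded for
          decay in both at a coarser scale.\<close>
        have "\<bar>?h x\<bar> \<le> K * \<bar>?h x\<bar>" using K mult_right_mono[of 1 K "\<bar>?h x\<bar>"] by simp
        then have "(\<bar>?h x\<bar> + \<bar>gap z i k x\<bar>) \<le> 2 * K * \<bar>?h x\<bar>" using k(3) by linarith
        then have "(\<bar>?h x\<bar> + \<bar>gap z i k x\<bar>) / (2 * K * \<epsilon>) \<le> 2 * K * \<bar>?h x\<bar> / (2 * K * \<epsilon>)"
          using K \<epsilon> by (intro divide_right_mono) auto
        also have "\<dots> = \<bar>?h x\<bar> / \<epsilon>" using K by simp
        finally have "exp (- \<bar>?h x\<bar> / \<epsilon>) \<le> ?t k x"
          by (simp only: minus_divide_left[symmetric] exp_le_cancel_iff neg_le_iff_le)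
        also have "\<dots> \<le> (\<Sum>k\<in>-{i,j}. ?t k x)"
          using k by (intro member_le_sum[of k "-{i,j}" "\<lambda>k. ?t k x"]) auto
        finally show ?thesis by (simp add: add.assoc[symmetric] add_increasing)
      qed
      finally show ?thesis using B0 by (simp add: mult_left_mono)
    qed
    have intt: "integrable P (?t k)" for k
      using K \<epsilon> by (intro integrable_exp_neg) auto
    have intBad: "integrable P (\<lambda>x. indicator ?Bad x :: real)"
      by (rule integrable_indicator_P) measurable
    have intR: "integrable P (\<lambda>x. indicator ?Bad x + (\<epsilon>\<^sup>2 + (\<Sum>k\<in>-{i,j}. ?t k x)))"
      by (intro Bochner_Integration.integrable_add Bochner_Integration.integrable_sum intt intBad) auto
    have "\<bar>LINT x|P. ?f ?V x\<bar> \<le> (LINT x|P. \<bar>?f ?V x\<bar>)" by (rule integral_abs_bound)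
    also have "\<dots> \<le> (LINT x|P. B * (indicator ?Bad x + (\<epsilon>\<^sup>2 + (\<Sum>k\<in>-{i,j}. ?t k x))))"
      by (intro integral_mono integrable_abs int integrable_mult_right intR pt) measurable
    also have "\<dots> = B * (LINT x|P. indicator ?Bad x + (\<epsilon>\<^sup>2 + (\<Sum>k\<in>-{i,j}. ?t k x)))" by simp
    also have "(LINT x|P. indicator ?Bad x + (\<epsilon>\<^sup>2 + (\<Sum>k\<in>-{i,j}. ?t k x))) = (LINT x|P. indicator ?Bad x) + (LINT x|P. \<epsilon>\<^sup>2 + (\<Sum>k\<in>-{i,j}. ?t k x))"
      by (intro Bochner_Integration.integral_add Bochner_Integration.integrable_add Bochner_Integration.integrable_sum intt intBad) auto
    also have "(LINT x|P. \<epsilon>\<^sup>2 + (\<Sum>k\<in>-{i,j}. ?t k x)) = (LINT x|P. \<epsilon>\<^sup>2) + (LINT x|P. (\<Sum>k\<in>-{i,j}. ?t k x))"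
      by (intro Bochner_Integration.integral_add Bochner_Integration.integrable_sum intt) auto
    also have "(LINT x|P. (\<Sum>k\<in>-{i,j}. ?t k x)) = (\<Sum>k\<in>-{i,j}. LINT x|P. ?t k x)"
      by (intro Bochner_Integration.integral_sum intt)
    also have "(LINT x|P. \<epsilon>\<^sup>2) = \<epsilon>\<^sup>2" using P.prob_space by simp
    also have "(LINT x|P. indicator ?Bad x) = measure P ?Bad" by simp
    also have "B * (measure P ?Bad + (\<epsilon>\<^sup>2 + (\<Sum>k\<in>-{i,j}. LINT x|P. ?t k x)))
      \<le> B * (C2 * s\<^sup>2 + (\<epsilon>\<^sup>2 + (\<Sum>k\<in>-{i,j}. C3 * (2 * K * \<epsilon>)\<^sup>2)))"
      using K \<epsilon> s g ij
      by (intro mult_left_mono add_mono sum_mono C2(2) C3(2) B0 order_refl) auto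
    also have "\<dots> \<le> B * (C2 * s\<^sup>2 + (\<epsilon>\<^sup>2 + N * (C3 * (2 * K * \<epsilon>)\<^sup>2)))"
    proof -
      have "card (-{i,j}) \<le> CARD('n)" by (intro card_mono) auto
      then have "real (card (-{i,j})) \<le> N" by (simp add: N_def)
      then show ?thesis unfolding sum_constant using C3(1) B0 by (intro mult_left_mono add_mono mult_right_mono) auto
    qed
    also have "\<dots> = B * \<epsilon>\<^sup>2 * (4 * C2 * (ln \<epsilon>)\<^sup>2 + 1 + N * (C3 * (2 * K)\<^sup>2))"
      by (simp add: s_def power2_eq_square algebra_simps)
    also have "\<dots> \<le> B * \<epsilon>\<^sup>2 * (Cb * (1 + (ln \<epsilon>)\<^sup>2))"
    proof (intro mult_left_mono)
      have "0 \<le> 4 * C2 + (1 + N * (C3 * (2 * K)\<^sup>2)) * (ln \<epsilon>)\<^sup>2" using C2 C3 by (simp add: N_def)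
      then show "4 * C2 * (ln \<epsilon>)\<^sup>2 + 1 + N * (C3 * (2 * K)\<^sup>2) \<le> Cb * (1 + (ln \<epsilon>)\<^sup>2)"
        unfolding Cb_def by (simp add: algebra_simps)
    qed (use B0 in simp)
    finally have V: "\<bar>LINT x|P. ?f ?V x\<bar> \<le> Cb * (B * (\<epsilon>\<^sup>2 * (1 + (ln \<epsilon>)\<^sup>2)))" by (simp add: mult_ac)
    have "Ca * (H * \<epsilon> powr (1 + \<alpha>) + B * \<epsilon>\<^sup>2) \<le> Ca * (H * \<epsilon> powr (1 + \<alpha>) + B * (\<epsilon>\<^sup>2 * (1 + (ln \<epsilon>)\<^sup>2)))"
      using Ca B0 mult_left_mono[of 1 "1 + (ln \<epsilon>)\<^sup>2" "\<epsilon>\<^sup>2"] by (intro mult_left_mono add_left_mono) auto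
    moreover have "0 \<le> Cb * (H * \<epsilon> powr (1 + \<alpha>))" using Cb H by simp
    ultimately show ?thesis unfolding split using W V by (simp add: algebra_simps abs_le_iff)
  qed
  show ?thesis
  proof (intro exI[of _ "Ca + Cb"] conjI allI impI, goal_cases)
    case (2 z i j \<epsilon> \<psi> B H)
    then show ?case by - (rule main; assumption)
  qed (use Ca Cb in simp)
qed

text \<open>The expansion integrated against \<open>\<psi>\<close>: \<open>pair_bound\<close> treats
  its pair terms and \<open>triple_bound\<close> its remainder. Ties, where the expansion may fail,
  form a null set.\<close>

lemma soft_cell_bound:
  assumes \<kappa>: "0 < \<kappa>" and \<alpha>: "0 < \<alpha>" "\<alpha> \<le> 1"
  shows "\<exists>C\<ge>0. \<forall>z i \<epsilon> \<psi> B H. good \<kappa> z \<longrightarrow> 0 < \<epsilon> \<longrightarrow> \<epsilon> < 1 \<longrightarrow>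
     \<psi> \<in> borel_measurable borel \<longrightarrow> (\<forall>x. \<bar>\<psi> x\<bar> \<le> B) \<longrightarrow> 0 \<le> H \<longrightarrow>
     hoelder_le \<alpha> H X \<psi> \<longrightarrow>
     \<bar>LINT x|P. \<psi> x * (soft \<epsilon> z i x - indicator (cell z i) x)\<bar>
       \<le> C * rate \<alpha> \<epsilon> B H"
proof -
  obtain C1 where C1: "C1 \<ge> 0" and pair: "\<forall>z i j \<epsilon> \<psi> B H. good \<kappa> z \<longrightarrow> i \<noteq> j \<longrightarrow> 0 < \<epsilon> \<longrightarrow> \<epsilon> < 1 \<longrightarrow>
     \<psi> \<in> borel_measurable borel \<longrightarrow> (\<forall>x. \<bar>\<psi> x\<bar> \<le> B) \<longrightarrow> 0 \<le> H \<longrightarrow>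
     hoelder_le \<alpha> H X \<psi> \<longrightarrow>
     \<bar>LINT x|P. \<psi> x * (om (gap z i j x / \<epsilon>) * indicator (only2 z i j) x)\<bar>
       \<le> C1 * rate \<alpha> \<epsilon> B H"
    using pair_bound[OF \<kappa> \<alpha>] by (elim exE conjE)
  obtain C3 where C3: "C3 \<ge> 0" "\<And>z i j k \<eta>. good \<kappa> z \<Longrightarrow> i \<noteq> j \<Longrightarrow> i \<noteq> k \<Longrightarrow> j \<noteq> k \<Longrightarrow> 0 < \<eta> \<Longrightarrow>
     (LINT x|P. triple_exp \<eta> z i j k x) \<le> C3 * \<eta>\<^sup>2"
    using triple_bound[OF \<kappa>] by blast
  define N where "N = real CARD('n)"
  define C where "C = N * C1 + N * (N * (N * C3))"
  have C0: "0 \<le> C" using C1 C3 by (simp add: C_def N_def)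
  have card: "real (card S) \<le> N" for S :: "'n set" unfolding N_def by (intro of_nat_mono card_mono) auto
  have const: "(\<Sum>k\<in>S. c) \<le> N * c" if "0 \<le> c" for S :: "'n set" and c :: real
    unfolding sum_constant using that by (intro mult_right_mono card)
  have main: "\<bar>LINT x|P. \<psi> x * (soft \<epsilon> z i x - indicator (cell z i) x)\<bar>
       \<le> C * rate \<alpha> \<epsilon> B H"
    if g: "good \<kappa> z" and \<epsilon>: "0 < \<epsilon>" "\<epsilon> < 1" and \<psi>[measurable]: "\<psi> \<in> borel_measurable borel"
      and B: "\<forall>x. \<bar>\<psi> x\<bar> \<le> B" and H: "0 \<le> H"
      and hol: "hoelder_le \<alpha> H X \<psi>"
    for z i \<epsilon> \<psi> B H
  proof -
    let ?b = "rate \<alpha> \<epsilon> B H"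
    have B0: "0 \<le> B" using B[rule_format, of undefined] by linarith
    let ?p = "\<lambda>j x. \<psi> x * (om (gap z i j x / \<epsilon>) * indicator (only2 z i j) x)"
    let ?s = "\<lambda>x. \<psi> x * (soft \<epsilon> z i x - indicator (cell z i) x)"
    have intp: "integrable P (?p j)" for j
    proof (rule integrable_bounded[of _ "B * (1 * 1)"])
      show "\<bar>?p j x\<bar> \<le> B * (1 * 1)" for x
        unfolding abs_mult by (intro mult_mono B[rule_format] abs_om_le_1) (auto simp: B0 indicator_def)
    qed measurable
    have ints: "integrable P ?s"
    proof (rule integrable_bounded[of _ "B * 1"])
      show "\<bar>?s x\<bar> \<le> B * 1" for x
        unfolding abs_mult
        by (intro mult_mono B[rule_format])
           (use B0 soft_le_1[of \<epsilon> z i x] soft_pos[of \<epsilon> z i x] in \<open>auto simp: indicator_def\<close>)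
    qed measurable
    have intt: "integrable P (\<lambda>x. triple_exp \<epsilon> z a j k x)" for a j k
      using \<epsilon> by (intro integrable_exp_neg) auto
    have inttr: "integrable P (triples \<epsilon> z)"
      unfolding triples_def[abs_def] by (intro Bochner_Integration.integrable_sum intt)
    have intps: "integrable P (\<lambda>x. \<Sum>j\<in>-{i}. ?p j x)" by (intro Bochner_Integration.integrable_sum intp)
    have "(LINT x|P. triples \<epsilon> z x) = (\<Sum>a\<in>UNIV. \<Sum>j\<in>-{a}. \<Sum>k\<in>-{a,j}.
        LINT x|P. triple_exp \<epsilon> z a j k x)"
      unfolding triples_def
      by (subst Bochner_Integration.integral_sum, intro Bochner_Integration.integrable_sum intt)+ simp
    also have "\<dots> \<le> (\<Sum>a\<in>(UNIV::'n set). \<Sum>j\<in>-{a}. \<Sum>k\<in>-{a,j}. C3 * \<epsilon>\<^sup>2)"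
      using g \<epsilon> by (intro sum_mono C3(2)) auto
    also have "\<dots> \<le> (\<Sum>a\<in>(UNIV::'n set). N * (N * (C3 * \<epsilon>\<^sup>2)))"
      using C3(1) by (intro sum_mono order_trans[OF sum_mono[OF const] const]) (auto simp: N_def)
    also have "\<dots> = N * (N * (N * C3)) * \<epsilon>\<^sup>2" by (simp add: N_def)
    finally have tr: "(LINT x|P. triples \<epsilon> z x) \<le> N * (N * (N * C3)) * \<epsilon>\<^sup>2" .
    have "\<bar>LINT x|P. ?s x - (\<Sum>j\<in>-{i}. ?p j x)\<bar> \<le> (LINT x|P. \<bar>?s x - (\<Sum>j\<in>-{i}. ?p j x)\<bar>)"
      by (rule integral_abs_bound)
    also have "\<dots> \<le> (LINT x|P. B * triples \<epsilon> z x)"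
    proof (intro integral_mono_AE)
      have "AE x in P. x \<in> X \<and> (\<forall>i j. i \<noteq> j \<longrightarrow> D z i x \<noteq> D z j x)"
        using AE_X AE_no_ties[of z] by auto
      then show "AE x in P. \<bar>?s x - (\<Sum>j\<in>-{i}. ?p j x)\<bar> \<le> B * triples \<epsilon> z x"
      proof (rule AE_mp, intro AE_I2 impI)
        fix x assume x: "x \<in> X \<and> (\<forall>i j. i \<noteq> j \<longrightarrow> D z i x \<noteq> D z j x)"
        have "?s x - (\<Sum>j\<in>-{i}. ?p j x) = \<psi> x * (soft \<epsilon> z i x - indicator (cell z i) x
          - (\<Sum>j\<in>-{i}. om (gap z i j x / \<epsilon>) * indicator (only2 z i j) x))"
          by (simp only: right_diff_distrib sum_distrib_left)
        also have "\<bar>\<dots>\<bar> \<le> B * triples \<epsilon> z x"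
          unfolding abs_mult using x B B0 \<epsilon> by (intro mult_mono soft_expansion) auto
        finally show "\<bar>?s x - (\<Sum>j\<in>-{i}. ?p j x)\<bar> \<le> B * triples \<epsilon> z x" .
      qed
    qed (use ints intps inttr in auto)
    also have "\<dots> = B * (LINT x|P. triples \<epsilon> z x)" by simp
    also have "\<dots> \<le> B * (N * (N * (N * C3)) * \<epsilon>\<^sup>2)" by (intro mult_left_mono tr B0)
    also have "\<dots> = N * (N * (N * C3)) * (B * \<epsilon>\<^sup>2)" by simp
    also have "\<dots> \<le> N * (N * (N * C3)) * ?b"
    proof (intro mult_left_mono)
      have "B * (\<epsilon>\<^sup>2 * 1) \<le> B * (\<epsilon>\<^sup>2 * (1 + (ln \<epsilon>)\<^sup>2))" using B0 by (intro mult_left_mono) auto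
      then show "B * \<epsilon>\<^sup>2 \<le> ?b" using H by (simp add: add_increasing2)
    qed (use C3 in \<open>simp add: N_def\<close>)
    finally have err: "\<bar>LINT x|P. ?s x - (\<Sum>j\<in>-{i}. ?p j x)\<bar> \<le> N * (N * (N * C3)) * ?b" .
    have "\<bar>\<Sum>j\<in>-{i}. LINT x|P. ?p j x\<bar> \<le> (\<Sum>j\<in>-{i}. C1 * ?b)"
      using g \<epsilon> \<psi> B H hol by (intro order_trans[OF sum_abs] sum_mono pair[rule_format]) auto
    also have "\<dots> \<le> N * (C1 * ?b)" unfolding sum_constant
      using C1 B0 H by (intro mult_right_mono card) auto
    finally have pp: "\<bar>\<Sum>j\<in>-{i}. LINT x|P. ?p j x\<bar> \<le> N * (C1 * ?b)" .
    have "(LINT x|P. ?s x - (\<Sum>j\<in>-{i}. ?p j x)) = (LINT x|P. ?s x) - (LINT x|P. (\<Sum>j\<in>-{i}. ?p j x))"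
      by (rule Bochner_Integration.integral_diff[OF ints intps])
    also have "(LINT x|P. (\<Sum>j\<in>-{i}. ?p j x)) = (\<Sum>j\<in>-{i}. LINT x|P. ?p j x)"
      by (intro Bochner_Integration.integral_sum intp)
    finally have "(LINT x|P. ?s x) = (LINT x|P. ?s x - (\<Sum>j\<in>-{i}. ?p j x)) + (\<Sum>j\<in>-{i}. LINT x|P. ?p j x)" by simp
    moreover have "C * ?b = N * (C1 * ?b) + N * (N * (N * C3)) * ?b" unfolding C_def by (simp add: distrib_right)
    ultimately show ?thesis using err pp by linarith
  qed
  show ?thesis
  proof (intro exI[of _ C] conjI allI impI C0, goal_cases)
    case (1 z i \<epsilon> \<psi> B H)
    then show ?case by - (rule main; assumption)
  qed
qed

end

section \<open>Strong monotonicity of the cell masses\<close>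

lemma Max_image_le_add:
  fixes f g :: "'b \<Rightarrow> real"
  assumes "finite S" "S \<noteq> {}" and le: "\<And>j. j \<in> S \<Longrightarrow> f j \<le> g j + c"
  shows "Max (f ` S) \<le> Max (g ` S) + c"
proof -
  have "f j \<le> Max (g ` S) + c" if "j \<in> S" for j
  proof -
    have "g j \<le> Max (g ` S)" using assms(1) that by (intro Max_ge) auto
    then show ?thesis using le[OF that] by linarith
  qed
  then show ?thesis using assms by (subst Max_le_iff) auto
qed

text \<open>Pigeonhole. Cut the interval from \<open>v k\<close> to \<open>v i\<close> into
  \<open>CARD('n)\<close> equal pieces. Without a gap each open piece would contain a value, so the
  pieces alone would use up all indices, yet \<open>v k\<close> is an endpoint and lies in none of
  them.\<close>

lemma exists_gap:
  fixes v :: "'n::finite \<Rightarrow> real"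
  assumes "v k < v i"
  shows "\<exists>t. v k \<le> t \<and> t < v i \<and> (\<forall>l. v l \<le> t \<or> t + (v i - v k) / CARD('n) \<le> v l)"
proof (rule ccontr)
  assume no: "\<not> ?thesis"
  let ?N = "CARD('n)"
  define \<delta> where "\<delta> = (v i - v k) / ?N"
  have \<delta>: "0 < \<delta>" using assms by (simp add: \<delta>_def)
  have "\<exists>l. v k + real p * \<delta> < v l \<and> v l < v k + real (Suc p) * \<delta>" if "p < ?N" for p
  proof -
    have "real p * \<delta> < real ?N * \<delta>" using that \<delta> by (intro mult_strict_right_mono) auto
    then have "v k + real p * \<delta> < v i" by (simp add: \<delta>_def)
    moreover have "v k \<le> v k + real p * \<delta>" using \<delta> by simp
    ultimately obtain l where "\<not> v l \<le> v k + real p * \<delta>" "\<not> v k + real p * \<delta> + \<delta> \<le> v l"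
      using no unfolding \<delta>_def by blast
    then show ?thesis by (intro exI[of _ l]) (simp add: algebra_simps)
  qed
  then obtain f where f: "\<And>p. p < ?N \<Longrightarrow> v k + real p * \<delta> < v (f p) \<and> v (f p) < v k + real (Suc p) * \<delta>"
    by metis
  have lt: "v (f p) < v (f p')" if "p < p'" "p' < ?N" for p p'
  proof -
    have "real (Suc p) * \<delta> \<le> real p' * \<delta>" using that \<delta> by (intro mult_right_mono) auto
    then show ?thesis using f[of p] f[of p'] that by linarith
  qed
  have "inj_on f {..<?N}"
  proof (rule linorder_inj_onI)
    fix p p' assume "p < p'" "p \<in> {..<?N}" "p' \<in> {..<?N}"
    then show "f p \<noteq> f p'" using lt[of p p'] by auto
  qed auto
  then have "card (f ` {..<?N}) = ?N" by (simp add: card_image)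
  then have "f ` {..<?N} = UNIV" by (intro card_subset_eq) auto
  then obtain p where p: "p < ?N" "f p = k" by (metis UNIV_I image_iff lessThan_iff)
  then have "real p * \<delta> < 0" using f[of p] by simp
  then show False using \<delta> by (simp add: mult_less_0_iff)
qed

context semidiscrete begin

section \<open>Unions of cells as superlevel sets of a difference of maxima\<close>

definition top_in :: "real^'n \<Rightarrow> 'n set \<Rightarrow> 'a set" where
  "top_in z A = {x\<in>X. \<exists>a\<in>A. \<forall>j. D z j x \<le> D z a x}"

lemma top_in_measurable [measurable]: "top_in z A \<in> sets borel"
  unfolding top_in_def by measurable

text \<open>The closed cells overlap only in ties, which are null.\<close>

lemma measure_top_in: "measure P (top_in z A) = (\<Sum>a\<in>A. measure P (cell z a))"
proof -
  have "measure P (top_in z A) = (LINT x|P. indicator (top_in z A) x)" by simp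
  also have "\<dots> = (LINT x|P. (\<Sum>a\<in>A. indicator (cell z a) x))"
  proof (rule integral_cong_AE)
    show "AE x in P. (indicator (top_in z A) x :: real) = (\<Sum>a\<in>A. indicator (cell z a) x)"
      using AE_no_ties[of z]
    proof (rule AE_mp, intro AE_I2 impI)
      fix x assume ties: "\<forall>i j. i \<noteq> j \<longrightarrow> D z i x \<noteq> D z j x"
      show "(indicator (top_in z A) x :: real) = (\<Sum>a\<in>A. indicator (cell z a) x)"
      proof (cases "x \<in> top_in z A")
        case True
        then obtain a where a: "a \<in> A" "x \<in> cell z a" by (auto simp: top_in_def cell_eq)
        have "x \<notin> cell z b" if "b \<noteq> a" for b
          using a(2) ties that unfolding cell_eq by (auto dest!: spec intro: antisym)
        then have "(\<Sum>b\<in>A. indicator (cell z b) x) = (\<Sum>b\<in>A. if b = a then 1 else (0::real))"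
          using a by (intro sum.cong) auto
        also have "\<dots> = 1" using a by simp
        finally show ?thesis using True by simp
      next
        case False
        then show ?thesis by (auto simp: top_in_def cell_eq indicator_def)
      qed
    qed
  qed measurable
  also have "\<dots> = (\<Sum>a\<in>A. measure P (cell z a))"
    by (subst Bochner_Integration.integral_sum) (auto intro: integrable_indicator_P)
  finally show ?thesis .
qed

lemma top_in_UNIV: "top_in z UNIV = X"
  using ex_argmax[of "\<lambda>j. D z j x" for x] by (auto simp: top_in_def)

lemma sum_cells: "(\<Sum>a\<in>UNIV. measure P (cell z a)) = 1"
  using measure_top_in[of z UNIV] by (simp add: top_in_UNIV measure_P_X)

text \<open>The difference of \<open>mx A z\<close> and \<open>mx (-A) z\<close> is a Lipschitz
  function whose sign decides membership in \<open>top_in z A\<close>. With the full index set,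
  \<open>mx\<close> is also the integrand of the unregularised semidual.\<close>

definition mx :: "'n set \<Rightarrow> real^'n \<Rightarrow> 'a \<Rightarrow> real" where
  "mx S z x = Max ((\<lambda>j. D z j x) ` S)"

lemma mx_measurable [measurable]: "mx S z \<in> borel_measurable borel"
  unfolding mx_def[abs_def] by measurable

lemma mx_ge: "j \<in> S \<Longrightarrow> D z j x \<le> mx S z x"
  unfolding mx_def by (intro Max_ge) auto

lemma mx_attained: "S \<noteq> {} \<Longrightarrow> \<exists>a\<in>S. mx S z x = D z a x"
proof -
  assume "S \<noteq> {}"
  then have "Max ((\<lambda>j. D z j x) ` S) \<in> (\<lambda>j. D z j x) ` S" by (intro Max_in) auto
  then show ?thesis unfolding mx_def by blast
qed

lemma mx_lip: "S \<noteq> {} \<Longrightarrow> \<bar>mx S z x - mx S z x'\<bar> \<le> Y * norm (x - x')"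
proof -
  assume S: "S \<noteq> {}"
  have "mx S z u \<le> mx S z v + Y * norm (u - v)" for u v
    unfolding mx_def using D_lip[of z _ u v] S by (intro Max_image_le_add) (auto simp: abs_le_iff algebra_simps)
  from this[of x x'] this[of x' x] show ?thesis by (auto simp: abs_le_iff norm_minus_commute)
qed

lemma in_top_in_iff:
  assumes A: "A \<noteq> {}" "-A \<noteq> {}" and x: "x \<in> X"
  shows "x \<in> top_in z A \<longleftrightarrow> mx (-A) z x \<le> mx A z x"
proof
  assume "x \<in> top_in z A"
  then obtain a where a: "a \<in> A" "\<And>j. D z j x \<le> D z a x" by (auto simp: top_in_def)
  obtain b where "b \<in> -A" "mx (-A) z x = D z b x" using mx_attained[OF A(2)] by blast
  then show "mx (-A) z x \<le> mx A z x" using a(2)[of b] mx_ge[OF a(1), of z x] by linarith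
next
  assume le: "mx (-A) z x \<le> mx A z x"
  obtain a where a: "a \<in> A" "mx A z x = D z a x" using mx_attained[OF A(1)] by blast
  have "D z j x \<le> D z a x" for j
    using mx_ge[of j A z x] mx_ge[of j "-A" z x] a(2) le by (cases "j \<in> A") auto
  then show "x \<in> top_in z A" using a x by (auto simp: top_in_def)
qed

text \<open>Any point of the nonempty cell \<open>i\<close> satisfies the inequality against
  \<open>k\<close>, and \<open>X\<close> lies in the ball of radius \<open>R\<close>.\<close>

lemma good_oscillation:
  assumes "good \<kappa> z" "0 < \<kappa>"
  shows "z $ i - z $ k \<le> 2 * Y * R"
proof -
  have "measure P (cell z i) \<noteq> 0" using assms by (auto simp: good_def dest: spec[of _ i])
  then obtain x where x: "x \<in> cell z i" by (metis ex_in_conv measure_empty)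
  then have "z $ i - z $ k \<le> (y i - y k) \<bullet> x" using D_diff[of z i x k] by (auto simp: cell_eq) (smt (verit))
  also have "\<dots> \<le> norm (y i - y k) * norm x" by (rule norm_cauchy_schwarz)
  also have "\<dots> \<le> (2 * Y) * R"
  proof (intro mult_mono)
    show "norm (y i - y k) \<le> 2 * Y" using norm_triangle_ineq4[of "y i" "y k"] y_Y[of i] y_Y[of k] by linarith
    show "norm x \<le> R" using x X_R by (auto simp: cell_eq)
  qed (use Y_pos in auto)
  finally show ?thesis .
qed

text \<open>\<open>convex_slab_mass\<close> for the difference of the two maxima, whose Lipschitz
  constant is at most \<open>2 * Y\<close>. The density bounds convert between volume and
  mass.\<close>

lemma slab_mass_lower:
  assumes \<kappa>: "0 < \<kappa>"
  shows "\<exists>K\<ge>0. \<forall>A z \<delta>. A \<noteq> {} \<longrightarrow> -A \<noteq> {} \<longrightarrow> 0 < \<delta> \<longrightarrow>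
    \<kappa> \<le> measure P {x\<in>X. 0 \<le> mx A z x - mx (-A) z x} \<longrightarrow>
    \<kappa> \<le> measure P {x\<in>X. mx A z x - mx (-A) z x < - \<delta>} \<longrightarrow>
    \<delta> \<le> K * measure P {x\<in>X. - \<delta> \<le> mx A z x - mx (-A) z x \<and> mx A z x - mx (-A) z x < 0}"
proof -
  define V where "V = 2 ^ DIM('a) * measure lborel X"
  \<comment> \<open>The volumes on the two sides are at least \<open>\<kappa> / M\<close> each, the
    denominator \<open>2 * L * R\<close> becomes \<open>4 * Y * R\<close>, and the passage from slab
    volume to slab mass costs \<open>1 / m\<close>.\<close>
  define K where "K = V * (4 * Y * R) * M\<^sup>2 / (m * \<kappa>\<^sup>2)"
  show ?thesis
  proof (intro exI[of _ K] conjI allI impI)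
    show "0 \<le> K" using Y_pos R_pos M_pos m_pos by (simp add: K_def V_def)
  next
    fix A :: "'n set" and z and \<delta> :: real
    assume A: "A \<noteq> {}" "-A \<noteq> {}" and \<delta>: "0 < \<delta>"
    define h where "h x = mx A z x - mx (-A) z x" for x
    have [measurable]: "h \<in> borel_measurable borel" unfolding h_def[abs_def] by measurable
    define E where "E = {x\<in>X. 0 \<le> h x}"
    define F where "F = {x\<in>X. h x < - \<delta>}"
    define S where "S = {x\<in>X. - \<delta> \<le> h x \<and> h x < 0}"
    have m[measurable]: "E \<in> sets borel" "F \<in> sets borel" "S \<in> sets borel" unfolding E_def F_def S_def by measurable
    have sub: "E \<subseteq> X" "F \<subseteq> X" "S \<subseteq> X" by (auto simp: E_def F_def S_def)
    assume "\<kappa> \<le> measure P {x\<in>X. 0 \<le> mx A z x - mx (-A) z x}" "\<kappa> \<le> measure P {x\<in>X. mx A z x - mx (-A) z x < - \<delta>}"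
    then have "\<kappa> \<le> measure P E" "\<kappa> \<le> measure P F" by (simp_all add: E_def F_def h_def)
    then have "\<kappa> \<le> M * measure lborel E" "\<kappa> \<le> M * measure lborel F"
      using measure_P_le[OF m(1) sub(1)] measure_P_le[OF m(2) sub(2)] by linarith+
    then have EF: "\<kappa> / M \<le> measure lborel E" "\<kappa> / M \<le> measure lborel F"
      using M_pos by (simp_all add: divide_le_eq mult.commute)
    have lip: "\<bar>h x - h x'\<bar> \<le> (2 * Y) * norm (x - x')" for x x'
      using mx_lip[OF A(1), of z x x'] mx_lip[OF A(2), of z x x'] unfolding h_def by linarith
    define c where "c = \<delta> / (2 * (2 * Y) * R)"
    have c: "0 \<le> c" using \<delta> Y_pos R_pos by (simp add: c_def)
    have "emeasure lborel E * emeasure lborel F * ennreal c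
      \<le> ennreal (2 ^ DIM('a)) * emeasure lborel X * emeasure lborel S"
      unfolding E_def F_def S_def c_def
      by (rule convex_slab_mass[OF X_convex X_R R_pos]) (use lip \<delta> Y_pos in auto)
    then have "ennreal (measure lborel E) * ennreal (measure lborel F) * ennreal c
      \<le> ennreal (2 ^ DIM('a)) * ennreal (measure lborel X) * ennreal (measure lborel S)"
      by (simp only: emeasure_eq_measure2[OF X_fmeasurable[OF m(1) sub(1)]] emeasure_eq_measure2[OF X_fmeasurable[OF m(2) sub(2)]]
          emeasure_eq_measure2[OF X_fmeasurable[OF m(3) sub(3)]] emeasure_eq_measure2[OF X_fmeasurable[OF X_borel order_refl]])
    then have "ennreal (measure lborel E * measure lborel F * c) \<le> ennreal (V * measure lborel S)"
      using c by (simp add: V_def ennreal_mult)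
    then have le: "measure lborel E * measure lborel F * (\<delta> / (2 * (2 * Y) * R)) \<le> V * measure lborel S"
      unfolding c_def by (subst (asm) ennreal_le_iff) (auto simp: V_def)
    have "(\<kappa> / M) * (\<kappa> / M) * (\<delta> / (2 * (2 * Y) * R)) \<le> measure lborel E * measure lborel F * (\<delta> / (2 * (2 * Y) * R))"
      using EF \<kappa> M_pos \<delta> Y_pos R_pos by (intro mult_right_mono mult_mono) auto
    also have "\<dots> \<le> V * (measure P S / m)"
      using le measure_P_ge[OF m(3) sub(3)] m_pos
      by (elim order_trans, intro mult_left_mono) (auto simp: V_def le_divide_eq mult.commute)
    finally have "\<delta> \<le> K * measure P S"
      using \<kappa> M_pos Y_pos R_pos m_pos by (simp add: K_def field_simps power2_eq_square)
    then show "\<delta> \<le> K * measure P {x\<in>X. - \<delta> \<le> mx A z x - mx (-A) z x \<and> mx A z x - mx (-A) z x < 0}"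
      by (simp add: S_def h_def)
  qed
qed

text \<open>Strong monotonicity of the cell masses: cut the index set at a gap of \<open>z' - z\<close>; the union of
  the cells on one side of the cut gains a slab whose width is the gap.\<close>

lemma potential_stability:
  assumes \<kappa>: "0 < \<kappa>"
  shows "\<exists>K\<ge>0. \<forall>z z' i k. good \<kappa> z \<longrightarrow> good \<kappa> z' \<longrightarrow>
    (z' $ i - z $ i) - (z' $ k - z $ k) \<le> K * (\<Sum>l\<in>UNIV. \<bar>measure P (cell z' l) - measure P (cell z l)\<bar>)"
proof -
  obtain K1 where K1: "0 \<le> K1" and slab: "\<forall>A z \<delta>. A \<noteq> {} \<longrightarrow> -A \<noteq> {} \<longrightarrow> 0 < \<delta> \<longrightarrow>
    \<kappa> / 2 \<le> measure P {x\<in>X. 0 \<le> mx A z x - mx (-A) z x} \<longrightarrow>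
    \<kappa> / 2 \<le> measure P {x\<in>X. mx A z x - mx (-A) z x < - \<delta>} \<longrightarrow>
    \<delta> \<le> K1 * measure P {x\<in>X. - \<delta> \<le> mx A z x - mx (-A) z x \<and> mx A z x - mx (-A) z x < 0}"
    using slab_mass_lower[of "\<kappa> / 2"] \<kappa> by auto
  define N where "N = real CARD('n)"
  define K2 where "K2 = 8 * Y * R / \<kappa>"
  have K2: "0 \<le> K2" using Y_pos R_pos \<kappa> by (simp add: K2_def)
  show ?thesis
  proof (intro exI[of _ "N * (K1 + K2)"] conjI allI impI)
    show "0 \<le> N * (K1 + K2)" using K1 K2 by (simp add: N_def)
  next
    fix z z' :: "real^'n" and i k assume g: "good \<kappa> z" "good \<kappa> z'"
    let ?G = "\<lambda>z l. measure P (cell z l)"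
    let ?s = "\<Sum>l\<in>UNIV. \<bar>?G z' l - ?G z l\<bar>"
    define v where "v l = z' $ l - z $ l" for l
    have s0: "0 \<le> ?s" by (intro sum_nonneg) auto
    show "(z' $ i - z $ i) - (z' $ k - z $ k) \<le> N * (K1 + K2) * ?s"
    proof (cases "v k < v i")
      case False
      then have "(z' $ i - z $ i) - (z' $ k - z $ k) \<le> 0" by (simp add: v_def)
      also have "0 \<le> N * (K1 + K2) * ?s" using s0 K1 K2 by (simp add: N_def)
      finally show ?thesis .
    next
      case True
      define \<delta> where "\<delta> = (v i - v k) / CARD('n)"
      have \<delta>: "0 < \<delta>" using True by (simp add: \<delta>_def)
      obtain t where t: "v k \<le> t" "t < v i" "\<And>l. v l \<le> t \<or> t + \<delta> \<le> v l"
        using exists_gap[OF True] unfolding \<delta>_def by blast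
      \<comment> \<open>The indices below the gap: passing from \<open>z\<close> to
        \<open>z'\<close> lowers their functions by at most \<open>t\<close>, all others by at least
        \<open>t + \<delta>\<close>.\<close>
      define A where "A = {l. v l \<le> t}"
      have kA: "k \<in> A" and iA: "i \<in> -A" using t by (auto simp: A_def)
      then have A: "A \<noteq> {}" "-A \<noteq> {}" by auto
      have vB: "t + \<delta> \<le> v l" if "l \<in> -A" for l using t(3)[of l] that by (auto simp: A_def)
      have Dv: "D z' l x = D z l x - v l" for l x by (simp add: D_def v_def)
      define h where "h x = mx A z x - mx (-A) z x" for x
      have [measurable]: "h \<in> borel_measurable borel" unfolding h_def[abs_def] by measurable
      have hz': "h x + \<delta> \<le> mx A z' x - mx (-A) z' x" for x
      proof -
        have "mx A z x \<le> mx A z' x + t"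
          unfolding mx_def using A by (intro Max_image_le_add) (auto simp: Dv A_def)
        moreover have "mx (-A) z' x \<le> mx (-A) z x + (- t - \<delta>)"
          unfolding mx_def
        proof (intro Max_image_le_add)
          show "D z' j x \<le> D z j x + (- t - \<delta>)" if "j \<in> -A" for j using vB[OF that] by (simp add: Dv)
        qed (use A in auto)
        ultimately show ?thesis by (simp add: h_def)
      qed
      have tz: "top_in z A = {x\<in>X. 0 \<le> h x}"
        using in_top_in_iff[OF A] by (auto simp: h_def) (auto simp: top_in_def)
      let ?S = "{x\<in>X. - \<delta> \<le> h x \<and> h x < 0}"
      \<comment> \<open>Since the difference of maxima rises by at least \<open>\<delta>\<close>,
        the whole slab below zero changes sides and is gained by \<open>A\<close>.\<close>
      have "?S \<subseteq> top_in z' A - top_in z A"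
        unfolding tz using in_top_in_iff[OF A, of _ z'] hz' by (smt (verit) DiffI mem_Collect_eq subsetI)
      then have "measure P ?S \<le> measure P (top_in z' A - top_in z A)"
        by (intro P.finite_measure_mono) auto
      also have "\<dots> = measure P (top_in z' A) - measure P (top_in z A)"
      proof (rule P.finite_measure_Diff)
        show "top_in z A \<subseteq> top_in z' A"
          unfolding tz using in_top_in_iff[OF A, of _ z'] hz' \<delta> by (smt (verit) mem_Collect_eq subsetI)
      qed auto
      also have "\<dots> = (\<Sum>l\<in>A. ?G z' l - ?G z l)" by (simp add: measure_top_in sum_subtractf)
      also have "\<dots> \<le> (\<Sum>l\<in>A. \<bar>?G z' l - ?G z l\<bar>)" by (intro sum_mono) auto
      also have "\<dots> \<le> ?s" by (intro sum_mono2) auto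
      finally have Ss: "measure P ?S \<le> ?s" .
      have E: "\<kappa> \<le> measure P {x\<in>X. 0 \<le> h x}"
      proof -
        have "\<kappa> \<le> ?G z k" using g by (simp add: good_def)
        also have "\<dots> \<le> (\<Sum>l\<in>A. ?G z l)" using kA by (intro member_le_sum) auto
        finally show ?thesis using measure_top_in[of z A] by (simp add: tz)
      qed
      have E': "measure P {x\<in>X. 0 \<le> h x} \<le> 1 - \<kappa>"
      proof -
        have "\<kappa> \<le> ?G z i" using g by (simp add: good_def)
        also have "\<dots> \<le> (\<Sum>l\<in>-A. ?G z l)" using iA by (intro member_le_sum) auto
        also have "\<dots> = 1 - (\<Sum>l\<in>A. ?G z l)"
          using sum.subset_diff[of A UNIV "?G z"] sum_cells[of z] by (simp add: Compl_eq_Diff_UNIV)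
        finally show ?thesis using measure_top_in[of z A] by (simp add: tz)
      qed
      have "\<delta> \<le> (K1 + K2) * measure P ?S"
      \<comment> \<open>If less than \<open>\<kappa> / 2\<close> lies beyond the slab, the slab
        itself has mass at least \<open>\<kappa> / 2\<close>, because the complement of
        \<open>{h \<ge> 0}\<close> has mass at least \<open>\<kappa>\<close>. Then a bound on
        \<open>\<delta>\<close> suffices, and the oscillation of the two potentials gives
        \<open>4 * Y * R\<close>; this explains \<open>K2\<close>.\<close>
      proof (cases "\<kappa> / 2 \<le> measure P {x\<in>X. h x < - \<delta>}")
        case True
        have "\<delta> \<le> K1 * measure P ?S"
          unfolding h_def by (rule slab[rule_format, OF A \<delta>]) (use True E \<kappa> in \<open>simp_all add: h_def\<close>)
        moreover have "0 \<le> K2 * measure P ?S" using K2 by simp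
        ultimately show ?thesis by (simp add: distrib_right)
      next
        case False
        have "measure P X \<le> measure P (({x\<in>X. 0 \<le> h x} \<union> {x\<in>X. h x < - \<delta>}) \<union> ?S)"
          by (intro P.finite_measure_mono) (auto simp: not_less)
        also have "\<dots> \<le> measure P ({x\<in>X. 0 \<le> h x} \<union> {x\<in>X. h x < - \<delta>}) + measure P ?S"
          by (intro measure_Un_le) auto
        finally have "1 \<le> measure P ({x\<in>X. 0 \<le> h x} \<union> {x\<in>X. h x < - \<delta>}) + measure P ?S"
          by (simp add: measure_P_X)
        moreover have "measure P ({x\<in>X. 0 \<le> h x} \<union> {x\<in>X. h x < - \<delta>}) \<le> measure P {x\<in>X. 0 \<le> h x} + measure P {x\<in>X. h x < - \<delta>}"
          by (intro measure_Un_le) auto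
        ultimately have S: "\<kappa> / 2 \<le> measure P ?S" using False E' by linarith
        have "\<delta> \<le> (v i - v k) / 1" unfolding \<delta>_def using True by (intro divide_left_mono) auto
        also have "\<dots> \<le> 4 * Y * R"
          using good_oscillation[OF g(1) \<kappa>, of k i] good_oscillation[OF g(2) \<kappa>, of i k] by (simp add: v_def)
        also have "\<dots> = K2 * (\<kappa> / 2)" using \<kappa> by (simp add: K2_def)
        also have "\<dots> \<le> K2 * measure P ?S" using S K2 by (intro mult_left_mono)
        finally have "\<delta> \<le> K2 * measure P ?S" .
        moreover have "0 \<le> K1 * measure P ?S" using K1 by simp
        ultimately show ?thesis by (simp add: distrib_right)
      qed
      also have "\<dots> \<le> (K1 + K2) * ?s" using Ss K1 K2 by (intro mult_left_mono) auto
      finally have "N * \<delta> \<le> N * ((K1 + K2) * ?s)" by (intro mult_left_mono) (auto simp: N_def)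
      moreover have "N * \<delta> = v i - v k" by (simp add: N_def \<delta>_def)
      ultimately show ?thesis by (simp add: v_def mult.assoc)
    qed
  qed
qed

end

section \<open>Existence and optimality of the potentials\<close>

text \<open>The coordinates of an admissible \<open>z\<close> sum to zero, so a coordinate of
  modulus above \<open>r\<close> is accompanied by one of the opposite sign or zero, and their
  difference exceeds \<open>r\<close>. Coercivity then puts \<open>f z\<close> above
  \<open>f 0\<close>, and the minimum may be sought in a compact box.\<close>

lemma attains_min_orthogonal_ones:
  fixes f :: "real^'n \<Rightarrow> real"
  assumes lip: "\<And>z z'. \<bar>f z - f z'\<bar> \<le> B * norm (z - z')" and c: "0 < c"
    and coercive: "\<And>z i j. z \<bullet> vec 1 = 0 \<Longrightarrow> c * (z $ i - z $ j) - K \<le> f z"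
  shows "\<exists>z. is_arg_min f (\<lambda>z. z \<bullet> vec 1 = 0) z"
proof -
  define r where "r = (\<bar>f 0\<bar> + \<bar>K\<bar>) / c"
  have r: "0 \<le> r" using c by (simp add: r_def)
  define S where "S = {z::real^'n. z \<bullet> vec 1 = 0} \<inter> {z. \<forall>i. \<bar>z $ i\<bar> \<le> r}"
  have "closed S" unfolding S_def
    by (intro closed_Int closed_Collect_eq closed_Collect_all closed_Collect_le continuous_intros)
  moreover have "bounded S"
  proof (rule boundedI)
    fix z assume "z \<in> S"
    then have "(\<Sum>i\<in>UNIV. \<bar>z $ i\<bar>) \<le> (\<Sum>i\<in>(UNIV::'n set). r)" by (intro sum_mono) (auto simp: S_def)
    then show "norm z \<le> (\<Sum>i\<in>(UNIV::'n set). r)" using norm_le_l1_cart[of z] by linarith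
  qed
  ultimately have "compact S" by (simp add: compact_eq_bounded_closed)
  have B: "0 \<le> B" using lip[of 0 "axis undefined 1"] by (simp add: zero_le_mult_iff)
  have "continuous_on S f"
  proof (rule lipschitz_on_continuous_on)
    show "B-lipschitz_on S f" by (rule lipschitz_onI) (use lip B in \<open>auto simp: dist_real_def dist_norm\<close>)
  qed
  moreover have "0 \<in> S" using r by (simp add: S_def)
  ultimately obtain z where z: "z \<in> S" "\<And>w. w \<in> S \<Longrightarrow> f z \<le> f w"
    using continuous_attains_inf[OF \<open>compact S\<close>, of f] by auto
  have "f z \<le> f w" if w: "w \<bullet> vec 1 = 0" for w
  proof (cases "w \<in> S")
    case False
    have sum0: "(\<Sum>i\<in>UNIV. w $ i) = 0" using w by (simp add: inner_vec_def)
    obtain i where i: "r < \<bar>w $ i\<bar>" using False w by (auto simp: S_def not_le)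
    have "\<exists>a b. r < w $ a - w $ b"
    proof (cases "0 \<le> w $ i")
      case True
      have "\<exists>b. w $ b \<le> 0"
      proof (rule ccontr)
        assume "\<not> ?thesis"
        then have "0 < (\<Sum>i\<in>UNIV. w $ i)" by (intro sum_pos) (auto simp: not_le)
        then show False using sum0 by simp
      qed
      then obtain b where "w $ b \<le> 0" ..
      then have "r < w $ i - w $ b" using i True by linarith
      then show ?thesis by blast
    next
      case False
      have "\<exists>b. 0 \<le> w $ b"
      proof (rule ccontr)
        assume "\<not> ?thesis"
        then have "(\<Sum>i\<in>UNIV. w $ i) < (\<Sum>i\<in>(UNIV::'n set). 0)" by (intro sum_strict_mono) (auto simp: not_le)
        then show False using sum0 by simp
      qed
      then obtain b where "0 \<le> w $ b" ..
      then have "r < w $ b - w $ i" using i False by linarith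
      then show ?thesis by blast
    qed
    then obtain a b where "r < w $ a - w $ b" by blast
    then have "c * r < c * (w $ a - w $ b)" using c by (intro mult_strict_left_mono)
    moreover have "c * r = \<bar>f 0\<bar> + \<bar>K\<bar>" using c by (simp add: r_def)
    ultimately have "f 0 \<le> f w" using coercive[OF w, of a b] by linarith
    then show ?thesis using z(2)[OF \<open>0 \<in> S\<close>] by simp
  qed (rule z(2))
  then show ?thesis using z(1) by (intro exI[of _ z]) (auto simp: is_arg_min_def S_def not_less)
qed

context semidiscrete begin

text \<open>A common form of the two semiduals, so that existence of minimisers and the first-order
  condition are proved once for both.\<close>

definition energy :: "(real^'n \<Rightarrow> 'a \<Rightarrow> real) \<Rightarrow> real^'n \<Rightarrow> real^'n \<Rightarrow> real" where
  "energy \<Phi> q z = (LINT x|P. \<Phi> z x) + z \<bullet> q"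

text \<open>Both the maximum of the \<open>D z i\<close> and its log-sum-exp relaxation are instances.\<close>

definition smax_like :: "(real^'n \<Rightarrow> 'a \<Rightarrow> real) \<Rightarrow> bool" where
  "smax_like \<Phi> \<longleftrightarrow> (\<forall>z. \<Phi> z \<in> borel_measurable borel) \<and> (\<forall>z i x. D z i x \<le> \<Phi> z x) \<and>
     (\<forall>z z' x x' c. (\<forall>i. D z i x \<le> D z' i x' + c) \<longrightarrow> \<Phi> z x \<le> \<Phi> z' x' + c)"

lemma smax_like_mx: "smax_like (mx UNIV)"
  unfolding smax_like_def
proof (intro conjI allI impI)
  fix z z' x x' c assume "\<forall>i. D z i x \<le> D z' i x' + c"
  then show "mx UNIV z x \<le> mx UNIV z' x' + c" unfolding mx_def by (intro Max_image_le_add) auto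
qed (auto intro: mx_ge)

definition lse :: "real \<Rightarrow> real^'n \<Rightarrow> 'a \<Rightarrow> real" where
  "lse \<epsilon> z x = \<epsilon> * ln (\<Sum>i\<in>UNIV. exp (D z i x / \<epsilon>))"

lemma smax_like_lse:
  assumes \<epsilon>: "0 < \<epsilon>"
  shows "smax_like (lse \<epsilon>)"
  unfolding smax_like_def
proof (intro conjI allI impI)
  fix z show "lse \<epsilon> z \<in> borel_measurable borel" unfolding lse_def[abs_def] by measurable
next
  fix z i x
  have "exp (D z i x / \<epsilon>) \<le> (\<Sum>i\<in>UNIV. exp (D z i x / \<epsilon>))"
    by (rule member_le_sum[of i UNIV "\<lambda>i. exp (D z i x / \<epsilon>)"]) auto
  then have "D z i x / \<epsilon> \<le> ln (\<Sum>i\<in>UNIV. exp (D z i x / \<epsilon>))"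
    using sum_exp_pos by (simp add: ln_ge_iff)
  then show "D z i x \<le> lse \<epsilon> z x" using \<epsilon> by (simp add: lse_def field_simps)
next
  fix z z' x x' c assume le: "\<forall>i. D z i x \<le> D z' i x' + c"
  have "(\<Sum>i\<in>UNIV. exp (D z i x / \<epsilon>)) \<le> (\<Sum>i\<in>UNIV. exp (c / \<epsilon>) * exp (D z' i x' / \<epsilon>))"
  proof (rule sum_mono)
    fix i
    have "D z i x / \<epsilon> \<le> (c + D z' i x') / \<epsilon>" using le[rule_format, of i] \<epsilon> by (intro divide_right_mono) auto
    then show "exp (D z i x / \<epsilon>) \<le> exp (c / \<epsilon>) * exp (D z' i x' / \<epsilon>)"
      by (simp add: mult_exp_exp add_divide_distrib)
  qed
  also have "\<dots> = exp (c / \<epsilon>) * (\<Sum>i\<in>UNIV. exp (D z' i x' / \<epsilon>))" by (simp add: sum_distrib_left)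
  finally have "ln (\<Sum>i\<in>UNIV. exp (D z i x / \<epsilon>)) \<le> ln (exp (c / \<epsilon>) * (\<Sum>i\<in>UNIV. exp (D z' i x' / \<epsilon>)))"
    using sum_exp_pos by (intro ln_mono) auto
  also have "\<dots> = c / \<epsilon> + ln (\<Sum>i\<in>UNIV. exp (D z' i x' / \<epsilon>))"
    using sum_exp_pos[of "\<lambda>i. D z' i x' / \<epsilon>"] by (simp add: ln_mult)
  finally have "\<epsilon> * ln (\<Sum>i\<in>UNIV. exp (D z i x / \<epsilon>)) \<le> \<epsilon> * (c / \<epsilon> + ln (\<Sum>i\<in>UNIV. exp (D z' i x' / \<epsilon>)))"
    using \<epsilon> by (intro mult_left_mono) auto
  then show "lse \<epsilon> z x \<le> lse \<epsilon> z' x' + c" using \<epsilon> by (simp add: lse_def distrib_left)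
qed

context
  fixes \<Phi> assumes \<Phi>: "smax_like \<Phi>"
begin

lemma smax_measurable [measurable]: "\<Phi> z \<in> borel_measurable borel"
  using \<Phi> by (simp add: smax_like_def)

lemma smax_ge: "D z i x \<le> \<Phi> z x" using \<Phi> by (simp add: smax_like_def)

lemma smax_le: "(\<And>i. D z i x \<le> D z' i x' + c) \<Longrightarrow> \<Phi> z x \<le> \<Phi> z' x' + c"
  using \<Phi> unfolding smax_like_def by blast

lemma smax_lip: "\<bar>\<Phi> z x - \<Phi> z' x\<bar> \<le> norm (z - z')"
proof -
  have "\<Phi> u x \<le> \<Phi> v x + norm (u - v)" for u v
  proof (rule smax_le)
    fix i show "D u i x \<le> D v i x + norm (u - v)"
      using component_le_norm_cart[of "u - v" i] by (simp add: D_def abs_le_iff)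
  qed
  from this[of z z'] this[of z' z] show ?thesis by (auto simp: abs_le_iff norm_minus_commute)
qed

lemma smax_integrable: "integrable P (\<Phi> z)"
proof (rule P.integrable_const_bound)
  define x0 where "x0 = (SOME x. x \<in> X)"
  have x0: "x0 \<in> X" unfolding x0_def using X_nonempty by (simp add: some_in_eq)
  have "\<bar>\<Phi> z x\<bar> \<le> \<bar>\<Phi> z x0\<bar> + Y * (2 * R)" if x: "x \<in> X" for x
  proof -
    have n: "Y * norm (u - v) \<le> Y * (2 * R)" if "u \<in> X" "v \<in> X" for u v
      using norm_triangle_ineq4[of u v] subsetD[OF X_R that(1)] subsetD[OF X_R that(2)] Y_pos
      by (intro mult_left_mono) auto
    have "\<Phi> z u \<le> \<Phi> z v + Y * (2 * R)" if "u \<in> X" "v \<in> X" for u v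
    proof (rule smax_le)
      fix i show "D z i u \<le> D z i v + Y * (2 * R)" using D_lip[of z i u v] n[OF that] by linarith
    qed
    from this[OF x x0] this[OF x0 x] show ?thesis by linarith
  qed
  then show "AE x in P. norm (\<Phi> z x) \<le> \<bar>\<Phi> z x0\<bar> + Y * (2 * R)" using AE_X by (auto intro: AE_mp)
qed simp

text \<open>Coercivity comes from the lower bound on the masses: \<open>\<Phi>\<close> dominates the
  affine function of the smallest coordinate \<open>l\<close>, and after subtracting
  \<open>z $ l\<close> the linear term is a sum of nonnegative terms weighted by at least
  \<open>c\<close>.\<close>

lemma energy_arg_min_exists:
  assumes c: "0 < c" and q: "\<And>i. c \<le> q $ i" "(\<Sum>i\<in>UNIV. q $ i) = 1"
  shows "\<exists>z. is_arg_min (energy \<Phi> q) (\<lambda>z. z \<bullet> vec 1 = 0) z"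
proof (rule attains_min_orthogonal_ones[OF _ c])
  fix z z'
  have "\<bar>(LINT x|P. \<Phi> z x) - (LINT x|P. \<Phi> z' x)\<bar> = \<bar>LINT x|P. \<Phi> z x - \<Phi> z' x\<bar>"
    by (subst Bochner_Integration.integral_diff) (auto intro: smax_integrable)
  also have "\<dots> \<le> (LINT x|P. \<bar>\<Phi> z x - \<Phi> z' x\<bar>)" by (rule integral_abs_bound)
  also have "\<dots> \<le> norm (z - z')"
    using smax_lip by (intro P.integral_le_const integrable_abs Bochner_Integration.integrable_diff smax_integrable) auto
  finally have 1: "\<bar>(LINT x|P. \<Phi> z x) - (LINT x|P. \<Phi> z' x)\<bar> \<le> norm (z - z')" .
  have "\<bar>z \<bullet> q - z' \<bullet> q\<bar> \<le> norm (z - z') * norm q"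
    using Cauchy_Schwarz_ineq2[of "z - z'" q] by (simp add: inner_diff_left)
  then show "\<bar>energy \<Phi> q z - energy \<Phi> q z'\<bar> \<le> (1 + norm q) * norm (z - z')"
    using 1 unfolding energy_def by (simp add: algebra_simps)
next
  fix z :: "real^'n" and i j
  obtain l where l: "\<And>k. z $ l \<le> z $ k" using ex_argmin[of "\<lambda>k. z $ k"] by blast
  have "AE x in P. - (R * Y) - z $ l \<le> \<Phi> z x"
    using AE_X
  proof (rule AE_mp, intro AE_I2 impI)
    fix x assume "x \<in> X"
    then have "norm x \<le> R" using X_R by auto
    then have "norm x * norm (y l) \<le> R * Y" using y_Y[of l] R_pos by (intro mult_mono) auto
    then have "- (R * Y) \<le> x \<bullet> y l" using Cauchy_Schwarz_ineq2[of x "y l"] by linarith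
    then show "- (R * Y) - z $ l \<le> \<Phi> z x" using smax_ge[of z l x] by (simp add: D_def)
  qed
  then have "- (R * Y) - z $ l \<le> (LINT x|P. \<Phi> z x)"
    by (intro P.integral_ge_const smax_integrable)
  moreover have "c * (z $ i - z $ j) \<le> z \<bullet> q - z $ l"
  proof -
    have "c * (z $ i - z $ j) \<le> c * (z $ i - z $ l)" using l[of j] c by (intro mult_left_mono) auto
    also have "\<dots> \<le> q $ i * (z $ i - z $ l)" using l[of i] q by (intro mult_right_mono) auto
    also have "\<dots> \<le> (\<Sum>k\<in>UNIV. q $ k * (z $ k - z $ l))"
      using c q(1) l
      by (intro member_le_sum[of i UNIV "\<lambda>k. q $ k * (z $ k - z $ l)"] mult_nonneg_nonneg)
         (auto intro: order_trans[of 0 c] less_imp_le)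
    also have "\<dots> = z \<bullet> q - z $ l"
      using q(2) by (simp add: inner_vec_def right_diff_distrib sum_subtractf sum_distrib_right[symmetric] mult.commute)
    finally show ?thesis .
  qed
  ultimately show "c * (z $ i - z $ j) - R * Y \<le> energy \<Phi> q z" unfolding energy_def by linarith
qed

text \<open>Adding \<open>t\<close> to all coordinates lowers \<open>\<Phi>\<close> by
  \<open>t\<close> and raises the linear term by \<open>t\<close>. So the constraint is a mere
  normalisation, and perturbations off the hyperplane may be used as competitors.\<close>

lemma energy_shift:
  assumes "(\<Sum>i\<in>UNIV. q $ i) = 1"
  shows "energy \<Phi> q (z + t *\<^sub>R vec 1) = energy \<Phi> q z"
proof -
  have sh: "\<Phi> (z + t *\<^sub>R vec 1) x = \<Phi> z x - t" for x
  proof -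
    have "\<Phi> (z + t *\<^sub>R vec 1) x \<le> \<Phi> z x + - t" by (rule smax_le) (simp add: D_def)
    moreover have "\<Phi> z x \<le> \<Phi> (z + t *\<^sub>R vec 1) x + t" by (rule smax_le) (simp add: D_def)
    ultimately show ?thesis by linarith
  qed
  have "(LINT x|P. \<Phi> (z + t *\<^sub>R vec 1) x) = (LINT x|P. \<Phi> z x) - t"
    unfolding sh by (subst Bochner_Integration.integral_diff) (auto intro: smax_integrable simp: P.prob_space[simplified])
  moreover have "(t *\<^sub>R vec 1) \<bullet> q = t" using assms by (simp add: inner_vec_def sum_distrib_left[symmetric])
  ultimately show ?thesis by (simp add: energy_def inner_add_left)
qed

text \<open>\<open>sub\<close> is a subgradient inequality taken at the perturbed potential. With
  minimality it bounds the integral of \<open>s t\<close> by \<open>q $ i\<close> from above for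
  positive \<open>t\<close> and from below for negative \<open>t\<close>; the continuity assumption
  \<open>K\<close> closes the two bounds at \<open>t = 0\<close>.\<close>

lemma first_order:
  fixes s :: "real \<Rightarrow> 'a \<Rightarrow> real"
  assumes q: "(\<Sum>i\<in>UNIV. q $ i) = 1" and min: "is_arg_min (energy \<Phi> q) (\<lambda>z. z \<bullet> vec 1 = 0) z"
    and s: "\<And>t. s t \<in> borel_measurable borel" "\<And>t x. \<bar>s t x\<bar> \<le> 1"
    and sub: "\<And>t x. x \<in> X \<Longrightarrow> \<Phi> (z + axis i t) x - \<Phi> z x \<le> - t * s t x"
    and K: "\<And>t. \<bar>t\<bar> \<le> 1 \<Longrightarrow> \<bar>(LINT x|P. s t x) - (LINT x|P. s 0 x)\<bar> \<le> K * \<bar>t\<bar>"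
  shows "(LINT x|P. s 0 x) = q $ i"
proof -
  have ints: "integrable P (s t)" for t by (rule integrable_bounded[OF s])
  have ge: "t * (LINT x|P. s t x) \<le> t * q $ i" for t
  proof -
    define w where "w = z + axis i t"
    \<comment> \<open>The shift that returns the perturbed potential to the constraint
      hyperplane.\<close>
    define u where "u = - (w \<bullet> vec 1) / CARD('n)"
    have "(w + u *\<^sub>R vec 1) \<bullet> vec 1 = 0"
      by (simp add: inner_add_left u_def inner_vec_def sum_subtractf)
    then have "energy \<Phi> q z \<le> energy \<Phi> q (w + u *\<^sub>R vec 1)" using min by (auto simp: is_arg_min_def not_less)
    also have "\<dots> = energy \<Phi> q w" by (rule energy_shift[OF q])
    finally have "0 \<le> (LINT x|P. \<Phi> w x) - (LINT x|P. \<Phi> z x) + (w - z) \<bullet> q" by (simp add: energy_def inner_diff_left)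
    also have "(w - z) \<bullet> q = t * q $ i" by (simp add: w_def inner_axis')
    also have "(LINT x|P. \<Phi> w x) - (LINT x|P. \<Phi> z x) = (LINT x|P. \<Phi> w x - \<Phi> z x)"
      by (rule Bochner_Integration.integral_diff[symmetric]) (rule smax_integrable)+
    also have "\<dots> \<le> (LINT x|P. - t * s t x)"
    proof (rule integral_mono_AE)
      show "AE x in P. \<Phi> w x - \<Phi> z x \<le> - t * s t x"
        using AE_X by (rule AE_mp) (intro AE_I2 impI, unfold w_def, rule sub)
    qed (intro Bochner_Integration.integrable_diff smax_integrable integrable_mult_right ints)+
    also have "\<dots> = - t * (LINT x|P. s t x)" by simp
    finally show ?thesis by simp
  qed
  have K0: "0 \<le> K" using K[of 1] by simp
  have up: "(LINT x|P. s 0 x) \<le> q $ i + K * t" if "0 < t" "t \<le> 1" for t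
    using ge[of t] K[of t] that by simp
  have lo: "q $ i - K * t \<le> (LINT x|P. s 0 x)" if "0 < t" "t \<le> 1" for t
    using ge[of "- t"] K[of "- t"] that by simp
  have "\<bar>(LINT x|P. s 0 x) - q $ i\<bar> \<le> 0 + e" if "0 < e" for e
  proof -
    define t where "t = min 1 (e / (K + 1))"
    have t: "0 < t" "t \<le> 1" using that K0 by (auto simp: t_def)
    have "K * t \<le> (K + 1) * t" using t by (intro mult_right_mono) auto
    also have "\<dots> \<le> (K + 1) * (e / (K + 1))" using K0 by (intro mult_left_mono) (auto simp: t_def)
    also have "\<dots> = e" using K0 by simp
    finally show ?thesis using up[OF t] lo[OF t] by linarith
  qed
  then show ?thesis using field_le_epsilon[of "\<bar>(LINT x|P. s 0 x) - q $ i\<bar>" 0] by auto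
qed

end

section \<open>First-order conditions for the two semiduals\<close>

lemma D_axis: "D (z + axis i t) j x = D z j x - (if j = i then t else 0)"
  by (simp add: D_def axis_def)

text \<open>A point can change membership in cell \<open>i\<close> only if some gap changes sign,
  and then that gap is no larger than the change of the corresponding potential difference.\<close>

lemma cell_indicator_diff:
  assumes x: "x \<in> X"
  shows "\<bar>indicator (cell z i) x - indicator (cell z' i) x\<bar>
    \<le> (\<Sum>j\<in>-{i}. indicator {x. \<bar>gap z i j x\<bar> \<le> \<bar>(z' $ i - z $ i) - (z' $ j - z $ j)\<bar>} x :: real)"
    (is "_ \<le> ?r")
proof (cases "x \<in> cell z i \<longleftrightarrow> x \<in> cell z' i")
  case True then show ?thesis by (auto simp: indicator_def intro!: sum_nonneg)
next
  case False
  have D': "gap z' i j x = (gap z i j x) - ((z' $ i - z $ i) - (z' $ j - z $ j))" for j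
    by (simp add: D_def)
  have "\<exists>j. j \<noteq> i \<and> \<bar>gap z i j x\<bar> \<le> \<bar>(z' $ i - z $ i) - (z' $ j - z $ j)\<bar>"
  proof (cases "x \<in> cell z i")
    case True
    then obtain j where "\<not> D z' j x \<le> D z' i x" using False x by (auto simp: cell_eq)
    moreover have "D z j x \<le> D z i x" using True by (simp add: cell_eq)
    ultimately show ?thesis using D'[of j] by (intro exI[of _ j]) auto
  next
    case n: False
    then obtain j where "\<not> D z j x \<le> D z i x" using x by (auto simp: cell_eq)
    moreover have "D z' j x \<le> D z' i x" using False n by (simp add: cell_eq)
    ultimately show ?thesis using D'[of j] by (intro exI[of _ j]) auto
  qed
  then obtain j where j: "j \<noteq> i" "\<bar>gap z i j x\<bar> \<le> \<bar>(z' $ i - z $ i) - (z' $ j - z $ j)\<bar>" by blast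
  have "\<bar>indicator (cell z i) x - indicator (cell z' i) x\<bar> \<le> (1::real)"
    by (auto simp: indicator_def)
  also have "1 = (indicator {x. \<bar>gap z i j x\<bar> \<le> \<bar>(z' $ i - z $ i) - (z' $ j - z $ j)\<bar>} x :: real)" using j by simp
  also have "\<dots> \<le> ?r"
    using j(1) by (intro member_le_sum[of j "-{i}" "\<lambda>j. indicator {x. \<bar>gap z i j x\<bar> \<le> \<bar>(z' $ i - z $ i) - (z' $ j - z $ j)\<bar>} x :: real"]) auto
  finally show ?thesis .
qed

lemma cell_difference_bound:
  "\<exists>C\<ge>0. \<forall>z z' i s. 0 \<le> s \<longrightarrow> (\<forall>j. \<bar>(z' $ i - z $ i) - (z' $ j - z $ j)\<bar> \<le> s) \<longrightarrow>
    (LINT x|P. \<bar>indicator (cell z i) x - indicator (cell z' i) x :: real\<bar>) \<le> C * s"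
proof -
  obtain C where C: "C \<ge> 0" "\<And>z i j s. i \<noteq> j \<Longrightarrow> 0 \<le> s \<Longrightarrow> measure P {x. \<bar>gap z i j x\<bar> \<le> s} \<le> C * s"
    using slab_P by blast
  show ?thesis
  proof (intro exI[of _ "CARD('n) * C"] conjI allI impI)
    fix z z' :: "real^'n" and i s assume s: "0 \<le> s" "\<forall>j. \<bar>(z' $ i - z $ i) - (z' $ j - z $ j)\<bar> \<le> s"
    let ?S = "\<lambda>j. {x. \<bar>gap z i j x\<bar> \<le> s}"
    have "(LINT x|P. \<bar>indicator (cell z i) x - indicator (cell z' i) x :: real\<bar>)
      \<le> (LINT x|P. (\<Sum>j\<in>-{i}. indicator (?S j) x))"
    proof (rule integral_mono_AE)
      show "AE x in P. \<bar>indicator (cell z i) x - indicator (cell z' i) x\<bar> \<le> (\<Sum>j\<in>-{i}. indicator (?S j) x :: real)"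
        using AE_X
      proof (rule AE_mp, intro AE_I2 impI)
        fix x assume "x \<in> X"
        note cell_indicator_diff[OF this, of z i z']
        also have "(\<Sum>j\<in>-{i}. indicator {x. \<bar>gap z i j x\<bar> \<le> \<bar>(z' $ i - z $ i) - (z' $ j - z $ j)\<bar>} x :: real) \<le> (\<Sum>j\<in>-{i}. indicator (?S j) x)"
          using s(2) by (intro sum_mono) (auto simp: indicator_def intro: order_trans)
        finally show "\<bar>indicator (cell z i) x - indicator (cell z' i) x\<bar> \<le> (\<Sum>j\<in>-{i}. indicator (?S j) x :: real)" .
      qed
    qed (intro integrable_abs Bochner_Integration.integrable_diff Bochner_Integration.integrable_sum integrable_indicator_P, measurable)+
    also have "\<dots> = (\<Sum>j\<in>-{i}. measure P (?S j))"
      by (subst Bochner_Integration.integral_sum) (auto intro: integrable_indicator_P)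
    also have "\<dots> \<le> (\<Sum>j\<in>-{i}. C * s)" using s by (intro sum_mono C) auto
    also have "\<dots> \<le> (\<Sum>j\<in>(UNIV::'n set). C * s)" using C(1) s(1) by (intro sum_mono2) auto
    finally show "(LINT x|P. \<bar>indicator (cell z i) x - indicator (cell z' i) x :: real\<bar>) \<le> CARD('n) * C * s"
      by simp
  qed (use C in simp)
qed

text \<open>The subgradient is minus the indicator of the perturbed cell; its integral is Lipschitz
  in the perturbation by the slab bound.\<close>

lemma brenier_first_order:
  assumes q: "(\<Sum>i\<in>UNIV. q $ i) = 1" and min: "is_arg_min (energy (mx UNIV) q) (\<lambda>z. z \<bullet> vec 1 = 0) z"
  shows "measure P (cell z i) = q $ i"
proof -
  obtain C where C: "C \<ge> 0" "\<And>z z' i s. 0 \<le> s \<Longrightarrow> (\<forall>j. \<bar>(z' $ i - z $ i) - (z' $ j - z $ j)\<bar> \<le> s) \<Longrightarrow>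
    (LINT x|P. \<bar>indicator (cell z i) x - indicator (cell z' i) x :: real\<bar>) \<le> C * s"
    using cell_difference_bound by blast
  let ?s = "\<lambda>t x. indicator (cell (z + axis i t) i) x :: real"
  have int: "integrable P (?s t)" for t by (rule integrable_indicator_P) measurable
  have "(LINT x|P. ?s 0 x) = q $ i"
  proof (rule first_order[OF smax_like_mx q min, of ?s i])
    fix t x assume x: "x \<in> X"
    let ?z = "z + axis i t"
    show "mx UNIV ?z x - mx UNIV z x \<le> - t * ?s t x"
    proof (cases "x \<in> cell ?z i")
      case True
      obtain a where "mx UNIV ?z x = D ?z a x" using mx_attained[of UNIV ?z x] by auto
      then have "mx UNIV ?z x \<le> D ?z i x" using True by (auto simp: cell_eq)
      also have "\<dots> = D z i x - t" by (simp add: D_axis)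
      also have "\<dots> \<le> mx UNIV z x - t" using mx_ge[of i UNIV z x] by simp
      finally show ?thesis using True by simp
    next
      case False
      obtain a where a: "mx UNIV ?z x = D ?z a x" using mx_attained[of UNIV ?z x] by auto
      then have "a \<noteq> i" using False x mx_ge[of _ UNIV ?z x] by (auto simp: cell_eq)
      then show ?thesis using a mx_ge[of a UNIV z x] False by (simp add: D_axis)
    qed
  next
    fix t :: real
    have "\<bar>(LINT x|P. ?s t x) - (LINT x|P. ?s 0 x)\<bar> = \<bar>LINT x|P. ?s t x - ?s 0 x\<bar>"
      by (subst Bochner_Integration.integral_diff[OF int int]) simp
    also have "\<dots> \<le> (LINT x|P. \<bar>?s t x - ?s 0 x\<bar>)" by (rule integral_abs_bound)
    also have "\<dots> \<le> C * \<bar>t\<bar>"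
      by (rule C(2)) (auto simp: axis_def)
    finally show "\<bar>(LINT x|P. ?s t x) - (LINT x|P. ?s 0 x)\<bar> \<le> C * \<bar>t\<bar>" .
  qed (auto simp: indicator_def)
  moreover have "axis i (0::real) = 0" by (simp add: vec_eq_iff axis_def)
  ultimately show ?thesis by simp
qed

text \<open>Only the exponential of index \<open>i\<close> changes, by the factor
  \<open>exp (- t / \<epsilon>)\<close>.\<close>

lemma soft_axis:
  assumes \<epsilon>: "0 < \<epsilon>"
  shows "soft \<epsilon> (z + axis i t) i x = soft \<epsilon> z i x * exp (- t / \<epsilon>) / (1 - soft \<epsilon> z i x + soft \<epsilon> z i x * exp (- t / \<epsilon>))"
    and "(\<Sum>j\<in>UNIV. exp (D (z + axis i t) j x / \<epsilon>)) = (\<Sum>j\<in>UNIV. exp (D z j x / \<epsilon>)) * (1 - soft \<epsilon> z i x + soft \<epsilon> z i x * exp (- t / \<epsilon>))"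
proof -
  let ?w = "exp (D z i x / \<epsilon>)" and ?S = "\<Sum>j\<in>UNIV. exp (D z j x / \<epsilon>)"
  have S: "0 < ?S" by (rule sum_exp_pos)
  have wi: "exp (D (z + axis i t) i x / \<epsilon>) = ?w * exp (- t / \<epsilon>)"
    by (simp add: D_axis mult_exp_exp diff_divide_distrib)
  have "(\<Sum>j\<in>UNIV. exp (D (z + axis i t) j x / \<epsilon>)) = exp (D (z + axis i t) i x / \<epsilon>) + (\<Sum>j\<in>UNIV-{i}. exp (D (z + axis i t) j x / \<epsilon>))"
    by (simp add: sum.remove[of UNIV i])
  also have "(\<Sum>j\<in>UNIV-{i}. exp (D (z + axis i t) j x / \<epsilon>)) = (\<Sum>j\<in>UNIV-{i}. exp (D z j x / \<epsilon>))"
    by (intro sum.cong) (auto simp: D_axis)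
  also have "\<dots> = ?S - ?w" by (simp add: sum.remove[of UNIV i])
  finally have sum: "(\<Sum>j\<in>UNIV. exp (D (z + axis i t) j x / \<epsilon>)) = ?w * exp (- t / \<epsilon>) + (?S - ?w)" by (simp only: wi)
  have sw: "?w = soft \<epsilon> z i x * ?S" using S by (simp add: soft_def)
  show 2: "(\<Sum>j\<in>UNIV. exp (D (z + axis i t) j x / \<epsilon>)) = ?S * (1 - soft \<epsilon> z i x + soft \<epsilon> z i x * exp (- t / \<epsilon>))"
    unfolding sum sw by (simp add: algebra_simps)
  show "soft \<epsilon> (z + axis i t) i x = soft \<epsilon> z i x * exp (- t / \<epsilon>) / (1 - soft \<epsilon> z i x + soft \<epsilon> z i x * exp (- t / \<epsilon>))"
  proof -
    have cancel: "a * S * u / (S * d) = a * u / d" if "S \<noteq> 0" for a S u d :: real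
      using that by (simp add: field_simps)
    show ?thesis
      unfolding soft_def[of \<epsilon> "z + axis i t"] 2 wi sw by (rule cancel) (use S in simp)
  qed
qed

lemma soft_axis_diff:
  assumes \<epsilon>: "0 < \<epsilon>"
  shows "\<bar>soft \<epsilon> (z + axis i t) i x - soft \<epsilon> z i x\<bar> \<le> exp (\<bar>t\<bar> / \<epsilon>) - 1"
proof -
  define p where "p = soft \<epsilon> z i x"
  define u where "u = exp (- t / \<epsilon>)"
  have p: "0 < p" "p \<le> 1" using soft_pos soft_le_1 by (auto simp: p_def)
  have u: "0 < u" by (simp add: u_def)
  have den: "0 < 1 - p + p * u" using p u by (intro add_nonneg_pos) auto
  have "soft \<epsilon> (z + axis i t) i x - p = p * (1 - p) * (u - 1) / (1 - p + p * u)"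
    unfolding soft_axis(1)[OF \<epsilon>] p_def[symmetric] u_def[symmetric] using den by (simp add: field_simps)
  then have "\<bar>soft \<epsilon> (z + axis i t) i x - p\<bar> = p * (1 - p) * \<bar>u - 1\<bar> / (1 - p + p * u)"
    using p den by (simp add: abs_mult)
  also have "\<dots> \<le> exp (\<bar>t\<bar> / \<epsilon>) - 1"
  proof -
    have e: "1 \<le> exp (\<bar>t\<bar> / \<epsilon>)" using \<epsilon> by simp
    have "p * (1 - p) * \<bar>u - 1\<bar> \<le> (exp (\<bar>t\<bar> / \<epsilon>) - 1) * (1 - p + p * u)"
    proof (cases "0 \<le> t")
      case True
      then have eu: "exp (\<bar>t\<bar> / \<epsilon>) = 1 / u" by (simp add: u_def exp_minus divide_inverse)
      have u1: "u \<le> 1" using True \<epsilon> by (simp add: u_def)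
      have "p * (1 - p) \<le> 1 - p + p * u" using p u mult_right_mono[of p 1 "1 - p"] by (simp add: add_increasing2)
      then have "p * (1 - p) * (1 - u) \<le> (1 - p + p * u) * (1 - u)" using u1 by (intro mult_right_mono) auto
      also have "\<dots> \<le> (1 - p + p * u) * ((1 - u) / u)"
        using u u1 den by (intro mult_left_mono) (auto simp: le_divide_eq mult_left_le)
      also have "(1 - u) / u = exp (\<bar>t\<bar> / \<epsilon>) - 1" using u by (simp add: eu diff_divide_distrib)
      finally show ?thesis using u1 by (simp add: mult.commute)
    next
      case False
      then have eu: "exp (\<bar>t\<bar> / \<epsilon>) = u" by (simp add: u_def)
      have "p * (1 - p) \<le> 1 * (1 - p)" using p by (intro mult_right_mono) auto
      also have "\<dots> \<le> 1 - p + p * u" using p u by simp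
      finally have "p * (1 - p) * (u - 1) \<le> (1 - p + p * u) * (u - 1)" using e eu by (intro mult_right_mono) auto
      then show ?thesis using e eu by (simp add: mult.commute)
    qed
    then show ?thesis using den by (simp add: pos_divide_le_eq)
  qed
  finally show ?thesis by (simp add: p_def)
qed

lemma entropic_first_order:
  assumes \<epsilon>: "0 < \<epsilon>" and q: "(\<Sum>i\<in>UNIV. q $ i) = 1" and min: "is_arg_min (energy (lse \<epsilon>) q) (\<lambda>z. z \<bullet> vec 1 = 0) z"
  shows "(LINT x|P. soft \<epsilon> z i x) = q $ i"
proof -
  let ?s = "\<lambda>t x. soft \<epsilon> (z + axis i t) i x"
  have s1: "\<bar>?s t x\<bar> \<le> 1" for t x using soft_pos[of \<epsilon> "z + axis i t" i x] soft_le_1[of \<epsilon> "z + axis i t" i x] by simp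
  note int = integrable_soft
  have ax0: "axis i (0::real) = 0" by (simp add: vec_eq_iff axis_def)
  have "(LINT x|P. ?s 0 x) = q $ i"
  proof (rule first_order[OF smax_like_lse[OF \<epsilon>] q min, of ?s i])
    fix t x
    define z' where "z' = z + axis i t"
    define p where "p = soft \<epsilon> z' i x"
    let ?S = "\<lambda>z. \<Sum>j\<in>UNIV. exp (D z j x / \<epsilon>)"
    have p: "0 < p" "p \<le> 1" using soft_pos soft_le_1 by (auto simp: p_def)
    \<comment> \<open>The inequality is needed with the weight \<open>p\<close> at the perturbed
      potential, so \<open>z\<close> is regarded as a perturbation of \<open>z'\<close> by
      \<open>- t\<close>.\<close>
    have z: "z = z' + axis i (- t)" by (simp add: z'_def vec_eq_iff axis_def)
    have Sz: "?S z = ?S z' * (1 - p + p * exp (t / \<epsilon>))"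
      using soft_axis(2)[OF \<epsilon>, of z' i "- t" x] unfolding z[symmetric] p_def by simp
    \<comment> \<open>Convexity of the exponential between 0 and \<open>t / \<epsilon>\<close>;
      after taking logarithms this is the subgradient inequality for log-sum-exp.\<close>
    have "exp (p * (t / \<epsilon>)) \<le> 1 - p + p * exp (t / \<epsilon>)"
      using convex_onD[OF exp_convex, of p 0 "t / \<epsilon>"] p by simp
    then have "p * (t / \<epsilon>) \<le> ln (1 - p + p * exp (t / \<epsilon>))"
      using p by (subst ln_ge_iff) (auto intro!: add_nonneg_pos)
    moreover have "ln (?S z) = ln (?S z') + ln (1 - p + p * exp (t / \<epsilon>))"
      unfolding Sz using sum_exp_pos[of "\<lambda>j. D z' j x / \<epsilon>"] p by (intro ln_mult_pos) (auto intro!: add_nonneg_pos)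
    ultimately have "ln (?S z') + p * (t / \<epsilon>) \<le> ln (?S z)" by simp
    then have "\<epsilon> * (ln (?S z') + p * (t / \<epsilon>)) \<le> \<epsilon> * ln (?S z)" using \<epsilon> by (intro mult_left_mono) auto
    then have "lse \<epsilon> z' x - lse \<epsilon> z x \<le> - t * p" using \<epsilon> by (simp add: lse_def distrib_left mult.commute)
    then show "lse \<epsilon> (z + axis i t) x - lse \<epsilon> z x \<le> - t * ?s t x" by (simp add: z'_def p_def)
  next
    fix t :: real assume t: "\<bar>t\<bar> \<le> 1"
    have "\<bar>(LINT x|P. ?s t x) - (LINT x|P. ?s 0 x)\<bar> = \<bar>LINT x|P. ?s t x - ?s 0 x\<bar>"
      by (subst Bochner_Integration.integral_diff[OF int int]) simp
    also have "\<dots> \<le> (LINT x|P. \<bar>?s t x - ?s 0 x\<bar>)" by (rule integral_abs_bound)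
    also have "\<dots> \<le> exp (\<bar>t\<bar> / \<epsilon>) - 1"
      using soft_axis_diff[OF \<epsilon>, of z i t]
      by (intro P.integral_le_const integrable_abs Bochner_Integration.integrable_diff int) (simp add: ax0)
    also have "\<dots> \<le> \<bar>t\<bar> / \<epsilon> * exp (\<bar>t\<bar> / \<epsilon>)"
    proof -
      have "1 - \<bar>t\<bar> / \<epsilon> \<le> exp (- (\<bar>t\<bar> / \<epsilon>))" using exp_ge_add_one_self[of "- (\<bar>t\<bar> / \<epsilon>)"] by simp
      then have "(1 - \<bar>t\<bar> / \<epsilon>) * exp (\<bar>t\<bar> / \<epsilon>) \<le> exp (- (\<bar>t\<bar> / \<epsilon>)) * exp (\<bar>t\<bar> / \<epsilon>)" by (intro mult_right_mono) auto
      then show ?thesis by (simp add: mult_exp_exp left_diff_distrib)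
    qed
    \<comment> \<open>This constant explodes as \<open>\<epsilon>\<close> tends to 0, which is
      harmless: it only serves the limit in \<open>t\<close> at fixed
      \<open>\<epsilon>\<close>.\<close>
    also have "\<dots> \<le> \<bar>t\<bar> / \<epsilon> * exp (1 / \<epsilon>)"
      using t \<epsilon> by (intro mult_left_mono) (auto intro: divide_right_mono)
    finally show "\<bar>(LINT x|P. ?s t x) - (LINT x|P. ?s 0 x)\<bar> \<le> exp (1 / \<epsilon>) / \<epsilon> * \<bar>t\<bar>" by (simp add: mult.commute)
  qed (auto intro: s1)
  then show ?thesis by (simp add: ax0)
qed

text \<open>The coordinate where \<open>z' - z\<close> is smallest has a strictly larger weight at \<open>z'\<close>.\<close>

lemma entropic_unique:
  assumes \<epsilon>: "0 < \<epsilon>" and eq: "\<And>i. (LINT x|P. soft \<epsilon> z i x) = (LINT x|P. soft \<epsilon> z' i x)"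
    and orth: "z \<bullet> vec 1 = 0" "z' \<bullet> vec 1 = 0"
  shows "z = z'"
proof -
  define v where "v i = z' $ i - z $ i" for i
  obtain k where k: "\<And>l. v k \<le> v l" using ex_argmin[of v] by blast
  have Dv: "D z' l x = D z l x - v l" for l x by (simp add: D_def v_def)
  have const: "v l = v k" for l
  proof (rule ccontr)
    assume "v l \<noteq> v k"
    then have l: "v k < v l" using k[of l] by simp
    have "soft \<epsilon> z k x < soft \<epsilon> z' k x" for x
    proof -
      \<comment> \<open>Multiplying numerator and denominator by \<open>c\<close> makes the
        numerator at \<open>z'\<close> equal to that at \<open>z\<close>; in the denominator no term
        grows and the term of \<open>l\<close> strictly decreases.\<close>
      define c where "c = exp (v k / \<epsilon>)"
      have e: "exp (D z' j x / \<epsilon>) * c = exp ((D z j x - (v j - v k)) / \<epsilon>)" for j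
        by (simp add: c_def Dv mult_exp_exp add_divide_distrib[symmetric])
      have c: "0 < c" by (simp add: c_def)
      have "soft \<epsilon> z' k x = (exp (D z' k x / \<epsilon>) * c) / ((\<Sum>j\<in>UNIV. exp (D z' j x / \<epsilon>)) * c)"
        using c by (simp add: soft_def)
      also have "\<dots> = exp (D z k x / \<epsilon>) / (\<Sum>j\<in>UNIV. exp ((D z j x - (v j - v k)) / \<epsilon>))"
        by (simp add: e sum_distrib_right)
      finally have s': "soft \<epsilon> z' k x = exp (D z k x / \<epsilon>) / (\<Sum>j\<in>UNIV. exp ((D z j x - (v j - v k)) / \<epsilon>))" .
      have "(\<Sum>j\<in>UNIV. exp ((D z j x - (v j - v k)) / \<epsilon>)) < (\<Sum>j\<in>UNIV. exp (D z j x / \<epsilon>))"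
      proof (rule sum_strict_mono_ex1)
        show "\<forall>j\<in>UNIV. exp ((D z j x - (v j - v k)) / \<epsilon>) \<le> exp (D z j x / \<epsilon>)"
          using k \<epsilon> by (auto intro: divide_right_mono)
        show "\<exists>j\<in>UNIV. exp ((D z j x - (v j - v k)) / \<epsilon>) < exp (D z j x / \<epsilon>)"
          using l \<epsilon> by (intro bexI[of _ l]) (auto intro: divide_strict_right_mono)
      qed simp
      then show ?thesis unfolding s' unfolding soft_def
        by (intro divide_strict_left_mono mult_pos_pos sum_exp_pos) auto
    qed
    then have "(LINT x|P. soft \<epsilon> z k x) < (LINT x|P. soft \<epsilon> z' k x)"
      by (intro P.integral_less_AE_space integrable_soft) (auto simp: P.emeasure_space_1[unfolded space_P])
    then show False using eq[of k] by simp
  qed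
  have "(\<Sum>i\<in>UNIV. v i) = 0" using orth by (simp add: v_def inner_vec_def sum_subtractf)
  moreover have "(\<Sum>i\<in>UNIV. v i) = (\<Sum>i\<in>(UNIV::'n set). v k)" by (rule sum.cong) (auto intro: const)
  ultimately have "v k = 0" by simp
  then have "v i = 0" for i using const[of i] by simp
  then show ?thesis by (simp add: v_def vec_eq_iff)
qed

end

section \<open>Comparison of the two maps\<close>

context semidiscrete begin

text \<open>Outside cell \<open>i\<close> the soft weight is at most
  \<open>exp (- \<eta> / \<epsilon>)\<close>, except in slabs of half-width \<open>\<eta>\<close>.
  So the cell loses at most half of the prescribed soft mass \<open>c\<close>: a quarter to the
  slabs and a quarter to the tail.\<close>

lemma entropic_good:
  assumes c: "0 < c"
  shows "\<exists>\<epsilon>0>0. \<forall>\<epsilon> z. 0 < \<epsilon> \<longrightarrow> \<epsilon> \<le> \<epsilon>0 \<longrightarrow> (\<forall>i. c \<le> (LINT x|P. soft \<epsilon> z i x)) \<longrightarrow> good (c / 2) z"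
proof -
  obtain C where C: "C \<ge> 0" "\<And>z i j s. i \<noteq> j \<Longrightarrow> 0 \<le> s \<Longrightarrow> measure P {x. \<bar>gap z i j x\<bar> \<le> s} \<le> C * s"
    using slab_P by blast
  define N where "N = real CARD('n)"
  \<comment> \<open>At most \<open>N\<close> slabs of mass \<open>C * \<eta>\<close> each then weigh
    at most \<open>c / 4\<close>; the 1 guards against \<open>C = 0\<close>.\<close>
  define \<eta> where "\<eta> = c / (4 * (N * C + 1))"
  have N: "0 \<le> N * C" using C by (simp add: N_def)
  have \<eta>: "0 < \<eta>" using c N by (simp add: \<eta>_def)
  have "N * C * \<eta> \<le> (N * C + 1) * \<eta>" using \<eta> by (intro mult_right_mono) auto
  also have "\<dots> = c / 4" using N by (simp add: \<eta>_def field_simps)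
  finally have NC: "N * C * \<eta> \<le> c / 4" .
  show ?thesis
  \<comment> \<open>The threshold for \<open>\<epsilon>\<close> comes from
    \<open>exp (- \<eta> / \<epsilon>) \<le> \<epsilon> / \<eta>\<close>, which has to be at most
    \<open>c / 4\<close>.\<close>
  proof (intro exI[of _ "\<eta> * c / 4"] conjI allI impI)
    show "0 < \<eta> * c / 4" using \<eta> c by simp
  next
    fix \<epsilon> :: real and z :: "real^'n" assume \<epsilon>: "0 < \<epsilon>" "\<epsilon> \<le> \<eta> * c / 4" and q: "\<forall>i. c \<le> (LINT x|P. soft \<epsilon> z i x)"
    have e: "exp (- \<eta> / \<epsilon>) \<le> c / 4"
    proof -
      have "\<eta> / \<epsilon> \<le> exp (\<eta> / \<epsilon>)" using exp_ge_add_one_self[of "\<eta> / \<epsilon>"] by linarith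
      then have "exp (- (\<eta> / \<epsilon>)) \<le> 1 / (\<eta> / \<epsilon>)" using \<eta> \<epsilon>
        unfolding exp_minus inverse_eq_divide by (intro divide_left_mono mult_pos_pos) auto
      also have "\<dots> \<le> c / 4" using \<epsilon> \<eta> by (simp add: field_simps)
      finally show ?thesis by simp
    qed
    show "good (c / 2) z" unfolding good_def
    proof
      fix i
      let ?I = "indicator (cell z i) :: 'a \<Rightarrow> real"
      let ?S = "\<lambda>j. {x. \<bar>gap z i j x\<bar> \<le> \<eta>}"
      note int = integrable_indicator_P and ints = integrable_soft
      have intsum: "integrable P (\<lambda>x. \<Sum>j\<in>-{i}. indicator (?S j) x :: real)"
        by (intro Bochner_Integration.integrable_sum int) measurable
      have "(LINT x|P. soft \<epsilon> z i x) \<le> (LINT x|P. ?I x + (exp (- \<eta> / \<epsilon>) + (\<Sum>j\<in>-{i}. indicator (?S j) x)))"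
      proof (rule integral_mono_AE)
        show "AE x in P. soft \<epsilon> z i x \<le> ?I x + (exp (- \<eta> / \<epsilon>) + (\<Sum>j\<in>-{i}. indicator (?S j) x))"
          using AE_X
        proof (rule AE_mp, intro AE_I2 impI)
          fix x assume x: "x \<in> X"
          have s0: "0 \<le> (\<Sum>j\<in>-{i}. indicator (?S j) x :: real)" by (intro sum_nonneg) auto
          have e0: "0 \<le> exp (- \<eta> / \<epsilon>)" by simp
          show "soft \<epsilon> z i x \<le> ?I x + (exp (- \<eta> / \<epsilon>) + (\<Sum>j\<in>-{i}. indicator (?S j) x))"
          proof (cases "x \<in> cell z i")
            case True
            then have "?I x = 1" by simp
            then show ?thesis using soft_le_1[of \<epsilon> z i x] s0 e0 by linarith
          next
            case False
            then obtain j where j: "D z i x < D z j x" using x by (auto simp: cell_eq not_le)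
            then have ji: "j \<in> -{i}" by auto
            have I0: "?I x = 0" using False by simp
            show ?thesis
            proof (cases "gap z j i x \<le> \<eta>")
              case True
              then have "1 = (indicator (?S j) x :: real)" using j by simp
              also have "\<dots> \<le> (\<Sum>j\<in>-{i}. indicator (?S j) x)"
                using ji by (intro member_le_sum[of j "-{i}" "\<lambda>j. indicator (?S j) x :: real"]) auto
              finally show ?thesis using soft_le_1[of \<epsilon> z i x] e0 I0 by linarith
            next
              case far: False
              have "exp (D z j x / \<epsilon>) \<le> (\<Sum>k\<in>UNIV. exp (D z k x / \<epsilon>))"
                by (rule member_le_sum[of j UNIV "\<lambda>k. exp (D z k x / \<epsilon>)"]) auto
              then have "soft \<epsilon> z i x \<le> exp (D z i x / \<epsilon>) / exp (D z j x / \<epsilon>)"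
                unfolding soft_def using sum_exp_pos by (intro divide_left_mono mult_pos_pos) auto
              also have "\<dots> = exp (gap z i j x / \<epsilon>)" by (simp add: exp_diff diff_divide_distrib)
              also have "\<dots> \<le> exp (- \<eta> / \<epsilon>)"
                using far \<epsilon> by (subst exp_le_cancel_iff) (intro divide_right_mono, auto)
              finally show ?thesis using s0 I0 by linarith
            qed
          qed
        qed
      qed (use ints in \<open>auto intro!: Bochner_Integration.integrable_add int intsum\<close>)
      also have "\<dots> = measure P (cell z i) + (exp (- \<eta> / \<epsilon>) + (\<Sum>j\<in>-{i}. measure P (?S j)))"
      proof -
        have "(LINT x|P. ?I x + (exp (- \<eta> / \<epsilon>) + (\<Sum>j\<in>-{i}. indicator (?S j) x)))
          = (LINT x|P. ?I x) + (LINT x|P. exp (- \<eta> / \<epsilon>) + (\<Sum>j\<in>-{i}. indicator (?S j) x))"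
          by (intro Bochner_Integration.integral_add Bochner_Integration.integrable_add int intsum) auto
        also have "(LINT x|P. exp (- \<eta> / \<epsilon>) + (\<Sum>j\<in>-{i}. indicator (?S j) x))
          = (LINT x|P. exp (- \<eta> / \<epsilon>)) + (LINT x|P. (\<Sum>j\<in>-{i}. indicator (?S j) x))"
          by (intro Bochner_Integration.integral_add intsum) auto
        also have "(LINT x|P. (\<Sum>j\<in>-{i}. indicator (?S j) x)) = (\<Sum>j\<in>-{i}. measure P (?S j))"
          by (subst Bochner_Integration.integral_sum) (auto intro: int)
        finally show ?thesis by (simp add: P.prob_space[simplified])
      qed
      also have "(\<Sum>j\<in>-{i}. measure P (?S j)) \<le> (\<Sum>j\<in>-{i}. C * \<eta>)" using \<eta> by (intro sum_mono C) auto
      also have "(\<Sum>j\<in>-{i}. C * \<eta>) \<le> (\<Sum>j\<in>(UNIV::'n set). C * \<eta>)" using C(1) \<eta> by (intro sum_mono2) auto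
      also have "(\<Sum>j\<in>(UNIV::'n set). C * \<eta>) = N * C * \<eta>" by (simp add: N_def)
      finally show "c / 2 \<le> measure P (cell z i)"
        using q[rule_format, of i] e NC by linarith
    qed
  qed
qed

text \<open>Here \<open>z\<close> is to be the entropic and \<open>z'\<close> the Brenier potential;
  they are linked only by the equality of soft masses and cell masses. The cells of \<open>z\<close>
  serve as intermediary.\<close>

lemma soft_brenier_bound:
  assumes c: "0 < c" and \<alpha>: "0 < \<alpha>" "\<alpha> \<le> 1"
  shows "\<exists>C\<ge>0. \<exists>\<epsilon>0>0. \<forall>z z' i \<epsilon> \<psi> B H. 0 < \<epsilon> \<longrightarrow> \<epsilon> \<le> \<epsilon>0 \<longrightarrow> \<epsilon> < 1 \<longrightarrow>
     (\<forall>l. c \<le> measure P (cell z' l) \<and> measure P (cell z' l) = (LINT x|P. soft \<epsilon> z l x)) \<longrightarrow>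
     \<psi> \<in> borel_measurable borel \<longrightarrow> (\<forall>x. \<bar>\<psi> x\<bar> \<le> B) \<longrightarrow> 0 \<le> H \<longrightarrow>
     hoelder_le \<alpha> H X \<psi> \<longrightarrow>
     \<bar>LINT x|P. \<psi> x * (soft \<epsilon> z i x - indicator (cell z' i) x)\<bar>
       \<le> C * rate \<alpha> \<epsilon> B H"
proof -
  have c2: "0 < c / 2" using c by simp
  obtain \<epsilon>0 where \<epsilon>0: "0 < \<epsilon>0" and gd: "\<forall>\<epsilon> z. 0 < \<epsilon> \<longrightarrow> \<epsilon> \<le> \<epsilon>0 \<longrightarrow> (\<forall>i. c \<le> (LINT x|P. soft \<epsilon> z i x)) \<longrightarrow> good (c / 2) z"
    using entropic_good[OF c] by (elim exE conjE)
  obtain C1 where C1: "0 \<le> C1" and cell: "\<forall>z i \<epsilon> \<psi> B H. good (c / 2) z \<longrightarrow> 0 < \<epsilon> \<longrightarrow> \<epsilon> < 1 \<longrightarrow>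
     \<psi> \<in> borel_measurable borel \<longrightarrow> (\<forall>x. \<bar>\<psi> x\<bar> \<le> B) \<longrightarrow> 0 \<le> H \<longrightarrow>
     hoelder_le \<alpha> H X \<psi> \<longrightarrow>
     \<bar>LINT x|P. \<psi> x * (soft \<epsilon> z i x - indicator (cell z i) x)\<bar>
       \<le> C1 * rate \<alpha> \<epsilon> B H"
    using soft_cell_bound[OF c2 \<alpha>] by (elim exE conjE)
  obtain C2 where C2: "0 \<le> C2" and stab: "\<forall>z z' i k. good (c / 2) z \<longrightarrow> good (c / 2) z' \<longrightarrow>
    (z' $ i - z $ i) - (z' $ k - z $ k) \<le> C2 * (\<Sum>l\<in>UNIV. \<bar>measure P (cell z' l) - measure P (cell z l)\<bar>)"
    using potential_stability[OF c2] by (elim exE conjE)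
  obtain C3 where C3: "0 \<le> C3" and diff: "\<forall>z z' i s. 0 \<le> s \<longrightarrow> (\<forall>j. \<bar>(z' $ i - z $ i) - (z' $ j - z $ j)\<bar> \<le> s) \<longrightarrow>
    (LINT x|P. \<bar>indicator (cell z i) x - indicator (cell z' i) x :: real\<bar>) \<le> C3 * s"
    using cell_difference_bound by (elim exE conjE)
  define N where "N = real CARD('n)"
  define C where "C = C1 + C3 * (C2 * (N * C1))"
  show ?thesis
  proof (rule exI[of _ C], intro conjI exI[of _ \<epsilon>0] allI impI \<epsilon>0)
    show "0 \<le> C" using C1 C2 C3 by (simp add: C_def N_def)
  next
    fix z z' :: "real^'n" and i \<epsilon> \<psi> B H
    assume \<epsilon>: "0 < \<epsilon>" "\<epsilon> \<le> \<epsilon>0" "\<epsilon> < 1"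
      and q: "\<forall>l. c \<le> measure P (cell z' l) \<and> measure P (cell z' l) = (LINT x|P. soft \<epsilon> z l x)"
      and \<psi>[measurable]: "\<psi> \<in> borel_measurable borel" and B: "\<forall>x. \<bar>\<psi> x\<bar> \<le> B" and H: "0 \<le> H"
      and hol: "hoelder_le \<alpha> H X \<psi>"
    let ?e = "\<epsilon>\<^sup>2 * (1 + (ln \<epsilon>)\<^sup>2)"
    let ?G = "\<lambda>z l. measure P (cell z l)"
    let ?I = "\<lambda>z x. indicator (cell z i) x :: real"
    have B0: "0 \<le> B" using B[rule_format, of undefined] by linarith
    have gz: "good (c / 2) z" by (rule gd[rule_format, OF \<epsilon>(1,2)]) (use q in metis)
    have gz': "good (c / 2) z'" unfolding good_def
    proof
      fix l
      have "c / 2 \<le> c" using c by simp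
      then show "c / 2 \<le> measure P (cell z' l)" using q[rule_format, of l] by linarith
    qed
    note ints = integrable_soft and intI = integrable_indicator_P
    \<comment> \<open>The test function 1 has \<open>H = 0\<close>, so the term in
      \<open>\<epsilon> powr (1 + \<alpha>)\<close> is absent from the distance between the
      potentials.\<close>
    have mass: "\<bar>?G z' l - ?G z l\<bar> \<le> C1 * ?e" for l
    proof -
      have "\<bar>LINT x|P. 1 * (soft \<epsilon> z l x - indicator (cell z l) x)\<bar> \<le> C1 * (1 * ?e + 0 * \<epsilon> powr (1 + \<alpha>))"
        by (rule cell[rule_format, OF gz \<epsilon>(1,3)]) auto
      moreover have "(LINT x|P. 1 * (soft \<epsilon> z l x - indicator (cell z l) x)) = ?G z' l - ?G z l"
        using q by (simp add: Bochner_Integration.integral_diff[OF ints intI])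
      ultimately show ?thesis by simp
    qed
    have "(\<Sum>l\<in>UNIV. \<bar>?G z' l - ?G z l\<bar>) \<le> (\<Sum>l\<in>(UNIV::'n set). C1 * ?e)" by (intro sum_mono mass)
    then have sm: "(\<Sum>l\<in>UNIV. \<bar>?G z' l - ?G z l\<bar>) \<le> N * C1 * ?e" by (simp add: N_def mult.assoc)
    have dz: "(z' $ j - z $ j) - (z' $ k - z $ k) \<le> C2 * (N * C1 * ?e)" for j k
      by (rule order_trans[OF stab[rule_format, OF gz gz'] mult_left_mono[OF sm C2]])
    have 0: "0 \<le> C2 * (N * C1 * ?e)" using C1 C2 by (simp add: N_def)
    have ID: "(LINT x|P. \<bar>?I z x - ?I z' x\<bar>) \<le> C3 * (C2 * (N * C1 * ?e))"
    proof (rule diff[rule_format, OF 0])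
      fix j show "\<bar>(z' $ i - z $ i) - (z' $ j - z $ j)\<bar> \<le> C2 * (N * C1 * ?e)"
        using dz[of i j] dz[of j i] by linarith
    qed
    have int1: "integrable P (\<lambda>x. \<psi> x * (soft \<epsilon> z i x - ?I z x))"
    proof (rule integrable_bounded[of _ "B * 1"])
      show "\<bar>\<psi> x * (soft \<epsilon> z i x - ?I z x)\<bar> \<le> B * 1" for x
        unfolding abs_mult using B B0 soft_pos[of \<epsilon> z i x] soft_le_1[of \<epsilon> z i x]
        by (intro mult_mono) (auto simp: indicator_def)
    qed measurable
    have int2: "integrable P (\<lambda>x. \<psi> x * (?I z x - ?I z' x))"
    proof (rule integrable_bounded[of _ "B * 1"])
      show "\<bar>\<psi> x * (?I z x - ?I z' x)\<bar> \<le> B * 1" for x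
        unfolding abs_mult using B B0 by (intro mult_mono) (auto simp: indicator_def)
    qed measurable
    have "(LINT x|P. \<psi> x * (soft \<epsilon> z i x - ?I z' x)) = (LINT x|P. \<psi> x * (soft \<epsilon> z i x - ?I z x) + \<psi> x * (?I z x - ?I z' x))"
      by (intro Bochner_Integration.integral_cong refl) (simp add: algebra_simps)
    also have "\<dots> = (LINT x|P. \<psi> x * (soft \<epsilon> z i x - ?I z x)) + (LINT x|P. \<psi> x * (?I z x - ?I z' x))"
      by (rule Bochner_Integration.integral_add[OF int1 int2])
    finally have split: "(LINT x|P. \<psi> x * (soft \<epsilon> z i x - ?I z' x)) = (LINT x|P. \<psi> x * (soft \<epsilon> z i x - ?I z x)) + (LINT x|P. \<psi> x * (?I z x - ?I z' x))" .
    have 1: "\<bar>LINT x|P. \<psi> x * (soft \<epsilon> z i x - ?I z x)\<bar> \<le> C1 * (B * ?e + H * \<epsilon> powr (1 + \<alpha>))"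
      by (rule cell[rule_format, OF gz \<epsilon>(1,3) \<psi> B[rule_format] H hol[rule_format]])
    have "\<bar>LINT x|P. \<psi> x * (?I z x - ?I z' x)\<bar> \<le> (LINT x|P. \<bar>\<psi> x * (?I z x - ?I z' x)\<bar>)" by (rule integral_abs_bound)
    also have "\<dots> \<le> (LINT x|P. B * \<bar>?I z x - ?I z' x\<bar>)"
    proof (rule integral_mono[OF integrable_abs[OF int2]])
      show "integrable P (\<lambda>x. B * \<bar>?I z x - ?I z' x\<bar>)"
        by (intro integrable_mult_right integrable_abs Bochner_Integration.integrable_diff intI) auto
      show "\<bar>\<psi> x * (?I z x - ?I z' x)\<bar> \<le> B * \<bar>?I z x - ?I z' x\<bar>" for x
        unfolding abs_mult using B by (intro mult_right_mono) auto
    qed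
    also have "\<dots> = B * (LINT x|P. \<bar>?I z x - ?I z' x\<bar>)" by simp
    also have "\<dots> \<le> B * (C3 * (C2 * (N * C1 * ?e)))" by (rule mult_left_mono[OF ID B0])
    also have "\<dots> = C3 * (C2 * (N * C1)) * (B * ?e)" by (simp add: mult_ac)
    also have "\<dots> \<le> C3 * (C2 * (N * C1)) * (B * ?e + H * \<epsilon> powr (1 + \<alpha>))"
      using C1 C2 C3 H by (intro mult_left_mono) (auto simp: N_def)
    finally show "\<bar>LINT x|P. \<psi> x * (soft \<epsilon> z i x - ?I z' x)\<bar> \<le> C * (B * ?e + H * \<epsilon> powr (1 + \<alpha>))"
      using 1 unfolding split C_def distrib_right by linarith
  qed
qed

lemma semidual_eq_energy: "semidual P Q y = energy (mx UNIV) (masses Q y)"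
  by (rule ext) (simp add: semidual_def energy_def mx_def D_def)

lemma entropic_semidual_eq_energy: "entropic_semidual P Q y \<epsilon> = energy (lse \<epsilon>) (masses Q y)"
  by (rule ext) (simp add: entropic_semidual_def energy_def lse_def D_def)

text \<open>The definite description requires uniqueness: two minimisers have equal cell masses, so
  by \<open>potential_stability\<close> they differ by a constant vector, which the normalisation
  forces to be zero.\<close>

lemma brenier_potential_masses:
  assumes c: "0 < c" and q: "\<And>i. c \<le> masses Q y $ i" "(\<Sum>i\<in>UNIV. masses Q y $ i) = 1"
  shows "measure P (cell (brenier_potential P Q y) i) = masses Q y $ i"
proof -
  let ?q = "masses Q y"
  let ?m = "is_arg_min (energy (mx UNIV) ?q) (\<lambda>z. z \<bullet> vec 1 = 0)"
  have "\<exists>!z. ?m z"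
  proof (rule ex_ex1I)
    show "\<exists>z. ?m z" by (rule energy_arg_min_exists[OF smax_like_mx c q])
  next
    fix z z' assume z: "?m z" "?m z'"
    have G: "measure P (cell z l) = ?q $ l" "measure P (cell z' l) = ?q $ l" for l
      using brenier_first_order[OF q(2) z(1)] brenier_first_order[OF q(2) z(2)] by auto
    then have g: "good c z" "good c z'" using q(1) by (auto simp: good_def)
    obtain K where K: "\<forall>z z' i k. good c z \<longrightarrow> good c z' \<longrightarrow>
      (z' $ i - z $ i) - (z' $ k - z $ k) \<le> K * (\<Sum>l\<in>UNIV. \<bar>measure P (cell z' l) - measure P (cell z l)\<bar>)"
      using potential_stability[OF c] by (elim exE conjE)
    have le: "(z' $ i - z $ i) - (z' $ k - z $ k) \<le> 0" for i k
      using K[rule_format, OF g, of i k] by (simp add: G)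
    have const: "z' $ i - z $ i = z' $ k - z $ k" for i k using le[of i k] le[of k i] by linarith
    have "(\<Sum>i\<in>UNIV. z' $ i - z $ i) = 0"
      using z by (simp add: is_arg_min_def inner_vec_def sum_subtractf)
    also have "(\<Sum>i\<in>UNIV. z' $ i - z $ i) = (\<Sum>i\<in>(UNIV::'n set). z' $ k - z $ k)" for k
      using const[of _ k] by (intro sum.cong) auto
    finally have "z' $ k - z $ k = 0" for k by simp
    then show "z = z'" by (simp add: vec_eq_iff)
  qed
  then have "?m (brenier_potential P Q y)"
    unfolding brenier_potential_def semidual_eq_energy by (rule theI')
  then show ?thesis by (rule brenier_first_order[OF q(2)])
qed

lemma entropic_potential_masses:
  assumes c: "0 < c" and q: "\<And>i. c \<le> masses Q y $ i" "(\<Sum>i\<in>UNIV. masses Q y $ i) = 1" and \<epsilon>: "0 < \<epsilon>"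
  shows "(LINT x|P. soft \<epsilon> (entropic_potential P Q y \<epsilon>) i x) = masses Q y $ i"
proof -
  let ?q = "masses Q y"
  let ?m = "is_arg_min (energy (lse \<epsilon>) ?q) (\<lambda>z. z \<bullet> vec 1 = 0)"
  have "\<exists>!z. ?m z"
  proof (rule ex_ex1I)
    show "\<exists>z. ?m z" by (rule energy_arg_min_exists[OF smax_like_lse[OF \<epsilon>] c q])
  next
    fix z z' assume z: "?m z" "?m z'"
    show "z = z'"
    proof (rule entropic_unique[OF \<epsilon>])
      show "(LINT x|P. soft \<epsilon> z i x) = (LINT x|P. soft \<epsilon> z' i x)" for i
        using entropic_first_order[OF \<epsilon> q(2) z(1)] entropic_first_order[OF \<epsilon> q(2) z(2)] by simp
    qed (use z in \<open>auto simp: is_arg_min_def\<close>)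
  qed
  then have "?m (entropic_potential P Q y \<epsilon>)"
    unfolding entropic_potential_def entropic_semidual_eq_energy by (rule theI')
  then show ?thesis by (rule entropic_first_order[OF \<epsilon> q(2)])
qed

lemma entropic_map_soft:
  "entropic_map P Q y \<epsilon> x = (\<Sum>i\<in>UNIV. soft \<epsilon> (entropic_potential P Q y \<epsilon>) i x *\<^sub>R y i)"
  by (simp add: entropic_map_def Let_def soft_def D_def)

text \<open>The value depends only on the set \<open>S\<close> of cells containing the point, and
  there are finitely many such sets. The empty one, which occurs off \<open>X\<close>, contributes
  the fixed value picked by \<open>SOME\<close>.\<close>

lemma brenier_map_measurable [measurable]: "brenier_map X P Q y \<in> borel_measurable borel"
proof -
  let ?c = "\<lambda>x. {i. x \<in> cell (brenier_potential P Q y) i}"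
  have "brenier_map X P Q y x = (\<Sum>S\<in>UNIV. indicator {x. \<forall>i. x \<in> cell (brenier_potential P Q y) i \<longleftrightarrow> i \<in> S} x *\<^sub>R y (SOME i. i \<in> S))" for x
  proof -
    have "(\<Sum>S\<in>UNIV. indicator {x. \<forall>i. x \<in> cell (brenier_potential P Q y) i \<longleftrightarrow> i \<in> S} x *\<^sub>R y (SOME i. i \<in> S))
      = (\<Sum>S\<in>UNIV. if S = ?c x then y (SOME i. i \<in> S) else 0)"
      by (intro sum.cong) (auto simp: indicator_def)
    also have "\<dots> = brenier_map X P Q y x" by (simp add: brenier_map_def)
    finally show ?thesis by simp
  qed
  moreover have "(\<lambda>x. \<Sum>S\<in>UNIV. indicator {x. \<forall>i. x \<in> cell (brenier_potential P Q y) i \<longleftrightarrow> i \<in> S} x *\<^sub>R y (SOME i. i \<in> S)) \<in> borel_measurable borel"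
    by measurable
  ultimately show ?thesis by (subst measurable_cong) auto
qed

lemma brenier_map_cells:
  "AE x in P. brenier_map X P Q y x = (\<Sum>i\<in>UNIV. indicator (cell (brenier_potential P Q y) i) x *\<^sub>R y i)"
proof -
  let ?z = "brenier_potential P Q y"
  have "AE x in P. x \<in> X \<and> (\<forall>i j. i \<noteq> j \<longrightarrow> D ?z i x \<noteq> D ?z j x)"
    using AE_X AE_no_ties[of ?z] by auto
  then show ?thesis
  proof (rule AE_mp, intro AE_I2 impI)
    fix x assume x: "x \<in> X \<and> (\<forall>i j. i \<noteq> j \<longrightarrow> D ?z i x \<noteq> D ?z j x)"
    have "x \<in> top_in ?z UNIV" using x by (simp add: top_in_UNIV)
    then obtain a where a: "x \<in> cell ?z a" by (auto simp: top_in_def cell_eq)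
    have uniq: "b = a" if "x \<in> cell ?z b" for b
    proof (rule ccontr)
      assume "b \<noteq> a"
      moreover have "D ?z a x = D ?z b x" using a that by (auto simp: cell_eq intro: antisym)
      ultimately show False using x by metis
    qed
    have "(SOME i. x \<in> cell ?z i) = a" by (rule some_equality, rule a, rule uniq)
    moreover have "(\<Sum>i\<in>UNIV. indicator (cell ?z i) x *\<^sub>R y i) = (\<Sum>i\<in>UNIV. if i = a then y i else 0)"
    proof (rule sum.cong[OF refl])
      fix i
      have "x \<in> cell ?z i \<longleftrightarrow> i = a" using a uniq[of i] by blast
      then show "indicator (cell ?z i) x *\<^sub>R y i = (if i = a then y i else 0)"
        by (simp add: indicator_def)
    qed
    ultimately show "brenier_map X P Q y x = (\<Sum>i\<in>UNIV. indicator (cell ?z i) x *\<^sub>R y i)"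
      by (simp add: brenier_map_def)
  qed
qed

end

section \<open>Total mass on the support and Hoelder fields\<close>

text \<open>The complement of the support is a union of open null sets; by Lindelof countably many
  of them suffice.\<close>

lemma measure_support_null:
  fixes Q :: "'a::second_countable_topology measure"
  assumes "sets Q = sets borel"
  shows "emeasure Q (- measure_support Q) = 0"
proof -
  let ?F = "{U. open U \<and> emeasure Q U = 0}"
  obtain F where F: "F \<subseteq> ?F" "countable F" "\<Union>F = \<Union>?F"
    using Lindelof[of ?F] by auto
  have "- measure_support Q = \<Union>?F" by (auto simp: measure_support_def not_gr_zero)
  also have "\<dots> = \<Union>F" using F by simp
  also have "emeasure Q (\<Union>F) = 0"
  proof -
    have "\<Union>F \<in> null_sets Q"
      using F assms by (intro null_sets_UN'[of F "\<lambda>x. x", simplified]) (auto simp: null_sets_def)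
    then show ?thesis by auto
  qed
  finally show ?thesis .
qed

lemma sum_masses:
  fixes y :: "'n::finite \<Rightarrow> 'a::euclidean_space"
  assumes Q: "prob_space Q" "sets Q = sets borel" "measure_support Q = range y" and "inj y"
  shows "(\<Sum>i\<in>UNIV. masses Q y $ i) = 1"
proof -
  interpret Q: prob_space Q by (rule Q)
  have sp: "space Q = UNIV" using sets_eq_imp_space_eq[OF Q(2)] by simp
  have "measure Q (- range y) = 0"
    using measure_support_null[OF Q(2)] Q(3) by (simp add: measure_def)
  then have "measure Q (range y) = 1"
    using Q.prob_compl[of "range y"] Q(2) by (simp add: sp Compl_eq_Diff_UNIV finite_imp_closed)
  moreover have "measure Q (range y) = (\<Sum>i\<in>UNIV. measure Q {y i})"
  proof -
    have "measure Q (\<Union>i. {y i}) = (\<Sum>i\<in>UNIV. measure Q {y i})"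
      using assms(4) Q(2) by (intro Q.finite_measure_finite_Union) (auto simp: disjoint_family_on_def inj_def)
    then show ?thesis by (simp add: UNION_singleton_eq_range)
  qed
  ultimately show ?thesis by (simp add: masses_def)
qed

text \<open>Supplies measurability: a field continuous on \<open>X\<close> becomes Borel after
  multiplication by the indicator of \<open>X\<close>.\<close>

lemma holder_continuous:
  fixes f :: "'a::real_normed_vector \<Rightarrow> 'b::real_normed_vector"
  assumes \<alpha>: "0 < \<alpha>" and H: "0 \<le> H"
    and hol: "\<And>u v. u \<in> X \<Longrightarrow> v \<in> X \<Longrightarrow> norm (f u - f v) \<le> H * norm (u - v) powr \<alpha>"
  shows "continuous_on X f"
  unfolding continuous_on_iff
proof (intro ballI allI impI)
  fix x e assume x: "x \<in> X" and e: "0 < (e::real)"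
  define d where "d = (e / (H + 1)) powr (1 / \<alpha>)"
  have d: "0 < d" "d powr \<alpha> = e / (H + 1)" using e H \<alpha> by (auto simp: d_def powr_powr)
  show "\<exists>d>0. \<forall>x'\<in>X. dist x' x < d \<longrightarrow> dist (f x') (f x) < e"
  proof (intro exI[of _ d] conjI ballI impI d(1))
    fix x' assume x': "x' \<in> X" "dist x' x < d"
    have "norm (f x' - f x) \<le> H * norm (x' - x) powr \<alpha>" by (rule hol[OF x'(1) x])
    also have "\<dots> \<le> H * d powr \<alpha>" using x' H \<alpha> by (intro mult_left_mono powr_mono2) (auto simp: dist_norm)
    also have "\<dots> < e" using e H by (simp add: d field_simps)
    finally show "dist (f x') (f x) < e" by (simp add: dist_norm)
  qed
qed

lemma holder_on_bounds:
  fixes \<phi> :: "'a::euclidean_space \<Rightarrow> 'b::real_normed_vector"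
  assumes hol: "holder_on \<alpha> X \<phi>" and X: "interior X \<noteq> {}"
  shows "x \<in> X \<Longrightarrow> norm (\<phi> x) \<le> sup_norm_on X \<phi>"
    and "u \<in> X \<Longrightarrow> v \<in> X \<Longrightarrow> norm (\<phi> u - \<phi> v) \<le> Sup (holder_quotients \<alpha> X \<phi>) * norm (u - v) powr \<alpha>"
    and "0 \<le> sup_norm_on X \<phi>" and "0 \<le> Sup (holder_quotients \<alpha> X \<phi>)"
proof -
  have bdd: "bdd_above ((\<lambda>x. norm (\<phi> x)) ` X)" "bdd_above (holder_quotients \<alpha> X \<phi>)"
    using hol by (auto simp: holder_on_def)
  show sup: "norm (\<phi> x) \<le> sup_norm_on X \<phi>" if "x \<in> X" for x
    unfolding sup_norm_on_def by (rule cSUP_upper[OF that bdd(1)])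
  have quot: "norm (\<phi> u - \<phi> v) / norm (u - v) powr \<alpha> \<le> Sup (holder_quotients \<alpha> X \<phi>)" if "u \<in> X" "v \<in> X" "u \<noteq> v" for u v
    by (rule cSup_upper[OF _ bdd(2)]) (use that in \<open>auto simp: holder_quotients_def\<close>)
  show "norm (\<phi> u - \<phi> v) \<le> Sup (holder_quotients \<alpha> X \<phi>) * norm (u - v) powr \<alpha>" if "u \<in> X" "v \<in> X"
    using quot[OF that] by (cases "u = v") (auto simp: pos_divide_le_eq)
  \<comment> \<open>Two distinct points of \<open>X\<close> are produced: the set of quotients is
    then nonempty, so its real supremum is not an unspecified value and inherits
    nonnegativity.\<close>
  obtain x r where r: "0 < r" "cball x r \<subseteq> X" using X by (auto simp: mem_interior_cball)
  obtain b :: 'a where b: "b \<in> Basis" using nonempty_Basis by blast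
  have x: "x \<in> X" "x + r *\<^sub>R b \<in> X" using r b by (auto simp: dist_norm)
  show "0 \<le> sup_norm_on X \<phi>" using sup[OF x(1)] norm_ge_zero[of "\<phi> x"] by linarith
  have "x \<noteq> x + r *\<^sub>R b" using r b by auto
  from quot[OF x this] show "0 \<le> Sup (holder_quotients \<alpha> X \<phi>)"
    by (rule order_trans[rotated]) auto
qed

text \<open>Both maps are combinations of the target points, so the pairing splits into scalar
  problems with test functions \<open>\<phi> x \<bullet> y i\<close>, whose sup bound and Hoelder
  constant grow by the factor \<open>Y\<close> at most.\<close>

lemma (in semidiscrete) L2_inner_bound:
  assumes c: "0 < c" and \<alpha>: "0 < \<alpha>" "\<alpha> \<le> 1"
  shows "\<exists>C>0. \<forall>Q \<phi> \<epsilon>. (\<forall>i. c \<le> masses Q y $ i) \<longrightarrow> (\<Sum>i\<in>UNIV. masses Q y $ i) = 1 \<longrightarrow> holder_on \<alpha> X \<phi> \<longrightarrow>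
    0 < \<epsilon> \<longrightarrow> \<epsilon> < 1 \<longrightarrow>
    \<bar>L2_inner_on X P \<phi> (\<lambda>x. entropic_map P Q y \<epsilon> x - brenier_map X P Q y x)\<bar>
      \<le> C * (sup_norm_on X \<phi> * (\<epsilon>\<^sup>2 * ln (1 / \<epsilon>) ^ 3) + holder_norm_on \<alpha> X \<phi> * \<epsilon> powr (1 + \<alpha>))"
proof -
  obtain C1 \<epsilon>0 where C1: "0 \<le> C1" and \<epsilon>0: "0 < \<epsilon>0" and key: "\<forall>z z' i \<epsilon> \<psi> B H. 0 < \<epsilon> \<longrightarrow> \<epsilon> \<le> \<epsilon>0 \<longrightarrow> \<epsilon> < 1 \<longrightarrow>
     (\<forall>l. c \<le> measure P (cell z' l) \<and> measure P (cell z' l) = (LINT x|P. soft \<epsilon> z l x)) \<longrightarrow>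
     \<psi> \<in> borel_measurable borel \<longrightarrow> (\<forall>x. \<bar>\<psi> x\<bar> \<le> B) \<longrightarrow> 0 \<le> H \<longrightarrow>
     hoelder_le \<alpha> H X \<psi> \<longrightarrow>
     \<bar>LINT x|P. \<psi> x * (soft \<epsilon> z i x - indicator (cell z' i) x)\<bar>
       \<le> C1 * rate \<alpha> \<epsilon> B H"
    using soft_brenier_bound[OF c \<alpha>] by (elim exE conjE)
  \<comment> \<open>Below \<open>exp (- 1)\<close> the logarithm \<open>ln (1 / \<epsilon>)\<close>
    is at least 1, so that \<open>1 + (ln \<epsilon>)\<^sup>2\<close> is at most twice its
    cube.\<close>
  define e where "e = min \<epsilon>0 (exp (- 1))"
  have e: "0 < e" "e \<le> \<epsilon>0" "e \<le> exp (- 1)" using \<epsilon>0 by (auto simp: e_def)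
  define N where "N = real CARD('n)"
  have N: "0 < N" by (simp add: N_def)
  \<comment> \<open>The first summand serves \<open>\<epsilon> \<le> e\<close>, the second the
    trivial bound for larger \<open>\<epsilon>\<close>.\<close>
  define C where "C = N * Y * (2 * C1) + N * Y / e\<^sup>2"
  have C: "0 < C" "N * Y * (2 * C1) \<le> C" "N * Y / e\<^sup>2 \<le> C" using C1 N Y_pos e by (auto simp: C_def add_nonneg_pos)
  show ?thesis
  proof (intro exI[of _ C] conjI allI impI C(1))
    fix Q :: "'a measure" and \<phi> :: "'a \<Rightarrow> 'a" and \<epsilon> :: real
    assume q: "\<forall>i. c \<le> masses Q y $ i" "(\<Sum>i\<in>UNIV. masses Q y $ i) = 1" and hol: "holder_on \<alpha> X \<phi>"
      and \<epsilon>: "0 < \<epsilon>" "\<epsilon> < 1"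
    define S where "S = sup_norm_on X \<phi>"
    define H where "H = Sup (holder_quotients \<alpha> X \<phi>)"
    note bounds = holder_on_bounds[OF hol X_interior, folded S_def H_def]
    have hn: "holder_norm_on \<alpha> X \<phi> = S + H" by (simp add: holder_norm_on_def S_def H_def)
    define z where "z = entropic_potential P Q y \<epsilon>"
    define z' where "z' = brenier_potential P Q y"
    have G': "measure P (cell z' l) = masses Q y $ l" for l
      unfolding z'_def by (rule brenier_potential_masses[OF c q(1)[rule_format] q(2)])
    have g: "(LINT x|P. soft \<epsilon> z l x) = masses Q y $ l" for l
      unfolding z_def by (rule entropic_potential_masses[OF c q(1)[rule_format] q(2) \<epsilon>(1)])
    define \<psi> where "\<psi> i x = indicator X x *\<^sub>R (\<phi> x \<bullet> y i)" for i x
    have cont: "continuous_on X \<phi>"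
      by (rule holder_continuous[OF \<alpha>(1) bounds(4) bounds(2)])
    have \<psi>m[measurable]: "\<psi> i \<in> borel_measurable borel" for i
      unfolding \<psi>_def by (intro borel_measurable_continuous_on_indicator continuous_intros cont) simp
    have \<psi>B: "\<bar>\<psi> i x\<bar> \<le> S * Y" for i x
    proof (cases "x \<in> X")
      case True
      have "\<bar>\<phi> x \<bullet> y i\<bar> \<le> norm (\<phi> x) * norm (y i)" by (rule Cauchy_Schwarz_ineq2)
      also have "\<dots> \<le> S * Y" using bounds(1)[OF True] bounds(3) y_Y[of i] by (intro mult_mono) auto
      finally show ?thesis using True by (simp add: \<psi>_def)
    qed (use bounds(3) Y_pos in \<open>simp add: \<psi>_def\<close>)
    have \<psi>H: "\<bar>\<psi> i u - \<psi> i v\<bar> \<le> (H * Y) * norm (u - v) powr \<alpha>" if uv: "u \<in> X" "v \<in> X" for i u v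
    proof -
      have "\<bar>\<psi> i u - \<psi> i v\<bar> = \<bar>(\<phi> u - \<phi> v) \<bullet> y i\<bar>" using uv by (simp add: \<psi>_def inner_diff_left)
      also have "\<dots> \<le> norm (\<phi> u - \<phi> v) * norm (y i)" by (rule Cauchy_Schwarz_ineq2)
      also have "\<dots> \<le> (H * norm (u - v) powr \<alpha>) * Y"
        using bounds(2)[OF uv] bounds(4) y_Y[of i] by (intro mult_mono) auto
      finally show ?thesis by (simp add: mult_ac)
    qed
    let ?d = "\<lambda>i x. soft \<epsilon> z i x - indicator (cell z' i) x :: real"
    have d1: "\<bar>?d i x\<bar> \<le> 1" for i x
      using soft_pos[of \<epsilon> z i x] soft_le_1[of \<epsilon> z i x] by (auto simp: indicator_def)
    have \<psi>d: "\<bar>\<psi> i x * ?d i x\<bar> \<le> (S * Y) * 1" for i x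
      unfolding abs_mult using \<psi>B[of i x] d1[of i x] bounds(3) Y_pos by (intro mult_mono) auto
    have int: "integrable P (\<lambda>x. \<psi> i x * ?d i x)" for i
      by (rule integrable_bounded[OF _ \<psi>d]) measurable
    have "L2_inner_on X P \<phi> (\<lambda>x. entropic_map P Q y \<epsilon> x - brenier_map X P Q y x)
      = (LINT x|P. indicator X x *\<^sub>R (\<phi> x \<bullet> (entropic_map P Q y \<epsilon> x - brenier_map X P Q y x)))"
      by (simp add: L2_inner_on_def set_lebesgue_integral_def)
    also have "\<dots> = (LINT x|P. (\<Sum>i\<in>UNIV. \<psi> i x * ?d i x))"
    proof -
      have eq: "AE x in P. indicator X x *\<^sub>R (\<phi> x \<bullet> (entropic_map P Q y \<epsilon> x - brenier_map X P Q y x)) = (\<Sum>i\<in>UNIV. \<psi> i x * ?d i x)"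
        using brenier_map_cells[of Q]
      proof (rule AE_mp, intro AE_I2 impI)
        fix x assume "brenier_map X P Q y x = (\<Sum>i\<in>UNIV. indicator (cell (brenier_potential P Q y) i) x *\<^sub>R y i)"
        then have "entropic_map P Q y \<epsilon> x - brenier_map X P Q y x = (\<Sum>i\<in>UNIV. ?d i x *\<^sub>R y i)"
          by (simp add: entropic_map_soft z_def z'_def sum_subtractf scaleR_diff_left)
        then show "indicator X x *\<^sub>R (\<phi> x \<bullet> (entropic_map P Q y \<epsilon> x - brenier_map X P Q y x)) = (\<Sum>i\<in>UNIV. \<psi> i x * ?d i x)"
          by (simp add: \<psi>_def inner_sum_right sum_distrib_left mult_ac)
      qed
      have [measurable]: "(\<lambda>x. indicator X x *\<^sub>R \<phi> x) \<in> borel_measurable borel"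
        by (intro borel_measurable_continuous_on_indicator cont) simp
      have "(\<lambda>x. (indicator X x *\<^sub>R \<phi> x) \<bullet> (entropic_map P Q y \<epsilon> x - brenier_map X P Q y x)) \<in> borel_measurable borel"
        unfolding entropic_map_soft by measurable
      then have "(\<lambda>x. indicator X x *\<^sub>R (\<phi> x \<bullet> (entropic_map P Q y \<epsilon> x - brenier_map X P Q y x))) \<in> borel_measurable P"
        by simp
      then show ?thesis by (rule integral_cong_AE[OF _ _ eq]) measurable
    qed
    also have "\<dots> = (\<Sum>i\<in>UNIV. LINT x|P. \<psi> i x * ?d i x)"
      by (rule Bochner_Integration.integral_sum) (rule int)
    finally have L2: "\<bar>L2_inner_on X P \<phi> (\<lambda>x. entropic_map P Q y \<epsilon> x - brenier_map X P Q y x)\<bar>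
      \<le> (\<Sum>i\<in>UNIV. \<bar>LINT x|P. \<psi> i x * ?d i x\<bar>)" by (simp only: sum_abs)
    let ?l = "\<epsilon>\<^sup>2 * ln (1 / \<epsilon>) ^ 3" and ?p = "\<epsilon> powr (1 + \<alpha>)"
    have l0: "0 \<le> ln (1 / \<epsilon>)" using \<epsilon> by simp
    have "\<bar>L2_inner_on X P \<phi> (\<lambda>x. entropic_map P Q y \<epsilon> x - brenier_map X P Q y x)\<bar> \<le> C * (S * ?l + (S + H) * ?p)"
    proof (cases "\<epsilon> \<le> e")
      case True
      have "\<bar>LINT x|P. \<psi> i x * ?d i x\<bar> \<le> C1 * ((S * Y) * (\<epsilon>\<^sup>2 * (1 + (ln \<epsilon>)\<^sup>2)) + (H * Y) * ?p)" for i
        using True e q(1) \<psi>B \<psi>H bounds(4) Y_pos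
        by (intro key[rule_format, OF \<epsilon>(1) _ \<epsilon>(2)]) (auto simp: G' g)
      then have "(\<Sum>i\<in>UNIV. \<bar>LINT x|P. \<psi> i x * ?d i x\<bar>) \<le> (\<Sum>i\<in>(UNIV::'n set). C1 * ((S * Y) * (\<epsilon>\<^sup>2 * (1 + (ln \<epsilon>)\<^sup>2)) + (H * Y) * ?p))"
        by (intro sum_mono)
      also have "\<dots> = N * Y * C1 * (S * (\<epsilon>\<^sup>2 * (1 + (ln \<epsilon>)\<^sup>2)) + H * ?p)" by (simp add: N_def algebra_simps)
      also have "\<dots> \<le> N * Y * C1 * (S * (\<epsilon>\<^sup>2 * (2 * ln (1 / \<epsilon>) ^ 3)) + H * ?p)"
      proof -
        have "ln \<epsilon> \<le> ln (exp (- 1))" using True e \<epsilon> by (intro ln_mono) auto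
        then have l1: "1 \<le> ln (1 / \<epsilon>)" using \<epsilon> by (simp add: ln_div)
        have "1 ^ 2 \<le> ln (1 / \<epsilon>) ^ 2" using l1 by (intro power_mono) auto
        moreover have "ln (1 / \<epsilon>) ^ 2 \<le> ln (1 / \<epsilon>) ^ 3" using l1 by (intro power_increasing) auto
        moreover have "(ln \<epsilon>)\<^sup>2 = ln (1 / \<epsilon>) ^ 2" using \<epsilon> by (simp add: ln_div)
        ultimately have "1 + (ln \<epsilon>)\<^sup>2 \<le> 2 * ln (1 / \<epsilon>) ^ 3" by simp
        then show ?thesis using N Y_pos C1 bounds(3)
          by (intro mult_left_mono add_right_mono) auto
      qed
      also have "\<dots> \<le> N * Y * C1 * (2 * (S * ?l + (S + H) * ?p))"
      proof -
        have "0 \<le> S * ?p" "0 \<le> H * ?p" using bounds by auto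
        then have "S * (\<epsilon>\<^sup>2 * (2 * ln (1 / \<epsilon>) ^ 3)) + H * ?p \<le> 2 * (S * ?l + (S + H) * ?p)"
          by (simp add: algebra_simps)
        then show ?thesis using N Y_pos C1 by (intro mult_left_mono) auto
      qed
      also have "\<dots> = N * Y * (2 * C1) * (S * ?l + (S + H) * ?p)" by (simp add: mult_ac)
      also have "\<dots> \<le> C * (S * ?l + (S + H) * ?p)"
        using C(2) bounds(3,4) l0 by (intro mult_right_mono) auto
      finally show ?thesis using L2 by linarith
    next
      case False
      have "\<bar>LINT x|P. \<psi> i x * ?d i x\<bar> \<le> S * Y" for i
      proof -
        have "\<bar>LINT x|P. \<psi> i x * ?d i x\<bar> \<le> (LINT x|P. \<bar>\<psi> i x * ?d i x\<bar>)" by (rule integral_abs_bound)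
        also have "\<dots> \<le> S * Y * 1" using \<psi>d by (intro P.integral_le_const integrable_abs int) auto
        finally show ?thesis by simp
      qed
      then have "(\<Sum>i\<in>UNIV. \<bar>LINT x|P. \<psi> i x * ?d i x\<bar>) \<le> (\<Sum>i\<in>(UNIV::'n set). S * Y)" by (intro sum_mono)
      also have "\<dots> = N * Y / e\<^sup>2 * (S * e\<^sup>2)" using e by (simp add: N_def)
      also have "\<dots> \<le> C * (S * ?l + (S + H) * ?p)"
      \<comment> \<open>The cubed logarithm vanishes as \<open>\<epsilon>\<close> tends to 1, so
        here the sup norm has to be absorbed by the Hoelder term, using \<open>e\<^sup>2 \<le>
        \<epsilon>\<^sup>2 \<le> \<epsilon> powr (1 + \<alpha>)\<close>.\<close>
      proof (rule mult_mono[OF C(3)])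
        have "e\<^sup>2 \<le> \<epsilon>\<^sup>2" using False e by (intro power_mono) auto
        also have "\<epsilon>\<^sup>2 = \<epsilon> powr 2" using \<epsilon> by simp
        also have "\<dots> \<le> ?p" using \<epsilon> \<alpha> by (intro powr_mono') auto
        finally have "S * e\<^sup>2 \<le> S * ?p" using bounds(3) by (intro mult_left_mono)
        moreover have "0 \<le> S * ?l" "0 \<le> H * ?p" using bounds l0 by auto
        ultimately show "S * e\<^sup>2 \<le> S * ?l + (S + H) * ?p" by (simp add: distrib_right)
      qed (use C bounds in auto)
      finally show ?thesis using L2 by linarith
    qed
    then show "\<bar>L2_inner_on X P \<phi> (\<lambda>x. entropic_map P Q y \<epsilon> x - brenier_map X P Q y x)\<bar>
      \<le> C * (sup_norm_on X \<phi> * ?l + holder_norm_on \<alpha> X \<phi> * ?p)" by (simp add: hn S_def)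
  qed
qed

theorem theorem1:
  fixes \<alpha> c0 :: real
    and X :: "'a::euclidean_space set"
    and P :: "'a measure"
    and \<rho> :: "'a \<Rightarrow> real"
    and y :: "'n::finite \<Rightarrow> 'a"
  assumes "0 < \<alpha>" "\<alpha> \<le> 1"
    and "compact X" "convex X" "interior X \<noteq> {}"
    and "prob_space P"
    and "measure_support P = X"
    and "P = density lborel (\<lambda>x. ennreal (\<rho> x) * indicator X x)"
    and "\<exists>L. L-lipschitz_on X \<rho>"
    and "\<And>x. x \<in> X \<Longrightarrow> 0 < \<rho> x"
    and "inj y"
    and "0 < c0" "c0 < 1"
  shows "\<exists>C>0. \<forall>(Q :: 'a measure) (\<phi> :: 'a \<Rightarrow> 'a).
           prob_space Q \<and> sets Q = sets borel \<and> measure_support Q = range y \<and>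
           (MIN i\<in>UNIV. measure Q {y i}) \<ge> c0 \<and> holder_on \<alpha> X \<phi> \<longrightarrow>
           (\<forall>\<epsilon>. 0 < \<epsilon> \<and> \<epsilon> < 1 \<longrightarrow>
              \<bar>L2_inner_on X P \<phi> (\<lambda>x. entropic_map P Q y \<epsilon> x - brenier_map X P Q y x)\<bar>
                \<le> C * (sup_norm_on X \<phi> * (\<epsilon>\<^sup>2 * ln (1 / \<epsilon>) ^ 3)
                       + holder_norm_on \<alpha> X \<phi> * \<epsilon> powr (1 + \<alpha>)))"
proof -
  obtain L where L: "L-lipschitz_on X \<rho>" using assms(9) by blast
  have X0: "X \<noteq> {}" using assms(5) by auto
  have cont: "continuous_on X \<rho>" using L by (rule lipschitz_on_continuous_on)
  obtain xm where xm: "xm \<in> X" "\<And>x. x \<in> X \<Longrightarrow> \<rho> xm \<le> \<rho> x"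
    using continuous_attains_inf[OF assms(3) X0 cont] by blast
  obtain xM where xM: "xM \<in> X" "\<And>x. x \<in> X \<Longrightarrow> \<rho> x \<le> \<rho> xM"
    using continuous_attains_sup[OF assms(3) X0 cont] by blast
  obtain R where R: "0 < R" "\<And>x. x \<in> X \<Longrightarrow> norm x \<le> R"
    using compact_imp_bounded[OF assms(3)] by (auto simp: bounded_pos)
  \<comment> \<open>The added 1 makes \<open>Y\<close> positive even when the only target is the
    origin.\<close>
  define Y where "Y = (\<Sum>i\<in>UNIV. norm (y i)) + 1"
  have Y: "norm (y i) \<le> Y" for i
  proof -
    have "norm (y i) \<le> (\<Sum>i\<in>UNIV. norm (y i))" by (rule member_le_sum) auto
    then show ?thesis by (simp add: Y_def)
  qed
  have "0 \<le> (\<Sum>i\<in>UNIV. norm (y i))" by (intro sum_nonneg) simp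
  then have Y0: "0 < Y" by (simp add: Y_def)
  interpret semidiscrete X P \<rho> y R "\<rho> xM" "\<rho> xm" L Y
  proof (rule semidiscrete.intro)
    show "\<bar>\<rho> x - \<rho> x'\<bar> \<le> L * norm (x - x')" if "x \<in> X" "x' \<in> X" for x x'
      using lipschitz_onD[OF L that] by (simp add: dist_real_def dist_norm)
    show "X \<subseteq> cball 0 R" using R by auto
    show "0 \<le> L" using L by (rule lipschitz_on_nonneg)
    show "0 < \<rho> xm" using assms(10) xm by blast
    show "\<rho> xm \<le> \<rho> x \<and> \<rho> x \<le> \<rho> xM" if "x \<in> X" for x using xm xM that by blast
  qed (fact assms R Y Y0)+
  obtain C where C: "0 < C" and bound: "\<forall>Q \<phi> \<epsilon>. (\<forall>i. c0 \<le> masses Q y $ i) \<longrightarrow> (\<Sum>i\<in>UNIV. masses Q y $ i) = 1 \<longrightarrow> holder_on \<alpha> X \<phi> \<longrightarrow>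
    0 < \<epsilon> \<longrightarrow> \<epsilon> < 1 \<longrightarrow>
    \<bar>L2_inner_on X P \<phi> (\<lambda>x. entropic_map P Q y \<epsilon> x - brenier_map X P Q y x)\<bar>
      \<le> C * (sup_norm_on X \<phi> * (\<epsilon>\<^sup>2 * ln (1 / \<epsilon>) ^ 3) + holder_norm_on \<alpha> X \<phi> * \<epsilon> powr (1 + \<alpha>))"
    using L2_inner_bound[OF assms(12) assms(1,2)] by (elim exE conjE)
  show ?thesis
  proof (intro exI[of _ C] conjI allI impI C)
    fix Q :: "'a measure" and \<phi> :: "'a \<Rightarrow> 'a" and \<epsilon> :: real
    assume Q: "prob_space Q \<and> sets Q = sets borel \<and> measure_support Q = range y \<and>
           (MIN i\<in>UNIV. measure Q {y i}) \<ge> c0 \<and> holder_on \<alpha> X \<phi>" and \<epsilon>: "0 < \<epsilon> \<and> \<epsilon> < 1"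
    show "\<bar>L2_inner_on X P \<phi> (\<lambda>x. entropic_map P Q y \<epsilon> x - brenier_map X P Q y x)\<bar>
      \<le> C * (sup_norm_on X \<phi> * (\<epsilon>\<^sup>2 * ln (1 / \<epsilon>) ^ 3) + holder_norm_on \<alpha> X \<phi> * \<epsilon> powr (1 + \<alpha>))"
    proof (rule bound[rule_format])
      show "c0 \<le> masses Q y $ i" for i
        using Q by (simp add: masses_def)
      show "(\<Sum>i\<in>UNIV. masses Q y $ i) = 1"
        using Q assms(11) by (intro sum_masses) auto
    qed (use Q \<epsilon> in auto)
  qed
qed

end
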